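(* Let $T$ be a complete first-order theory with monster model $\mathfrak{C}$. Suppose that $p\in S(B)$ does not co-fork over some $A\subseteq B$. Then $\mathrm{dpr}(p)=\mathrm{dpr}(p\restriction A)$.
   Context: $T$ is a complete first-order theory and $\mathfrak{C}$ is its monster model; all parameter sets are subsets of $\mathfrak{C}$. Tuples may be infinite. A type $\mathrm{tp}(a/B)$ co-forks over $A\subseteq B$ if $\mathrm{tp}(B/aA)$ forks over $A$. dp-rank: for a partial type $\Sigma(x)$ over $A$ and a cardinal $\kappa$, $\mathrm{dpr}(\Sigma)<\kappa$ if for every family $(I_\alpha)_{\alpha<\kappa}$ of $A$-mutually indiscernible infinite sequences and every $b\models\Sigma$ there is $\beta<\kappa$ such that $I_\beta$ is indiscernible over $bA$; otherwise $\mathrm{dpr}(\Sigma)\ge\kappa$. (This does not depend on the set $A$ containing the parameters of $\Sigma$.) $\mathrm{dpr}(\Sigma)=\mathrm{dpr}(\Sigma')$ means that for every cardinal $\kappa$, $\mathrm{dpr}(\Sigma)<\kappa$ iff $\mathrm{dpr}(\Sigma')<\kappa$. *)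

theory Defs
  imports Main
begin

unbundle cardinal_syntax

section \<open>First-order logic\<close>

text \<open>
  A symbol belongs to the language iff its arity is defined, so that languages without
  function symbols or without relation symbols are covered.
\<close>

record ('f, 'r) lang =
  fun_ar :: "'f \<Rightarrow> nat option"
  rel_ar :: "'r \<Rightarrow> nat option"

datatype ('f, 'v) trm =
    Var 'v
  | App 'f "('f, 'v) trm list"

datatype ('f, 'r, 'v) fml =
    Eq "('f, 'v) trm" "('f, 'v) trm"
  | Rel 'r "('f, 'v) trm list"
  | Neg "('f, 'r, 'v) fml"
  | Conj "('f, 'r, 'v) fml" "('f, 'r, 'v) fml"
  | Exi 'v "('f, 'r, 'v) fml"

fun tvars :: "('f, 'v) trm \<Rightarrow> 'v set" where
  "tvars (Var x) = {x}"
| "tvars (App f ts) = (\<Union>t\<in>set ts. tvars t)"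

primrec fv :: "('f, 'r, 'v) fml \<Rightarrow> 'v set" where
  "fv (Eq t u) = tvars t \<union> tvars u"
| "fv (Rel r ts) = (\<Union>t\<in>set ts. tvars t)"
| "fv (Neg \<phi>) = fv \<phi>"
| "fv (Conj \<phi> \<psi>) = fv \<phi> \<union> fv \<psi>"
| "fv (Exi x \<phi>) = fv \<phi> - {x}"

fun wf_trm :: "('f, 'r) lang \<Rightarrow> ('f, 'v) trm \<Rightarrow> bool" where
  "wf_trm L (Var x) \<longleftrightarrow> True"
| "wf_trm L (App f ts) \<longleftrightarrow> fun_ar L f = Some (length ts) \<and> (\<forall>t\<in>set ts. wf_trm L t)"

primrec wf_fml :: "('f, 'r) lang \<Rightarrow> ('f, 'r, 'v) fml \<Rightarrow> bool" where
  "wf_fml L (Eq t u) \<longleftrightarrow> wf_trm L t \<and> wf_trm L u"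
| "wf_fml L (Rel r ts) \<longleftrightarrow> rel_ar L r = Some (length ts) \<and> (\<forall>t\<in>set ts. wf_trm L t)"
| "wf_fml L (Neg \<phi>) \<longleftrightarrow> wf_fml L \<phi>"
| "wf_fml L (Conj \<phi> \<psi>) \<longleftrightarrow> wf_fml L \<phi> \<and> wf_fml L \<psi>"
| "wf_fml L (Exi x \<phi>) \<longleftrightarrow> wf_fml L \<phi>"

definition forms :: "('f, 'r) lang \<Rightarrow> 'v set \<Rightarrow> ('f, 'r, 'v) fml set" where
  "forms L X = {\<phi>. wf_fml L \<phi> \<and> fv \<phi> \<subseteq> X}"

text \<open>
  The universe of a structure is the whole type \<open>'m\<close>; the interpretation of a symbol is
  relevant only on lists of the right length.
\<close>

record ('f, 'r, 'm) struc =
  fun_int :: "'f \<Rightarrow> 'm list \<Rightarrow> 'm"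
  rel_int :: "'r \<Rightarrow> 'm list \<Rightarrow> bool"

primrec trm_val :: "('f, 'r, 'm) struc \<Rightarrow> ('v \<Rightarrow> 'm) \<Rightarrow> ('f, 'v) trm \<Rightarrow> 'm" where
  "trm_val M s (Var x) = s x"
| "trm_val M s (App f ts) = fun_int M f (map (trm_val M s) ts)"

primrec sat :: "('f, 'r, 'm) struc \<Rightarrow> ('v \<Rightarrow> 'm) \<Rightarrow> ('f, 'r, 'v) fml \<Rightarrow> bool" where
  "sat M s (Eq t u) \<longleftrightarrow> trm_val M s t = trm_val M s u"
| "sat M s (Rel r ts) \<longleftrightarrow> rel_int M r (map (trm_val M s) ts)"
| "sat M s (Neg \<phi>) \<longleftrightarrow> \<not> sat M s \<phi>"
| "sat M s (Conj \<phi> \<psi>) \<longleftrightarrow> sat M s \<phi> \<and> sat M s \<psi>"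
| "sat M s (Exi x \<phi>) \<longleftrightarrow> (\<exists>a. sat M (s(x := a)) \<phi>)"

text \<open>
  Theories are identified with their deductive closures, so a complete theory decides
  every sentence by membership; consistency comes with the model in \<open>monster_model\<close> below.
\<close>

definition complete_theory :: "('f, 'r) lang \<Rightarrow> ('f, 'r, nat) fml set \<Rightarrow> bool" where
  "complete_theory L T \<longleftrightarrow>
     T \<subseteq> forms L {} \<and> (\<forall>\<sigma>\<in>forms L {}. (\<sigma> \<in> T) \<noteq> (Neg \<sigma> \<in> T))"

definition is_model :: "('f, 'r, 'm) struc \<Rightarrow> ('f, 'r, nat) fml set \<Rightarrow> bool" where
  "is_model M T \<longleftrightarrow> (\<forall>\<sigma>\<in>T. \<forall>s. sat M s \<sigma>)"


section \<open>Parameters and types\<close>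

text \<open>The language \<open>L(B)\<close>: the symbol \<open>Inr b\<close> is a constant naming \<open>b\<close>.\<close>

definition lang_over :: "('f, 'r) lang \<Rightarrow> 'm set \<Rightarrow> ('f + 'm, 'r) lang" where
  "lang_over L B =
     \<lparr>fun_ar = case_sum (fun_ar L) (\<lambda>b. if b \<in> B then Some 0 else None), rel_ar = rel_ar L\<rparr>"

definition named :: "('f, 'r, 'm) struc \<Rightarrow> ('f + 'm, 'r, 'm) struc" where
  "named M = \<lparr>fun_int = case_sum (fun_int M) (\<lambda>b _. b), rel_int = rel_int M\<rparr>"

text \<open>
  A tuple indexed by \<open>X :: 'v set\<close> is a function on \<open>'v\<close> of which only the values on \<open>X\<close>
  matter; a type in the variables \<open>X\<close> is a set of formulas with free variables in \<open>X\<close>.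
\<close>

definition realizes ::
  "('f, 'r, 'm) struc \<Rightarrow> ('v \<Rightarrow> 'm) \<Rightarrow> ('f + 'm, 'r, 'v) fml set \<Rightarrow> bool" where
  "realizes M a \<Sigma> \<longleftrightarrow> (\<forall>\<phi>\<in>\<Sigma>. sat (named M) a \<phi>)"

definition fin_sat :: "('f, 'r, 'm) struc \<Rightarrow> ('f + 'm, 'r, 'v) fml set \<Rightarrow> bool" where
  "fin_sat M \<Sigma> \<longleftrightarrow> (\<forall>\<Delta>\<subseteq>\<Sigma>. finite \<Delta> \<longrightarrow> (\<exists>a. realizes M a \<Delta>))"

definition tp :: "('f, 'r) lang \<Rightarrow> ('f, 'r, 'm) struc \<Rightarrow> 'v set \<Rightarrow> ('v \<Rightarrow> 'm) \<Rightarrow> 'm set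
    \<Rightarrow> ('f + 'm, 'r, 'v) fml set" where
  "tp L M X a B = {\<phi> \<in> forms (lang_over L B) X. sat (named M) a \<phi>}"

definition complete_types :: "('f, 'r) lang \<Rightarrow> ('f, 'r, 'm) struc \<Rightarrow> 'v set \<Rightarrow> 'm set
    \<Rightarrow> ('f + 'm, 'r, 'v) fml set set" where
  "complete_types L M X B =
     {p. p \<subseteq> forms (lang_over L B) X \<and> fin_sat M p \<and>
         (\<forall>\<phi>\<in>forms (lang_over L B) X. \<phi> \<in> p \<or> Neg \<phi> \<in> p)}"

definition restrict_type :: "('f, 'r) lang \<Rightarrow> ('f + 'm, 'r, 'v) fml set \<Rightarrow> 'm set
    \<Rightarrow> ('f + 'm, 'r, 'v) fml set" where
  "restrict_type L p A = {\<phi> \<in> p. wf_fml (lang_over L A) \<phi>}"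


section \<open>Monster models\<close>

definition small :: "'k rel \<Rightarrow> 'a set \<Rightarrow> bool" where
  "small \<kappa> S \<longleftrightarrow> |S| <o \<kappa>"

definition saturated :: "'k rel \<Rightarrow> ('f, 'r) lang \<Rightarrow> ('f, 'r, 'm) struc \<Rightarrow> bool" where
  "saturated \<kappa> L M \<longleftrightarrow>
     (\<forall>A (\<Sigma> :: ('f + 'm, 'r, nat) fml set).
        small \<kappa> A \<and> \<Sigma> \<subseteq> forms (lang_over L A) {0} \<and> fin_sat M \<Sigma> \<longrightarrow> (\<exists>a. realizes M a \<Sigma>))"

definition elementary_on ::
  "('f, 'r) lang \<Rightarrow> ('f, 'r, 'm) struc \<Rightarrow> 'm set \<Rightarrow> ('m \<Rightarrow> 'm) \<Rightarrow> bool" where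
  "elementary_on L M A g \<longleftrightarrow>
     (\<forall>(\<phi> :: ('f, 'r, nat) fml) s.
        wf_fml L \<phi> \<and> s ` fv \<phi> \<subseteq> A \<longrightarrow> (sat M s \<phi> \<longleftrightarrow> sat M (g \<circ> s) \<phi>))"

definition automorphism :: "('f, 'r) lang \<Rightarrow> ('f, 'r, 'm) struc \<Rightarrow> ('m \<Rightarrow> 'm) \<Rightarrow> bool" where
  "automorphism L M h \<longleftrightarrow> bij h \<and>
     (\<forall>f as. fun_ar L f = Some (length as) \<longrightarrow> h (fun_int M f as) = fun_int M f (map h as)) \<and>
     (\<forall>r as. rel_ar L r = Some (length as) \<longrightarrow> (rel_int M r (map h as) \<longleftrightarrow> rel_int M r as))"

definition strongly_homogeneous ::
  "'k rel \<Rightarrow> ('f, 'r) lang \<Rightarrow> ('f, 'r, 'm) struc \<Rightarrow> bool" where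
  "strongly_homogeneous \<kappa> L M \<longleftrightarrow>
     (\<forall>A g. small \<kappa> A \<and> elementary_on L M A g \<longrightarrow>
        (\<exists>h. automorphism L M h \<and> (\<forall>a\<in>A. h a = g a)))"

text \<open>
  The monster model comes with a cardinal \<open>\<kappa>\<close> larger than \<open>|T|\<close> (the number of
  \<open>L\<close>-formulas); parameter sets, tuples, index sets and cardinals are small, that is,
  of size less than \<open>\<kappa>\<close>. As \<open>\<kappa>\<close> is a cardinal on the type \<open>'v\<close>, every small index set
  and every small linear order has a copy inside \<open>'v\<close>, and every cardinal below \<open>\<kappa>\<close>
  is represented by a relation on \<open>'v\<close>.
\<close>

definition monster_model :: "'k rel \<Rightarrow> ('f, 'r) lang \<Rightarrow> ('f, 'r, nat) fml set
    \<Rightarrow> ('f, 'r, 'm) struc \<Rightarrow> bool" where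
  "monster_model \<kappa> L T M \<longleftrightarrow>
     Card_order \<kappa> \<and> |{\<phi> :: ('f, 'r, nat) fml. wf_fml L \<phi>}| <o \<kappa> \<and>
     is_model M T \<and> saturated \<kappa> L M \<and> strongly_homogeneous \<kappa> L M"


section \<open>Dividing, forking and co-forking\<close>

text \<open>
  A formula \<open>\<phi>(x, b)\<close> with parameters is given by an \<open>L\<close>-formula \<open>\<phi>\<close> whose variables
  \<open>Inl x\<close> are the object variables and whose variables \<open>Inr n\<close> are to be replaced by the
  parameters \<open>b n\<close>.
\<close>

definition divides :: "('f, 'r) lang \<Rightarrow> ('f, 'r, 'm) struc \<Rightarrow> ('f, 'r, 'v + nat) fml
    \<Rightarrow> (nat \<Rightarrow> 'm) \<Rightarrow> 'm set \<Rightarrow> bool" where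
  "divides L M \<phi> b A \<longleftrightarrow>
     (\<exists>(k::nat) (c :: nat \<Rightarrow> nat \<Rightarrow> 'm).
        (\<forall>i. tp L M {n. Inr n \<in> fv \<phi>} (c i) A = tp L M {n. Inr n \<in> fv \<phi>} b A) \<and>
        (\<forall>S. finite S \<and> card S = k \<longrightarrow> \<not> (\<exists>a. \<forall>i\<in>S. sat M (case_sum a (c i)) \<phi>)))"

definition forks :: "('f, 'r) lang \<Rightarrow> ('f, 'r, 'm) struc \<Rightarrow> 'v set
    \<Rightarrow> ('f + 'm, 'r, 'v) fml set \<Rightarrow> 'm set \<Rightarrow> bool" where
  "forks L M X \<Sigma> A \<longleftrightarrow>
     (\<exists>D. finite D \<and>
        (\<forall>(\<phi>, b)\<in>D. \<phi> \<in> forms L (X <+> UNIV) \<and> divides L M \<phi> b A) \<and>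
        (\<forall>a. realizes M a \<Sigma> \<longrightarrow> (\<exists>(\<phi>, b)\<in>D. sat M (case_sum a b) \<phi>)))"

text \<open>
  The set \<open>B\<close> is turned into a tuple by an enumeration \<open>e\<close>; which one is immaterial.
\<close>

definition tp_co_forks :: "('f, 'r) lang \<Rightarrow> ('f, 'r, 'm) struc \<Rightarrow> 'v set \<Rightarrow> ('v \<Rightarrow> 'm)
    \<Rightarrow> 'm set \<Rightarrow> 'm set \<Rightarrow> bool" where
  "tp_co_forks L M X a B A \<longleftrightarrow>
     (\<exists>(Y :: 'v set) e. bij_betw e Y B \<and> forks L M Y (tp L M Y e (a ` X \<union> A)) A)"

text \<open>By homogeneity the choice of the realization is immaterial as well.\<close>

definition co_forks :: "('f, 'r) lang \<Rightarrow> ('f, 'r, 'm) struc \<Rightarrow> 'v set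
    \<Rightarrow> ('f + 'm, 'r, 'v) fml set \<Rightarrow> 'm set \<Rightarrow> 'm set \<Rightarrow> bool" where
  "co_forks L M X p B A \<longleftrightarrow> (\<exists>a. realizes M a p \<and> tp_co_forks L M X a B A)"


section \<open>Indiscernible sequences and dp-rank\<close>

text \<open>
  A sequence of (possibly infinite) tuples: \<open>idx\<close> is the index set, linearly ordered by
  the reflexive relation \<open>ord\<close>, and the term at \<open>i\<close> is the tuple \<open>trm_at i\<close> indexed by \<open>coords\<close>.
\<close>

record ('v, 'm) seq =
  idx :: "'v set"
  ord :: "'v rel"
  coords :: "'v set"
  trm_at :: "'v \<Rightarrow> 'v \<Rightarrow> 'm"

definition infinite_seq :: "'v rel \<Rightarrow> ('v, 'm) seq \<Rightarrow> bool" where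
  "infinite_seq \<kappa> I \<longleftrightarrow>
     infinite (idx I) \<and> linear_order_on (idx I) (ord I) \<and> small \<kappa> (idx I) \<and> small \<kappa> (coords I)"

definition seq_elems :: "('v, 'm) seq \<Rightarrow> 'm set" where
  "seq_elems I = (\<Union>i\<in>idx I. trm_at I i ` coords I)"

definition increasing :: "('v, 'm) seq \<Rightarrow> nat \<Rightarrow> (nat \<Rightarrow> 'v) \<Rightarrow> bool" where
  "increasing I n s \<longleftrightarrow> s ` {..<n} \<subseteq> idx I \<and>
     (\<forall>k l. k < l \<and> l < n \<longrightarrow> (s k, s l) \<in> ord I \<and> s k \<noteq> s l)"

text \<open>
  The concatenation of the terms at \<open>s 0, \<dots>, s (n - 1)\<close> is a tuple
  indexed by \<open>{..<n} \<times> coords I\<close>.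
\<close>

definition indiscernible ::
  "('f, 'r) lang \<Rightarrow> ('f, 'r, 'm) struc \<Rightarrow> ('v, 'm) seq \<Rightarrow> 'm set \<Rightarrow> bool" where
  "indiscernible L M I A \<longleftrightarrow>
     (\<forall>n s t. increasing I n s \<and> increasing I n t \<longrightarrow>
        tp L M ({..<n} \<times> coords I) (\<lambda>(k, y). trm_at I (s k) y) A =
        tp L M ({..<n} \<times> coords I) (\<lambda>(k, y). trm_at I (t k) y) A)"

definition mutually_indiscernible :: "('f, 'r) lang \<Rightarrow> ('f, 'r, 'm) struc \<Rightarrow> 'i set
    \<Rightarrow> ('i \<Rightarrow> ('v, 'm) seq) \<Rightarrow> 'm set \<Rightarrow> bool" where
  "mutually_indiscernible L M K I A \<longleftrightarrow>
     (\<forall>\<alpha>\<in>K. indiscernible L M (I \<alpha>) (A \<union> (\<Union>\<beta>\<in>K - {\<alpha>}. seq_elems (I \<beta>))))"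

text \<open>
  \<open>dpr_less \<kappa> L M X A \<Sigma> \<mu>\<close>: the partial type \<open>\<Sigma>\<close> over \<open>A\<close> in the variables \<open>X\<close> has
  dp-rank less than the cardinal \<open>\<mu>\<close>.
\<close>

definition dpr_less :: "'v rel \<Rightarrow> ('f, 'r) lang \<Rightarrow> ('f, 'r, 'm) struc \<Rightarrow> 'v set \<Rightarrow> 'm set
    \<Rightarrow> ('f + 'm, 'r, 'v) fml set \<Rightarrow> 'v rel \<Rightarrow> bool" where
  "dpr_less \<kappa> L M X A \<Sigma> \<mu> \<longleftrightarrow>
     (\<forall>(I :: 'v \<Rightarrow> ('v, 'm) seq) b.
        (\<forall>\<alpha>\<in>Field \<mu>. infinite_seq \<kappa> (I \<alpha>)) \<and> mutually_indiscernible L M (Field \<mu>) I A \<and>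
        realizes M b \<Sigma> \<longrightarrow>
        (\<exists>\<beta>\<in>Field \<mu>. indiscernible L M (I \<beta>) (b ` X \<union> A)))"

definition dpr_eq :: "'v rel \<Rightarrow> ('f, 'r) lang \<Rightarrow> ('f, 'r, 'm) struc \<Rightarrow> 'v set
    \<Rightarrow> 'm set \<Rightarrow> ('f + 'm, 'r, 'v) fml set \<Rightarrow> 'm set \<Rightarrow> ('f + 'm, 'r, 'v) fml set \<Rightarrow> bool" where
  "dpr_eq \<kappa> L M X A \<Sigma> A' \<Sigma>' \<longleftrightarrow>
     (\<forall>\<mu> :: 'v rel. Card_order \<mu> \<and> \<mu> <o \<kappa> \<longrightarrow>
        (dpr_less \<kappa> L M X A \<Sigma> \<mu> \<longleftrightarrow> dpr_less \<kappa> L M X A' \<Sigma>' \<mu>))"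

end

theory Submission
  imports Defs "HOL-Library.Countable_Set" "HOL-Library.Ramsey"
begin

text \<open>
  Let \<open>a0\<close> realize \<open>p\<close>, let \<open>e\<close> enumerate \<open>B\<close>, and suppose that \<open>tp(e/a0 A)\<close> does not fork
  over \<open>A\<close>.

  Passing from \<open>A\<close> to \<open>B\<close> cannot raise the dp-rank: if a family is mutually indiscernible
  over \<open>B\<close>, then it stays mutually indiscernible over \<open>A\<close> after \<open>B\<close> has been appended to
  each of its terms, and indiscernibility over \<open>bA\<close> of a sequence whose terms contain \<open>B\<close>
  is indiscernibility over \<open>bB\<close> (\<open>dpr_less_base\<close>).

  For the converse, let \<open>(I \<alpha>)\<close> be mutually indiscernible over \<open>A\<close> and let \<open>b\<close> realize the
  restriction of \<open>p\<close>, with no \<open>I \<alpha>\<close> indiscernible over \<open>bA\<close>; formulas \<open>\<Phi> \<alpha>\<close> witness this.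
  What has to be produced is a family that is mutually indiscernible over \<open>B\<close> and a
  realization of \<open>p\<close> which destroys the indiscernibility of every member. By compactness
  finitely many \<open>\<alpha>\<close> and a finite part of \<open>p\<close> matter at a time, and disjoint convex
  segments of one sequence that is indiscernible over \<open>B\<close> are mutually indiscernible over
  \<open>B\<close>. With Ramsey's theorem it is therefore enough to find columns \<open>C 0, C 1, \<dots>\<close>, the
  \<open>\<alpha>\<close>-th coordinate of a column standing for a term of \<open>I \<alpha>\<close>, such that for each finite
  set \<open>v\<close> of positions of the right size some realization of the finite part of \<open>p\<close> is
  separated by all \<open>\<Phi> \<alpha>\<close> when the segments needed are read off along \<open>v\<close>
  (\<open>pattern_imp_not_dpr_less\<close>).

  Over \<open>A\<close> such realizations \<open>a_v\<close> exist: they are conjugates of \<open>b\<close>, because all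
  increasing choices from a mutually indiscernible family are conjugate over \<open>A\<close>. The
  family \<open>(a_v)\<close> may be taken indiscernible over \<open>A\<close>, with \<open>a_w = a0\<close> for one \<open>w\<close>. It
  remains to move the \<open>a_v\<close> by an automorphism over \<open>A\<close> so that they satisfy a finite part
  of \<open>p\<close>, that is, a formula \<open>Q(e, x)\<close> true of \<open>a0\<close>. There are two cases.

  If no formula \<open>Q(y, x)\<close> shatters arbitrarily large finite sets of realizations of the
  restriction of \<open>p\<close>, then for \<open>v\<close> to the left of \<open>w\<close> the formula
  \<open>Q(y, a_w) \<and> \<not> Q(y, a_v)\<close> divides over \<open>A\<close>: an element satisfying many members of the
  indiscernible sequence of such formulas alternates on the sequence of the \<open>a_v\<close>, and
  alternation on an indiscernible sequence yields shattering. As \<open>tp(e/a0 A)\<close> does not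
  fork over \<open>A\<close>, it has a realization that satisfies none of finitely many of these
  formulas; it satisfies \<open>Q(y, a_w)\<close>, hence \<open>Q(y, a_v)\<close> for all \<open>v\<close> in question
  (\<open>not_shattering_consistent\<close>).

  If some formula does shatter arbitrarily large sets, then there is an indiscernible
  sequence of realizations all of whose finite parts are shattered. Since \<open>tp(e/a0 A)\<close>
  does not divide over \<open>A\<close>, the whole sequence can be moved into a finite part of \<open>p\<close>
  (\<open>shattering_consistent\<close>). Now the roles are exchanged: the elements that cut out the
  subsets of the sequence serve as columns, and the members of the sequence are the
  separated realizations (\<open>shattering_not_dpr_less\<close>). So in this case the dp-rank of \<open>p\<close>
  is not bounded by any cardinal below \<open>\<kappa>\<close>.
\<close>

section \<open>Substitution\<close>

lemma finite_tvars: "finite (tvars t)"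
  by (induct t) auto

lemma finite_fv: "finite (fv \<phi>)"
  by (induct \<phi>) (auto simp: finite_tvars)

lemma trm_val_cong: "(\<And>x. x \<in> tvars t \<Longrightarrow> s x = s' x) \<Longrightarrow> trm_val M s t = trm_val M s' t"
proof (induct t)
  case (App f ts)
  have "map (trm_val M s) ts = map (trm_val M s') ts"
    using App by (intro map_cong) auto
  then show ?case by (simp del: map_eq_conv)
qed simp

lemma sat_cong: "(\<And>x. x \<in> fv \<phi> \<Longrightarrow> s x = s' x) \<Longrightarrow> sat M s \<phi> = sat M s' \<phi>"
proof (induct \<phi> arbitrary: s s')
  case (Eq t u)
  then show ?case using trm_val_cong[of t s s' M] trm_val_cong[of u s s' M] by auto
next
  case (Rel r ts)
  have "map (trm_val M s) ts = map (trm_val M s') ts"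
    using Rel by (intro map_cong trm_val_cong) auto
  then show ?case by (simp del: map_eq_conv)
next
  case (Conj a b)
  show ?case using Conj.hyps(1)[of s s'] Conj.hyps(2)[of s s'] Conj.prems by simp
next
  case (Neg a)
  show ?case using Neg.hyps[of s s'] Neg.prems by simp
next
  case (Exi x \<phi>)
  have "sat M (s(x := a)) \<phi> = sat M (s'(x := a)) \<phi>" for a
    using Exi.prems by (intro Exi.hyps) auto
  then show ?case by simp
qed

fun subst_trm :: "('f \<Rightarrow> 'g) \<Rightarrow> ('x \<Rightarrow> ('g, 'w) trm) \<Rightarrow> ('f, 'x) trm \<Rightarrow> ('g, 'w) trm" where
  "subst_trm \<iota> g (Var x) = g x"
| "subst_trm \<iota> g (App f ts) = App (\<iota> f) (map (subst_trm \<iota> g) ts)"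

lemma trm_val_subst:
  assumes "\<And>f. fun_int N (\<iota> f) = fun_int M f"
  shows "trm_val N s (subst_trm \<iota> g t) = trm_val M (\<lambda>x. trm_val N s (g x)) t"
proof (induct t)
  case (App f ts)
  then have "map (trm_val N s \<circ> subst_trm \<iota> g) ts = map (trm_val M (\<lambda>x. trm_val N s (g x))) ts"
    by (intro map_cong) auto
  then show ?case by (simp add: assms del: map_eq_conv)
qed simp

lemma tvars_subst: "tvars (subst_trm \<iota> g t) = (\<Union>x\<in>tvars t. tvars (g x))"
  by (induct t) auto

lemma wf_subst:
  assumes "\<And>f. fun_ar L' (\<iota> f) = fun_ar L f"
  shows "wf_trm L t \<Longrightarrow> (\<And>x. x \<in> tvars t \<Longrightarrow> wf_trm L' (g x)) \<Longrightarrow> wf_trm L' (subst_trm \<iota> g t)"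
  by (induct t) (auto simp: assms)

text \<open>
  Stated for the values of formulas only, which avoids capture: in the quantifier step the
  bound variable is renamed to one that does not occur in any substituted term. The symbol
  map \<open>\<iota>\<close> allows the target language to have more constants, as in \<open>lang_over\<close>.
\<close>

lemma substitution:
  fixes \<phi> :: "('f, 'r, 'x) fml" and g :: "'x \<Rightarrow> ('g, 'w) trm"
  assumes inf: "infinite (UNIV :: 'w set)"
    and fi: "\<And>f. fun_int N (\<iota> f) = fun_int M f" and ri: "rel_int N = rel_int M"
    and fa: "\<And>f. fun_ar L' (\<iota> f) = fun_ar L f" and ra: "rel_ar L' = rel_ar L"
  shows "wf_fml L \<phi> \<Longrightarrow> (\<And>x. x \<in> fv \<phi> \<Longrightarrow> wf_trm L' (g x)) \<Longrightarrow>
    \<exists>\<psi>. wf_fml L' \<psi> \<and> fv \<psi> \<subseteq> (\<Union>x\<in>fv \<phi>. tvars (g x)) \<and>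
        (\<forall>s. sat N s \<psi> \<longleftrightarrow> sat M (\<lambda>x. trm_val N s (g x)) \<phi>)"
proof (induct \<phi> arbitrary: g)
  case (Eq t u)
  then show ?case
    by (intro exI[of _ "Eq (subst_trm \<iota> g t) (subst_trm \<iota> g u)"])
      (auto simp: trm_val_subst[OF fi] tvars_subst intro!: wf_subst[OF fa])
next
  case (Rel r ts)
  have "map (trm_val N s \<circ> subst_trm \<iota> g) ts = map (trm_val M (\<lambda>x. trm_val N s (g x))) ts" for s
    by (simp add: trm_val_subst[OF fi] comp_def)
  with Rel show ?case
    by (intro exI[of _ "Rel r (map (subst_trm \<iota> g) ts)"])
      (auto simp: tvars_subst ra ri simp del: map_eq_conv intro!: wf_subst[OF fa])
next
  case (Neg \<phi>)
  then have "wf_fml L \<phi>" "\<And>x. x \<in> fv \<phi> \<Longrightarrow> wf_trm L' (g x)"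
    by auto
  from Neg.hyps[of g, OF this] obtain \<psi> where "wf_fml L' \<psi> \<and> fv \<psi> \<subseteq> (\<Union>x\<in>fv \<phi>. tvars (g x)) \<and>
      (\<forall>s. sat N s \<psi> \<longleftrightarrow> sat M (\<lambda>x. trm_val N s (g x)) \<phi>)"
    by blast
  then show ?case by (intro exI[of _ "Neg \<psi>"]) auto
next
  case (Conj \<phi>1 \<phi>2)
  obtain \<psi>1 where 1: "wf_fml L' \<psi>1 \<and> fv \<psi>1 \<subseteq> (\<Union>x\<in>fv \<phi>1. tvars (g x)) \<and>
      (\<forall>s. sat N s \<psi>1 \<longleftrightarrow> sat M (\<lambda>x. trm_val N s (g x)) \<phi>1)"
    using Conj.hyps(1)[of g] Conj.prems by auto
  obtain \<psi>2 where 2: "wf_fml L' \<psi>2 \<and> fv \<psi>2 \<subseteq> (\<Union>x\<in>fv \<phi>2. tvars (g x)) \<and>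
      (\<forall>s. sat N s \<psi>2 \<longleftrightarrow> sat M (\<lambda>x. trm_val N s (g x)) \<phi>2)"
    using Conj.hyps(2)[of g] Conj.prems by auto
  show ?case using 1 2 by (intro exI[of _ "Conj \<psi>1 \<psi>2"]) auto
next
  case (Exi x \<phi>)
  have "finite (\<Union>z\<in>fv \<phi>. tvars (g z))"
    by (simp add: finite_fv finite_tvars)
  then obtain y where y: "y \<notin> (\<Union>z\<in>fv \<phi>. tvars (g z))"
    using inf by (meson ex_new_if_finite)
  have "wf_fml L \<phi>" "\<And>z. z \<in> fv \<phi> \<Longrightarrow> wf_trm L' ((g(x := Var y)) z)"
    using Exi.prems by auto
  from Exi.hyps[of "g(x := Var y)", OF this] obtain \<psi> where \<psi>: "wf_fml L' \<psi>"
      "fv \<psi> \<subseteq> (\<Union>z\<in>fv \<phi>. tvars ((g(x := Var y)) z))"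
      "\<And>s. sat N s \<psi> \<longleftrightarrow> sat M (\<lambda>z. trm_val N s ((g(x := Var y)) z)) \<phi>"
    by blast
  have "sat N (s(y := a)) \<psi> \<longleftrightarrow> sat M ((\<lambda>z. trm_val N s (g z))(x := a)) \<phi>" for s a
    unfolding \<psi>(3)
  proof (rule sat_cong)
    fix z assume z: "z \<in> fv \<phi>"
    show "trm_val N (s(y := a)) ((g(x := Var y)) z) = ((\<lambda>z. trm_val N s (g z))(x := a)) z"
    proof (cases "z = x")
      case False
      then show ?thesis using y z by (auto intro!: trm_val_cong)
    qed simp
  qed
  moreover have "fv \<psi> - {y} \<subseteq> (\<Union>z\<in>fv \<phi> - {x}. tvars (g z))"
    using \<psi>(2) by (auto split: if_splits)
  ultimately show ?case using \<psi>(1)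
    by (intro exI[of _ "Exi y \<psi>"]) auto
qed

text \<open>
  Turning the constants for parameters into variables. Object variables become \<open>Inl x\<close> and
  parameters \<open>Inr c\<close>, so bound variables never clash with parameters.
\<close>

fun unname_trm :: "('f + 'm, 'x) trm \<Rightarrow> ('f, 'x + 'm) trm" where
  "unname_trm (Var x) = Var (Inl x)"
| "unname_trm (App f ts) = (case f of Inl f \<Rightarrow> App f (map unname_trm ts) | Inr c \<Rightarrow> Var (Inr c))"

primrec unname :: "('f + 'm, 'r, 'x) fml \<Rightarrow> ('f, 'r, 'x + 'm) fml" where
  "unname (Eq t u) = Eq (unname_trm t) (unname_trm u)"
| "unname (Rel r ts) = Rel r (map unname_trm ts)"
| "unname (Neg \<phi>) = Neg (unname \<phi>)"
| "unname (Conj \<phi> \<psi>) = Conj (unname \<phi>) (unname \<psi>)"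
| "unname (Exi x \<phi>) = Exi (Inl x) (unname \<phi>)"

lemma trm_val_unname: "trm_val M (case_sum s id) (unname_trm t) = trm_val (named M) s t"
proof (induct t)
  case (App f ts)
  then have "map (trm_val M (case_sum s id) \<circ> unname_trm) ts = map (trm_val (named M) s) ts"
    by (intro map_cong) auto
  then show ?case by (auto simp: named_def simp del: map_eq_conv split: sum.splits)
qed simp

lemma wf_unname_trm: "wf_trm (lang_over L B) t \<Longrightarrow>
  wf_trm L (unname_trm t) \<and> tvars (unname_trm t) \<subseteq> tvars t <+> B"
  by (induct t) (fastforce simp: lang_over_def split: sum.splits if_splits)+

lemma sat_unname: "sat M (case_sum s id) (unname \<phi>) = sat (named M) s \<phi>"
proof (induct \<phi> arbitrary: s)
  case (Rel r ts)
  have "map (trm_val M (case_sum s id) \<circ> unname_trm) ts = map (trm_val (named M) s) ts"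
    by (simp add: trm_val_unname comp_def)
  then show ?case by (simp add: named_def del: map_eq_conv)
next
  case (Exi x \<phi>)
  have "(case_sum s id)(Inl x := a) = case_sum (s(x := a)) id" for a
    by (auto simp: fun_eq_iff split: sum.splits)
  then show ?case by (simp only: unname.simps sat.simps Exi)
qed (auto simp: trm_val_unname)

lemma wf_unname: "wf_fml (lang_over L B) \<phi> \<Longrightarrow>
  wf_fml L (unname \<phi>) \<and> fv (unname \<phi>) \<subseteq> fv \<phi> <+> B"
proof (induct \<phi>)
  case (Eq t u)
  then show ?case using wf_unname_trm[of L B t] wf_unname_trm[of L B u] by auto
next
  case (Rel r ts)
  then show ?case using wf_unname_trm[of L B] by (fastforce simp: lang_over_def)
qed auto

lemma wf_fml_mono:
  fixes \<phi> :: "('f + 'm, 'r, 'x) fml"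
  assumes "A \<subseteq> A'" "wf_fml (lang_over L A) \<phi>"
  shows "wf_fml (lang_over L A') \<phi>"
proof -
  have "wf_trm (lang_over L A) t \<Longrightarrow> wf_trm (lang_over L A') t" for t :: "('f + 'm, 'x) trm"
    using assms(1) by (induct t) (auto simp: lang_over_def split: sum.splits if_splits)
  with assms(2) show ?thesis by (induct \<phi>) (auto simp: lang_over_def)
qed

section \<open>Definable predicates\<close>

text \<open>
  All later arguments speak about predicates of assignments instead of formulas. The
  closure properties below replace syntactic manipulations.
\<close>

definition definable :: "('f, 'r) lang \<Rightarrow> ('f, 'r, 'm) struc \<Rightarrow> 'm set \<Rightarrow> 'x set \<Rightarrow>
    (('x \<Rightarrow> 'm) \<Rightarrow> bool) \<Rightarrow> bool" where
  "definable L M A X P \<longleftrightarrow>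
     (\<exists>\<phi>\<in>forms (lang_over L A) X. \<forall>s. P s \<longleftrightarrow> sat (named M) s \<phi>)"

lemma definable_cong:
  assumes "definable L M A X P" "\<And>x. x \<in> X \<Longrightarrow> s x = s' x"
  shows "P s = P s'"
  using assms unfolding definable_def forms_def
  by (metis (mono_tags, lifting) mem_Collect_eq sat_cong subsetD)

lemma definable_form: "\<phi> \<in> forms (lang_over L A) X \<Longrightarrow> definable L M A X (\<lambda>s. sat (named M) s \<phi>)"
  by (auto simp: definable_def)

lemma definable_Not: "definable L M A X P \<Longrightarrow> definable L M A X (\<lambda>s. \<not> P s)"
  unfolding definable_def forms_def
  by (clarify, rule_tac x = "Neg \<phi>" in bexI) auto

lemma definable_conj:
  "definable L M A X P \<Longrightarrow> definable L M A X Q \<Longrightarrow> definable L M A X (\<lambda>s. P s \<and> Q s)"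
  unfolding definable_def forms_def
  by (clarify, rule_tac x = "Conj \<phi> \<phi>'" in bexI) auto

lemma definable_disj:
  "definable L M A X P \<Longrightarrow> definable L M A X Q \<Longrightarrow> definable L M A X (\<lambda>s. P s \<or> Q s)"
  using definable_Not[OF definable_conj[OF definable_Not definable_Not, of L M A X P Q]] by simp

lemma definable_eq:
  "definable L M A X P \<Longrightarrow> definable L M A X Q \<Longrightarrow> definable L M A X (\<lambda>s. P s = Q s)"
  using definable_disj[OF definable_conj definable_conj[OF definable_Not definable_Not],
      of L M A X P Q P Q]
  by (rule back_subst[of "definable L M A X"]) auto

lemma definable_const: "definable L M A X (\<lambda>s. b)"
proof -
  let ?\<phi> = "Exi undefined (Eq (Var undefined) (Var undefined))"
  have "definable L M A X (\<lambda>s. True)"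
    unfolding definable_def forms_def by (rule bexI[of _ ?\<phi>]) auto
  then show ?thesis using definable_Not[of L M A X "\<lambda>_. True"] by (cases b) auto
qed

lemma definable_Ball:
  "finite I \<Longrightarrow> (\<And>i. i \<in> I \<Longrightarrow> definable L M A X (P i)) \<Longrightarrow> definable L M A X (\<lambda>s. \<forall>i\<in>I. P i s)"
proof (induct I rule: finite_induct)
  case empty
  then show ?case by (simp add: definable_const)
next
  case (insert i I)
  then show ?case by (simp add: definable_conj)
qed

lemma definable_finite_support:
  assumes "definable L M A X P"
  obtains X0 where "finite X0" "X0 \<subseteq> X" "definable L M A X0 P"
proof -
  obtain \<phi> where \<phi>: "\<phi> \<in> forms (lang_over L A) X" "\<forall>s. P s \<longleftrightarrow> sat (named M) s \<phi>"
    using assms by (auto simp: definable_def)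
  show ?thesis
    by (rule that[of "fv \<phi>"]) (use \<phi> in \<open>auto simp: finite_fv forms_def definable_def\<close>)
qed

lemma definable_Exi:
  assumes "definable L M A (insert x X) P"
  shows "definable L M A X (\<lambda>s. \<exists>a. P (s(x := a)))"
proof -
  obtain \<phi> where "\<phi> \<in> forms (lang_over L A) (insert x X)" "\<forall>s. P s \<longleftrightarrow> sat (named M) s \<phi>"
    using assms by (auto simp: definable_def)
  then show ?thesis unfolding definable_def forms_def
    by (intro bexI[of _ "Exi x \<phi>"]) auto
qed

text \<open>
  The assignment that gives the variable \<open>x\<close> either the value of the variable \<open>w\<close> or the
  fixed value \<open>c\<close>, according to whether \<open>g x\<close> is \<open>Inl w\<close> or \<open>Inr c\<close>. Substitution of
  variables and parameters for variables thus is composition with \<open>place g\<close>.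
\<close>

definition place :: "('x \<Rightarrow> 'w + 'm) \<Rightarrow> ('w \<Rightarrow> 'm) \<Rightarrow> 'x \<Rightarrow> 'm" where
  "place g s x = (case g x of Inl w \<Rightarrow> s w | Inr c \<Rightarrow> c)"

lemma definable_L_place:
  fixes \<phi> :: "('f, 'r, 'x) fml" and g :: "'x \<Rightarrow> 'w + 'm"
  assumes inf: "infinite (UNIV :: 'w set)" and wf: "wf_fml L \<phi>"
    and g: "\<And>x. x \<in> fv \<phi> \<Longrightarrow> g x \<in> Z <+> A"
  shows "definable L M A Z (\<lambda>s. sat M (place g s) \<phi>)"
proof -
  define h :: "'x \<Rightarrow> ('f + 'm, 'w) trm" where
    "h x = (case g x of Inl w \<Rightarrow> Var w | Inr c \<Rightarrow> App (Inr c) [])" for x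
  have v: "trm_val (named M) s (h x) = place g s x" for s x
    by (auto simp: h_def place_def named_def split: sum.splits)
  have w: "x \<in> fv \<phi> \<Longrightarrow> wf_trm (lang_over L A) (h x)" for x
    using g[of x] by (auto simp: h_def lang_over_def)
  have t: "x \<in> fv \<phi> \<Longrightarrow> tvars (h x) \<subseteq> Z" for x
    using g[of x] by (auto simp: h_def)
  obtain \<psi> where "wf_fml (lang_over L A) \<psi>" "fv \<psi> \<subseteq> (\<Union>x\<in>fv \<phi>. tvars (h x))"
     "\<forall>s. sat (named M) s \<psi> \<longleftrightarrow> sat M (\<lambda>x. trm_val (named M) s (h x)) \<phi>"
    using substitution[OF inf, of "named M" Inl M "lang_over L A" L \<phi> h] wf w
    by (auto simp: named_def lang_over_def)
  then show ?thesis using t unfolding definable_def forms_def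
    by (intro bexI[of _ \<psi>]) (auto simp: v)
qed

lemma definable_unname:
  assumes "definable L M A X P"
  obtains \<psi> where "\<psi> \<in> forms L (X <+> A)" "\<And>s. P s \<longleftrightarrow> sat M (case_sum s id) \<psi>"
proof -
  obtain \<phi> where \<phi>: "\<phi> \<in> forms (lang_over L A) X" "\<forall>s. P s \<longleftrightarrow> sat (named M) s \<phi>"
    using assms by (auto simp: definable_def)
  show ?thesis
    by (rule that[of "unname \<phi>"]) (use \<phi> wf_unname[of L A \<phi>] in \<open>auto simp: sat_unname forms_def\<close>)
qed

lemma definable_place:
  fixes g :: "'x \<Rightarrow> 'w + 'm"
  assumes "definable L M A X P" and inf: "infinite (UNIV :: 'w set)"
    and g: "\<And>x. x \<in> X \<Longrightarrow> g x \<in> Z <+> A'" and A: "A \<subseteq> A'"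
  shows "definable L M A' Z (\<lambda>s. P (place g s))"
proof -
  obtain \<psi> where \<psi>: "\<psi> \<in> forms L (X <+> A)" "\<And>s. P s \<longleftrightarrow> sat M (case_sum s id) \<psi>"
    using definable_unname[OF assms(1)] by blast
  have eq: "case_sum (place g s) id = place (case_sum g Inr) s" for s
    by (auto simp: fun_eq_iff place_def split: sum.splits)
  show ?thesis unfolding \<psi>(2) eq
    by (rule definable_L_place[OF inf]) (use \<psi>(1) g A in \<open>auto simp: forms_def split: sum.splits\<close>)
qed

lemma definable_mono:
  assumes "definable L M A X P" "A \<subseteq> A'" "X \<subseteq> X'"
  shows "definable L M A' X' P"
  using assms wf_fml_mono[OF assms(2)] unfolding definable_def forms_def by blast

lemma definable_reindex:
  fixes g :: "'x \<Rightarrow> 'w"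
  assumes "definable L M A X P" "infinite (UNIV :: 'w set)" "g ` X \<subseteq> Z"
  shows "definable L M A Z (\<lambda>s. P (\<lambda>x. s (g x)))"
  using definable_place[OF assms(1,2), of "Inl \<circ> g" Z A] assms(3)
  by (auto simp: place_def[abs_def])

text \<open>
  Parameters that form a tuple \<open>b\<close> can be traded for variables; \<open>definable_instantiate\<close> is
  the way back.
\<close>

lemma definable_absorb:
  fixes b :: "'x \<Rightarrow> 'm" and P :: "('w \<Rightarrow> 'm) \<Rightarrow> bool"
  assumes "definable L M (b ` X \<union> A) Z P" and inf: "infinite (UNIV :: 'w set)"
  obtains Q where "definable L M A (X <+> Z) Q" "\<And>z. P z \<longleftrightarrow> Q (case_sum b z)"
proof -
  obtain \<psi> where \<psi>: "\<psi> \<in> forms L (Z <+> (b ` X \<union> A))" "\<And>s. P s \<longleftrightarrow> sat M (case_sum s id) \<psi>"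
    using definable_unname[OF assms(1)] by blast
  define g :: "'w + 'm \<Rightarrow> ('x + 'w) + 'm" where
    "g = case_sum (Inl \<circ> Inr) (\<lambda>c. if c \<in> A then Inr c else Inl (Inl (SOME x. x \<in> X \<and> b x = c)))"
  have ch: "c \<in> b ` X \<Longrightarrow> (SOME x. x \<in> X \<and> b x = c) \<in> X \<and> b (SOME x. x \<in> X \<and> b x = c) = c" for c
    by (rule someI_ex) auto
  have inf': "infinite (UNIV :: ('x + 'w) set)"
    using inf by simp
  have "definable L M A (X <+> Z) (\<lambda>s. sat M (place g s) \<psi>)"
    by (rule definable_L_place[OF inf'])
      (use \<psi>(1) ch in \<open>auto simp: forms_def g_def split: sum.splits\<close>)
  moreover have "P z \<longleftrightarrow> sat M (place g (case_sum b z)) \<psi>" for z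
    unfolding \<psi>(2)
    by (rule sat_cong) (use \<psi>(1) ch in \<open>auto simp: forms_def g_def place_def split: sum.splits\<close>)
  ultimately show ?thesis by (rule that)
qed

lemma definable_instantiate:
  fixes b :: "'x \<Rightarrow> 'm" and Q :: "('x + 'w \<Rightarrow> 'm) \<Rightarrow> bool"
  assumes "definable L M A (X <+> Z) Q" and inf: "infinite (UNIV :: 'w set)"
  shows "definable L M (b ` X \<union> A) Z (\<lambda>z. Q (case_sum b z))"
proof -
  have eq: "case_sum b z = place (case_sum (Inr \<circ> b) Inl) z" for z
    by (auto simp: fun_eq_iff place_def split: sum.splits)
  show ?thesis unfolding eq
    by (rule definable_place[OF assms]) auto
qed

lemma definable_Ex_finite:
  fixes Q :: "('x + 'w \<Rightarrow> 'm) \<Rightarrow> bool"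
  assumes "definable L M A (X <+> W) Q" and fin: "finite W" and inf: "infinite (UNIV :: 'x set)"
  shows "definable L M A X (\<lambda>s. \<exists>c. Q (case_sum s c))"
proof -
  have "definable L M A (Inl ` X) (\<lambda>s :: 'x + 'w \<Rightarrow> 'm. \<exists>c. Q (case_sum (s \<circ> Inl) c))"
    using fin assms(1)
  proof (induct W arbitrary: Q rule: finite_induct)
    case empty
    have "Q (case_sum (s \<circ> Inl) c) \<longleftrightarrow> Q s" for s c
      by (rule definable_cong[OF empty]) auto
    then have eq: "(\<lambda>s. \<exists>c. Q (case_sum (s \<circ> Inl) c)) = Q"
      by blast
    show ?case unfolding eq using empty by (simp add: Plus_def)
  next
    case (insert w W)
    let ?Q = "\<lambda>s. \<exists>a. Q (s(Inr w := a))"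
    have "definable L M A (X <+> W) ?Q"
      by (rule definable_Exi) (use insert.prems in \<open>simp add: Plus_def\<close>)
    from insert.hyps(3)[OF this]
    have "definable L M A (Inl ` X) (\<lambda>s :: 'x + 'w \<Rightarrow> 'm. \<exists>c. ?Q (case_sum (s \<circ> Inl) c))" .
    moreover have "(\<exists>c. ?Q (case_sum (s \<circ> Inl) c)) \<longleftrightarrow> (\<exists>c. Q (case_sum (s \<circ> Inl) c))" for s :: "'x + 'w \<Rightarrow> 'm"
    proof -
      have 1: "(case_sum (s \<circ> Inl) c)(Inr w := a) = case_sum (s \<circ> Inl) (c(w := a))" for c a
        by (auto simp: fun_eq_iff split: sum.splits)
      show ?thesis unfolding 1 by (metis fun_upd_triv)
    qed
    ultimately show ?case by simp
  qed
  from definable_reindex[OF this inf, of "case_sum id undefined" X]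
  show ?thesis by (auto simp: comp_def image_image)
qed

text \<open>
  Together with \<open>realizes_tp_iff\<close> this removes types in favour of definable predicates.
\<close>

lemma tp_eq_iff:
  "tp L M X a A = tp L M X b A \<longleftrightarrow> (\<forall>P. definable L M A X P \<longrightarrow> P a = P b)"
  unfolding tp_def definable_def by auto

section \<open>Saturation and homogeneity\<close>

text \<open>
  The properties of a monster model that do not mention the theory.
\<close>

locale monster =
  fixes \<kappa> :: "'v rel" and L :: "('f, 'r) lang" and M :: "('f, 'r, 'm) struc"
  assumes Card_order: "Card_order \<kappa>"
    and forms_less: "|{\<phi> :: ('f, 'r, nat) fml. wf_fml L \<phi>}| <o \<kappa>"
    and saturated: "saturated \<kappa> L M"
    and homogeneous: "strongly_homogeneous \<kappa> L M"
begin

text \<open>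
  There are infinitely many formulas, so \<open>\<kappa>\<close> is uncountable.
\<close>

lemma nat_less: "|UNIV :: nat set| <o \<kappa>"
proof -
  have "inj (\<lambda>n :: nat. Eq (Var n) (Var n) :: ('f, 'r, nat) fml)"
    by (auto simp: inj_on_def)
  then have "|UNIV :: nat set| \<le>o |{\<phi> :: ('f, 'r, nat) fml. wf_fml L \<phi>}|"
    by (intro card_of_ordLeqI[where f = "\<lambda>n. Eq (Var n) (Var n)"]) auto
  then show ?thesis using forms_less by (rule ordLeq_ordLess_trans)
qed

lemma infinite_Field: "infinite (Field \<kappa>)"
proof -
  have "|UNIV :: nat set| <o |Field \<kappa>|"
    by (rule ordLess_ordIso_trans[OF nat_less ordIso_symmetric[OF card_of_Field_ordIso[OF Card_order]]])
  then have "|UNIV :: nat set| \<le>o |Field \<kappa>|" by (rule ordLess_imp_ordLeq)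
  then show ?thesis by (simp add: infinite_iff_card_of_nat)
qed

lemma infinite_vars: "infinite (UNIV :: 'v set)"
  by (rule infinite_super[OF subset_UNIV infinite_Field])

lemma small_leq: "|S| \<le>o |S'| \<Longrightarrow> small \<kappa> S' \<Longrightarrow> small \<kappa> S"
  unfolding small_def by (rule ordLeq_ordLess_trans)

lemma small_image: "small \<kappa> S \<Longrightarrow> small \<kappa> (f ` S)"
  by (rule small_leq[OF card_of_image])

lemma small_subset: "S \<subseteq> S' \<Longrightarrow> small \<kappa> S' \<Longrightarrow> small \<kappa> S"
  by (rule small_leq[OF card_of_mono1])

lemma small_Un: "small \<kappa> S \<Longrightarrow> small \<kappa> S' \<Longrightarrow> small \<kappa> (S \<union> S')"
  unfolding small_def by (rule card_of_Un_ordLess_infinite_Field[OF infinite_Field Card_order])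

lemma small_Plus: "small \<kappa> S \<Longrightarrow> small \<kappa> S' \<Longrightarrow> small \<kappa> (S <+> S')"
  unfolding Plus_def by (intro small_Un small_image)

lemma small_countable: "countable (S :: 's set) \<Longrightarrow> small \<kappa> S"
proof -
  assume "countable S"
  then obtain f :: "'s \<Rightarrow> nat" where "inj_on f S" unfolding countable_def by blast
  then have "|S| \<le>o |UNIV :: nat set|" by (rule card_of_ordLeqI) simp
  then show ?thesis unfolding small_def by (rule ordLeq_ordLess_trans[OF _ nat_less])
qed

lemma small_finite: "finite S \<Longrightarrow> small \<kappa> S"
  by (simp add: small_countable countable_finite)

lemma small_Times:
  assumes "small \<kappa> S" "small \<kappa> S'"
  shows "small \<kappa> (S \<times> S')"
proof -
  let ?C = "S <+> S' <+> (UNIV :: nat set)"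
  have inf: "infinite ?C" by (simp add: finite_Plus_iff)
  have "small \<kappa> (UNIV :: nat set)" by (simp add: small_countable)
  then have C: "small \<kappa> ?C" using assms by (intro small_Plus)
  have "|S \<times> S'| \<le>o |?C \<times> ?C|"
    by (rule card_of_ordLeqI[where f = "map_prod Inl (Inr \<circ> Inl)"]) (auto simp: inj_on_def)
  also have "|?C \<times> ?C| =o |?C|" by (rule card_of_Times_same_infinite[OF inf])
  finally show ?thesis using C by (rule small_leq)
qed

text \<open>
  Since \<open>\<kappa>\<close> may be singular, a union of few small sets need not be small. This is why
  sequences are thinned out to countable index sets and finitely many coordinates before
  they are put together.
\<close>

lemma small_Sigma:
  assumes "small \<kappa> S" "\<And>x. x \<in> S \<Longrightarrow> countable (T x)"
  shows "small \<kappa> (Sigma S T)"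
proof -
  let ?f = "\<lambda>(x, y). (x, to_nat_on (T x) y)"
  have "inj_on ?f (Sigma S T)"
    using assms(2) by (auto simp: inj_on_def)
  then have "|Sigma S T| \<le>o |S \<times> (UNIV :: nat set)|"
    by (rule card_of_ordLeqI) auto
  moreover have "small \<kappa> (S \<times> (UNIV :: nat set))"
    by (rule small_Times[OF assms(1) small_countable]) simp
  ultimately show ?thesis by (rule small_leq)
qed

lemma small_embeds:
  assumes "small \<kappa> S"
  obtains j :: "'s \<Rightarrow> 'v" where "inj_on j (S :: 's set)"
proof -
  have "|S| \<le>o \<kappa>" using assms unfolding small_def by (rule ordLess_imp_ordLeq)
  also have "\<kappa> =o |Field \<kappa>|"
    by (rule ordIso_symmetric[OF card_of_Field_ordIso[OF Card_order]])
  finally show ?thesis using that by (auto simp: card_of_ordLeq[symmetric])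
qed

lemma realize_one:
  assumes A: "small \<kappa> A"
    and d: "\<And>j. j \<in> J \<Longrightarrow> definable L M A {0 :: nat} (R j)"
    and fin: "\<And>J0. J0 \<subseteq> J \<Longrightarrow> finite J0 \<Longrightarrow> \<exists>s. \<forall>j\<in>J0. R j s"
  shows "\<exists>s. \<forall>j\<in>J. R j s"
proof -
  have "\<exists>\<phi>. \<forall>j\<in>J. \<phi> j \<in> forms (lang_over L A) {0 :: nat} \<and> (\<forall>s. R j s \<longleftrightarrow> sat (named M) s (\<phi> j))"
    using d unfolding definable_def by (intro bchoice) blast
  then obtain \<phi> where \<phi>: "\<And>j. j \<in> J \<Longrightarrow> \<phi> j \<in> forms (lang_over L A) {0 :: nat}"
      "\<And>j s. j \<in> J \<Longrightarrow> R j s \<longleftrightarrow> sat (named M) s (\<phi> j)" by blast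
  have "fin_sat M (\<phi> ` J)"
    unfolding fin_sat_def
  proof (intro allI impI)
    fix \<Delta> assume "\<Delta> \<subseteq> \<phi> ` J" "finite \<Delta>"
    then obtain J0 where J0: "J0 \<subseteq> J" "finite J0" "\<Delta> = \<phi> ` J0"
      by (meson finite_subset_image)
    with fin obtain s where "\<forall>j\<in>J0. R j s" by blast
    then show "\<exists>a. realizes M a \<Delta>" using J0 \<phi>(2) unfolding realizes_def by blast
  qed
  moreover have "\<phi> ` J \<subseteq> forms (lang_over L A) {0}" using \<phi>(1) by blast
  ultimately obtain s where "realizes M s (\<phi> ` J)"
    using saturated A unfolding saturated_def by meson
  then show ?thesis using \<phi>(2) unfolding realizes_def by blast
qed

text \<open>
  Saturation speaks about one variable at a time. A maximal partial assignment that
  remains finitely satisfiable together with the predicates is total on \<open>Z\<close>: the type of a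
  further coordinate over the coordinates chosen already is finitely satisfiable, hence
  realized. Chains have unions because each predicate depends on finitely many
  coordinates.
\<close>

lemma realize:
  fixes P :: "'j \<Rightarrow> ('x \<Rightarrow> 'm) \<Rightarrow> bool"
  assumes A: "small \<kappa> A" and Z: "small \<kappa> Z"
    and d: "\<And>j. j \<in> J \<Longrightarrow> definable L M A Z (P j)"
    and fin: "\<And>J0. J0 \<subseteq> J \<Longrightarrow> finite J0 \<Longrightarrow> \<exists>s. \<forall>j\<in>J0. P j s"
  shows "\<exists>s. \<forall>j\<in>J. P j s"
proof -
  have "\<exists>Z'. \<forall>j\<in>J. finite (Z' j) \<and> Z' j \<subseteq> Z \<and> definable L M A (Z' j) (P j)"
    by (intro bchoice ballI) (meson d definable_finite_support)
  then obtain Z' where Z': "\<And>j. j \<in> J \<Longrightarrow> finite (Z' j)" "\<And>j. j \<in> J \<Longrightarrow> Z' j \<subseteq> Z"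
      "\<And>j. j \<in> J \<Longrightarrow> definable L M A (Z' j) (P j)" by blast
  define ok where "ok = {m :: ('x \<times> 'm) set. m \<subseteq> Z \<times> UNIV \<and>
     (\<forall>J0\<subseteq>J. finite J0 \<longrightarrow> (\<exists>s. (\<forall>j\<in>J0. P j s) \<and> (\<forall>(z, a)\<in>m. s z = a)))}"
  have okD: "\<exists>s. (\<forall>j\<in>J0. P j s) \<and> (\<forall>(z, a)\<in>m. s z = a)"
    if "m \<in> ok" "J0 \<subseteq> J" "finite J0" for m J0
    using that by (simp add: ok_def)
  have okf: "a = a'" if "m \<in> ok" "(z, a) \<in> m" "(z, a') \<in> m" for m z a a'
  proof -
    from okD[OF that(1), of "{}"] obtain s where s: "\<forall>(z, a)\<in>m. s z = a" by auto
    have "s z = a" using s that(2) by auto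
    moreover have "s z = a'" using s that(3) by auto
    ultimately show ?thesis by simp
  qed
  have "\<exists>m\<in>ok. \<forall>m'\<in>ok. m \<subseteq> m' \<longrightarrow> m' = m"
  proof (rule subset_Zorn_nonempty)
    have "{} \<in> ok" using fin by (auto simp: ok_def)
    then show "ok \<noteq> {}" by blast
  next
    fix \<C> assume ne: "\<C> \<noteq> {}" and ch: "subset.chain ok \<C>"
    then have sub: "\<C> \<subseteq> ok" and lin: "\<And>m m'. m \<in> \<C> \<Longrightarrow> m' \<in> \<C> \<Longrightarrow> m \<subseteq> m' \<or> m' \<subseteq> m"
      by (auto simp: subset_chain_def)
    have dir: "\<exists>m\<in>\<C>. U \<subseteq> m" if "finite U" "U \<subseteq> \<Union>\<C>" for U
      using finite_subset_Union_chain[OF that ne] ch lin by (metis ch subset.chain_def)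
    have uf: "a = a'" if "(z, a) \<in> \<Union>\<C>" "(z, a') \<in> \<Union>\<C>" for z a a'
    proof -
      have "\<exists>m\<in>\<C>. {(z, a), (z, a')} \<subseteq> m"
        by (rule dir) (use that in auto)
      then obtain m where "m \<in> \<C>" "{(z, a), (z, a')} \<subseteq> m" by blast
      then show ?thesis using okf[of m z a a'] sub by auto
    qed
    show "\<Union>\<C> \<in> ok"
      unfolding ok_def mem_Collect_eq
    proof (intro conjI allI impI)
      show "\<Union>\<C> \<subseteq> Z \<times> UNIV" using sub by (auto simp: ok_def)
    next
      fix J0 assume J0: "J0 \<subseteq> J" "finite J0"
      let ?Z0 = "\<Union>j\<in>J0. Z' j"
      have "finite ?Z0" using Z' J0 by auto
      have "finite {(z, a) \<in> \<Union>\<C>. z \<in> ?Z0}" (is "finite ?U")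
      proof (rule inj_on_finite[of fst])
        show "inj_on fst ?U" using uf by (fastforce simp: inj_on_def)
        show "fst ` ?U \<subseteq> ?Z0" by auto
        show "finite ?Z0" by fact
      qed
      then obtain m where m: "m \<in> \<C>" "?U \<subseteq> m" using dir[of ?U] by blast
      then obtain s where s: "\<forall>j\<in>J0. P j s" "\<forall>(z, a)\<in>m. s z = a"
        using okD[of m J0] sub J0 by auto
      define s' where "s' z = (if \<exists>a. (z, a) \<in> \<Union>\<C> then THE a. (z, a) \<in> \<Union>\<C> else s z)" for z
      have s'1: "s' z = a" if "(z, a) \<in> \<Union>\<C>" for z a
      proof -
        have "(THE a. (z, a) \<in> \<Union>\<C>) = a" by (rule the_equality) (use that uf in blast)+
        then show ?thesis unfolding s'_def using that by auto
      qed
      have s'2: "s' z = s z" if z: "z \<in> ?Z0" for z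
      proof (cases "\<exists>a. (z, a) \<in> \<Union>\<C>")
        case True
        then obtain a where a: "(z, a) \<in> \<Union>\<C>" by blast
        then have "(z, a) \<in> m" using m(2) z by blast
        with s(2) have "s z = a" by auto
        then show ?thesis using s'1[OF a] by simp
      next
        case False
        then show ?thesis unfolding s'_def by (simp only: if_False)
      qed
      have "P j s'" if "j \<in> J0" for j
      proof -
        have "P j s' = P j s"
          by (rule definable_cong[OF Z'(3)]) (use that J0 s'2 in auto)
        then show ?thesis using s(1) that by simp
      qed
      then show "\<exists>s. (\<forall>j\<in>J0. P j s) \<and> (\<forall>(z, a)\<in>\<Union>\<C>. s z = a)"
        using s'1 by blast
    qed
  qed
  then obtain m where m: "m \<in> ok" and max: "\<And>m'. m' \<in> ok \<Longrightarrow> m \<subseteq> m' \<Longrightarrow> m' = m" by blast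
  have total: "\<exists>a. (z, a) \<in> m" if z: "z \<in> Z" for z
  proof (rule ccontr)
    assume nz: "\<not> (\<exists>a. (z, a) \<in> m)"
    define R where "R J0 c \<longleftrightarrow> (\<exists>s. (\<forall>j\<in>J0. P j s) \<and> (\<forall>(z, a)\<in>m. s z = a) \<and> s z = c (0::nat))" for J0 c
    have "small \<kappa> (A \<union> Range m)"
    proof (rule small_Un[OF A])
      obtain s where s: "\<forall>(z, a)\<in>m. s z = a" using okD[OF m, of "{}"] by auto
      have "Range m \<subseteq> s ` Z" using s m unfolding ok_def by fastforce
      then show "small \<kappa> (Range m)" by (rule small_subset[OF _ small_image[OF Z]])
    qed
    moreover have "definable L M (A \<union> Range m) {0} (R J0)" if "J0 \<in> {J0. J0 \<subseteq> J \<and> finite J0}" for J0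
    proof -
      have J0: "J0 \<subseteq> J" "finite J0" using that by auto
      let ?Z0 = "\<Union>j\<in>J0. Z' j"
      define W where "W = ?Z0 - Domain m - {z}"
      define g :: "'x \<Rightarrow> (nat + 'x) + 'm" where
        "g v = (if v = z then Inl (Inl 0) else if v \<in> Domain m then Inr (THE a. (v, a) \<in> m)
           else Inl (Inr v))" for v
      have the_m: "(THE a. (v, a) \<in> m) = a" if "(v, a) \<in> m" for v a
        by (rule the_equality) (use that okf[OF m] in blast)+
      have finZ: "finite ?Z0" using Z' J0 by auto
      have "definable L M A ?Z0 (\<lambda>s. \<forall>j\<in>J0. P j s)"
        by (rule definable_Ball) (use J0 Z' in \<open>auto intro!: definable_mono[OF Z'(3)]\<close>)
      then have "definable L M (A \<union> Range m) ({0 :: nat} <+> W) (\<lambda>s. \<forall>j\<in>J0. P j (place g s))"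
      proof (rule definable_place)
        fix x assume x: "x \<in> ?Z0"
        show "g x \<in> ({0} <+> W) <+> (A \<union> Range m)"
          using x the_m by (auto simp: g_def W_def)
      qed auto
      then have "definable L M (A \<union> Range m) {0 :: nat}
          (\<lambda>s. \<exists>c. \<forall>j\<in>J0. P j (place g (case_sum s c)))"
        by (rule definable_Ex_finite) (use finZ in \<open>auto simp: W_def\<close>)
      moreover have "R J0 = (\<lambda>s. \<exists>c. \<forall>j\<in>J0. P j (place g (case_sum s c)))"
      proof (intro ext iffI)
        fix s assume "R J0 s"
        then obtain t where t: "\<forall>j\<in>J0. P j t" "\<forall>(z, a)\<in>m. t z = a" "t z = s 0"
          unfolding R_def by blast
        have "place g (case_sum s t) = t"
          using t(2,3) the_m by (fastforce simp: place_def g_def fun_eq_iff)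
        then show "\<exists>c. \<forall>j\<in>J0. P j (place g (case_sum s c))" using t(1) by metis
      next
        fix s assume "\<exists>c. \<forall>j\<in>J0. P j (place g (case_sum s c))"
        then obtain c where "\<forall>j\<in>J0. P j (place g (case_sum s c))" by blast
        moreover have "place g (case_sum s c) v = a" if "(v, a) \<in> m" for v a
          using that nz the_m by (auto simp: place_def g_def)
        moreover have "place g (case_sum s c) z = s 0" by (simp add: place_def g_def)
        ultimately show "R J0 s" unfolding R_def by blast
      qed
      ultimately show ?thesis by simp
    qed
    moreover have "\<exists>s. \<forall>J0\<in>\<J>. R J0 s"
      if "\<J> \<subseteq> {J0. J0 \<subseteq> J \<and> finite J0}" "finite \<J>" for \<J>
    proof -
      have "\<Union>\<J> \<subseteq> J" "finite (\<Union>\<J>)" using that by auto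
      then obtain s where "\<forall>j\<in>\<Union>\<J>. P j s" "\<forall>(z, a)\<in>m. s z = a"
        using okD[OF m, of "\<Union>\<J>"] by auto
      then have "\<forall>J0\<in>\<J>. R J0 (\<lambda>_. s z)" unfolding R_def by blast
      then show ?thesis by blast
    qed
    ultimately obtain c where c: "\<And>J0. J0 \<subseteq> J \<Longrightarrow> finite J0 \<Longrightarrow> R J0 c"
      using realize_one[of "A \<union> Range m" "{J0. J0 \<subseteq> J \<and> finite J0}" R] by blast
    have "insert (z, c 0) m \<in> ok"
      unfolding ok_def mem_Collect_eq
    proof (intro conjI allI impI)
      show "insert (z, c 0) m \<subseteq> Z \<times> UNIV" using m z by (auto simp: ok_def)
      fix J0 assume "J0 \<subseteq> J" "finite J0"
      then have "R J0 c" by (rule c)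
      then show "\<exists>s. (\<forall>j\<in>J0. P j s) \<and> (\<forall>(z, a)\<in>insert (z, c 0) m. s z = a)"
        unfolding R_def by auto
    qed
    then have "insert (z, c 0) m = m" using max by blast
    then show False using nz by blast
  qed
  obtain s0 where s0: "\<forall>(z, a)\<in>m. s0 z = a" using okD[OF m, of "{}"] by auto
  have "P j s0" if j: "j \<in> J" for j
  proof -
    obtain s where s: "P j s" "\<forall>(z, a)\<in>m. s z = a"
      using okD[OF m, of "{j}"] j by auto
    have "P j s0 = P j s"
      by (rule definable_cong[OF d[OF j]]) (use s s0 total in fastforce)
    then show ?thesis using s(1) by simp
  qed
  then show ?thesis by blast
qed

definition Aut :: "'m set \<Rightarrow> ('m \<Rightarrow> 'm) set" where
  "Aut A = {h. automorphism L M h \<and> (\<forall>a\<in>A. h a = a)}"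

lemma Aut_fixes: "h \<in> Aut A \<Longrightarrow> a \<in> A \<Longrightarrow> h a = a"
  by (simp add: Aut_def)

lemma automorphism_trm:
  "automorphism L M h \<Longrightarrow> wf_trm L t \<Longrightarrow> trm_val M (\<lambda>x. h (s x)) t = h (trm_val M s t)"
proof (induct t)
  case (App f ts)
  then have eq: "map (trm_val M (\<lambda>x. h (s x))) ts = map h (map (trm_val M s) ts)"
    by simp
  have "fun_ar L f = Some (length (map (trm_val M s) ts))" using App.prems(2) by simp
  with App.prems(1) have "h (fun_int M f (map (trm_val M s) ts)) = fun_int M f (map h (map (trm_val M s) ts))"
    unfolding automorphism_def by blast
  then show ?case by (simp only: trm_val.simps eq)
qed simp

lemma automorphism_sat:
  "automorphism L M h \<Longrightarrow> wf_fml L \<phi> \<Longrightarrow> sat M (\<lambda>x. h (s x)) \<phi> \<longleftrightarrow> sat M s \<phi>"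
proof (induct \<phi> arbitrary: s)
  case (Eq t u)
  then have "inj h" by (simp add: automorphism_def bij_def)
  then show ?case using Eq by (simp add: automorphism_trm inj_eq)
next
  case (Rel r ts)
  have eq: "map (trm_val M (\<lambda>x. h (s x))) ts = map h (map (trm_val M s) ts)"
    using Rel by (simp add: automorphism_trm)
  have "rel_ar L r = Some (length (map (trm_val M s) ts))" using Rel by simp
  with Rel(1) have "rel_int M r (map h (map (trm_val M s) ts)) = rel_int M r (map (trm_val M s) ts)"
    unfolding automorphism_def by blast
  then show ?case by (simp only: sat.simps eq)
next
  case (Exi x \<phi>)
  have "surj h" using Exi by (simp add: automorphism_def bij_def)
  then have "(\<exists>a. sat M ((\<lambda>y. h (s y))(x := a)) \<phi>) \<longleftrightarrow> (\<exists>a. sat M ((\<lambda>y. h (s y))(x := h a)) \<phi>)"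
    by (metis surjD)
  moreover have "(\<lambda>y. h (s y))(x := h a) = (\<lambda>y. h ((s(x := a)) y))" for a by auto
  ultimately show ?case using Exi by (simp only: sat.simps wf_fml.simps)
qed auto

lemma definable_Aut:
  assumes "definable L M A X P" "h \<in> Aut A"
  shows "P (\<lambda>x. h (s x)) \<longleftrightarrow> P s"
proof -
  obtain \<psi> where \<psi>: "\<psi> \<in> forms L (X <+> A)" "\<And>s. P s \<longleftrightarrow> sat M (case_sum s id) \<psi>"
    using definable_unname[OF assms(1)] by blast
  have "sat M (case_sum (\<lambda>x. h (s x)) id) \<psi> \<longleftrightarrow> sat M (\<lambda>x. h (case_sum s id x)) \<psi>"
    by (rule sat_cong) (use \<psi>(1) assms(2) in \<open>auto simp: forms_def Aut_def\<close>)
  then show ?thesis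
    using \<psi> automorphism_sat[of h \<psi> "case_sum s id"] assms(2) by (simp add: Aut_def forms_def)
qed

lemma tp_Aut: "h \<in> Aut A \<Longrightarrow> tp L M X (\<lambda>x. h (a x)) A = tp L M X a A"
  using definable_Aut tp_eq_iff by blast

lemma Aut_comp: "h \<in> Aut A \<Longrightarrow> g \<in> Aut A \<Longrightarrow> h \<circ> g \<in> Aut A"
  unfolding Aut_def automorphism_def by (auto intro: bij_comp simp flip: map_map)

lemma Aut_id: "id \<in> Aut A"
  unfolding Aut_def automorphism_def by simp

lemma Aut_mono: "A \<subseteq> A' \<Longrightarrow> Aut A' \<subseteq> Aut A"
  unfolding Aut_def by blast

lemma definable_equal:
  assumes "x \<in> X" "y \<in> X"
  shows "definable L M A X (\<lambda>s. s x = s y)"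
  unfolding definable_def forms_def
  by (rule bexI[of _ "Eq (Var x) (Var y)"]) (use assms in auto)

lemma definable_equal_const:
  assumes "x \<in> X" "c \<in> A"
  shows "definable L M A X (\<lambda>s. s x = c)"
  unfolding definable_def forms_def
  by (rule bexI[of _ "Eq (Var x) (App (Inr c) [])"]) (use assms in \<open>auto simp: lang_over_def named_def\<close>)

text \<open>
  Equality of types makes the map that sends \<open>a x\<close> to \<open>b x\<close> and fixes \<open>A\<close> well defined and
  elementary.
\<close>

lemma tp_eq_imp_Aut:
  fixes a b :: "'x \<Rightarrow> 'm"
  assumes tp: "tp L M X a A = tp L M X b A" and X: "small \<kappa> X" and A: "small \<kappa> A"
    and inf: "infinite (UNIV :: 'x set)"
  obtains h where "h \<in> Aut A" "\<And>x. x \<in> X \<Longrightarrow> h (a x) = b x"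
proof -
  have eq: "P a = P b" if "definable L M A X P" for P
    using tp that tp_eq_iff by blast
  define ch where "ch c = (SOME x. x \<in> X \<and> a x = c)" for c
  have ch: "ch c \<in> X \<and> a (ch c) = c" if "c \<in> a ` X" for c
    unfolding ch_def by (rule someI_ex) (use that in auto)
  define g where "g c = (if c \<in> a ` X then b (ch c) else c)" for c
  have ga: "g (a x) = b x" if "x \<in> X" for x
    using eq[OF definable_equal[of x X "ch (a x)" A]] that ch[of "a x"] by (auto simp: g_def)
  have gA: "g c = c" if "c \<in> A" for c
    using eq[OF definable_equal_const[of "ch c" X c A]] that ch[of c] by (auto simp: g_def)
  have "elementary_on L M (A \<union> a ` X) g"
    unfolding elementary_on_def
  proof (intro allI impI)
    fix \<phi> :: "('f, 'r, nat) fml" and s assume s: "wf_fml L \<phi> \<and> s ` fv \<phi> \<subseteq> A \<union> a ` X"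
    define gg :: "nat \<Rightarrow> 'x + 'm" where
      "gg n = (if s n \<in> a ` X then Inl (ch (s n)) else Inr (s n))" for n
    have "definable L M A X (\<lambda>t. sat M (place gg t) \<phi>)"
      by (rule definable_L_place[OF inf]) (use s ch in \<open>auto simp: gg_def\<close>)
    then have "sat M (place gg a) \<phi> \<longleftrightarrow> sat M (place gg b) \<phi>" by (rule eq)
    moreover have "place gg a = s" using ch by (auto simp: place_def gg_def fun_eq_iff)
    moreover have "sat M (place gg b) \<phi> \<longleftrightarrow> sat M (g \<circ> s) \<phi>"
      by (rule sat_cong) (use s gA in \<open>auto simp: place_def gg_def g_def\<close>)
    ultimately show "sat M s \<phi> = sat M (g \<circ> s) \<phi>" by simp
  qed
  moreover have "small \<kappa> (A \<union> a ` X)" by (intro small_Un A small_image X)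
  ultimately obtain h where h: "automorphism L M h" "\<forall>c\<in>A \<union> a ` X. h c = g c"
    using homogeneous unfolding strongly_homogeneous_def by meson
  show ?thesis by (rule that[of h]) (use h ga gA in \<open>auto simp: Aut_def\<close>)
qed

end

section \<open>Ramsey's theorem and extraction\<close>

definition nth_of :: "nat set \<Rightarrow> nat \<Rightarrow> nat" where
  "nth_of S i = sorted_list_of_set S ! i"

lemma nth_of_less:
  assumes "finite S" "i < j" "j < card S"
  shows "nth_of S i < nth_of S j"
  using sorted_wrt_nth_less[OF strict_sorted_list_of_set[of S]] assms by (simp add: nth_of_def)

lemma nth_of_image: "finite S \<Longrightarrow> nth_of S ` {..<card S} = S"
  by (simp add: nth_of_def nth_image[of "card S" "sorted_list_of_set S", simplified] lessThan_atLeast0)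

lemma nth_of_in: "finite S \<Longrightarrow> i < card S \<Longrightarrow> nth_of S i \<in> S"
  using nth_of_image[of S] by blast

lemma nth_of_inj: "finite S \<Longrightarrow> inj_on (nth_of S) {..<card S}"
  by (intro strict_mono_on_imp_inj_on strict_mono_onI) (auto intro: nth_of_less)

lemma nth_of_unique:
  assumes "\<And>i j. i < j \<Longrightarrow> j < k \<Longrightarrow> f i < f j" "f ` {..<k} = S" "i < k"
  shows "nth_of S i = f i"
proof -
  have "sorted_wrt (<) (map f [0..<k])"
    using assms(1) by (auto simp: sorted_wrt_iff_nth_less)
  moreover have "set (map f [0..<k]) = S" using assms(2) by (simp add: lessThan_atLeast0)
  moreover have "finite S" using assms(2) by auto
  ultimately have "sorted_list_of_set S = map f [0..<k]"
    by (intro strict_sorted_equal) auto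
  then show ?thesis using assms(3) by (simp add: nth_of_def)
qed

lemma nth_of_comp:
  assumes S: "finite S" and v: "v \<subseteq> {..<card S}" and i: "i < card v"
  shows "nth_of (nth_of S ` v) i = nth_of S (nth_of v i)"
proof (rule nth_of_unique[OF _ _ i])
  have fin: "finite v" using v finite_subset by blast
  show "nth_of S (nth_of v i) < nth_of S (nth_of v j)" if "i < j" "j < card v" for i j
    using that v nth_of_in[OF fin, of j] by (intro nth_of_less S fin) auto
  show "(\<lambda>i. nth_of S (nth_of v i)) ` {..<card v} = nth_of S ` v"
    using nth_of_image[OF fin] by (metis image_image)
qed

lemma nth_of_rank:
  assumes S: "finite S" and s: "s \<in> S"
  shows "nth_of S (card {t\<in>S. t < s}) = s"
proof -
  obtain i where i: "i < card S" "s = nth_of S i"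
    using nth_of_image[OF S] s by force
  have "{t\<in>S. t < s} = nth_of S ` {..<i}"
  proof
    show "{t\<in>S. t < s} \<subseteq> nth_of S ` {..<i}"
    proof
      fix t assume t: "t \<in> {t\<in>S. t < s}"
      then obtain j where j: "j < card S" "t = nth_of S j"
        using nth_of_image[OF S] by force
      have "j < i"
        using nth_of_less[OF S, of i j] t j i by (metis (no_types, lifting) linorder_neqE_nat mem_Collect_eq not_less_iff_gr_or_eq)
      then show "t \<in> nth_of S ` {..<i}" using j by blast
    qed
    show "nth_of S ` {..<i} \<subseteq> {t\<in>S. t < s}"
      using i nth_of_in[OF S] nth_of_less[OF S] by auto
  qed
  moreover have "inj_on (nth_of S) {..<i}"
    by (rule inj_on_subset[OF nth_of_inj[OF S]]) (use i in auto)
  ultimately show ?thesis using i by (simp add: card_image)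
qed

text \<open>
  Several colourings, of subsets of different sizes, are made homogeneous one after the
  other.
\<close>

lemma ramsey_finitely_many:
  fixes k :: "'j \<Rightarrow> nat"
  assumes "finite J"
  shows "\<exists>n. \<forall>Z :: nat set. finite Z \<longrightarrow> n \<le> card Z \<longrightarrow> (\<forall>f :: 'j \<Rightarrow> nat set \<Rightarrow> bool.
    \<exists>H\<subseteq>Z. card H = K \<and> (\<forall>j\<in>J. \<forall>S\<in>nsets H (k j). \<forall>S'\<in>nsets H (k j). f j S = f j S'))"
  using assms
proof (induct J rule: finite_induct)
  case empty
  show ?case by (rule exI[of _ K]) (metis empty_iff obtain_subset_with_card_n)
next
  case (insert j J)
  from insert.hyps(3) obtain n where n: "\<forall>Z :: nat set. finite Z \<longrightarrow> n \<le> card Z \<longrightarrow> (\<forall>f :: 'j \<Rightarrow> nat set \<Rightarrow> bool.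
    \<exists>H\<subseteq>Z. card H = K \<and> (\<forall>j\<in>J. \<forall>S\<in>nsets H (k j). \<forall>S'\<in>nsets H (k j). f j S = f j S'))"
    by (rule exE)
  obtain N where N: "partn_lst {..<N::nat} [n, n] (k j)" using ramsey_full by blast
  show ?case
  proof (rule exI[of _ N], intro allI impI)
    fix Z :: "nat set" and f :: "'j \<Rightarrow> nat set \<Rightarrow> bool"
    assume Z: "finite Z" "N \<le> card Z"
    define col where "col S = (if f j (nth_of Z ` S) then 0 else 1 :: nat)" for S
    have "col \<in> nsets {..<N} (k j) \<rightarrow> {..<length [n, n]}" by (simp add: col_def)
    then obtain i where "i < length [n, n]" "monochromatic {..<N} ([n, n] ! i) (k j) col i"
      using N unfolding partn_lst_def by blast
    moreover have "[n, n] ! i = n" if "i < length [n, n]" for i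
      using that by (cases i) auto
    ultimately obtain H0 where H0: "H0 \<in> nsets {..<N} n" "col ` nsets H0 (k j) \<subseteq> {i}"
      unfolding monochromatic_def by auto
    have H0': "H0 \<subseteq> {..<card Z}" "finite H0" "card H0 = n"
      using H0(1) Z(2) by (auto simp: nsets_def)
    have inj: "inj_on (nth_of Z) H0" by (rule inj_on_subset[OF nth_of_inj[OF Z(1)] H0'(1)])
    let ?H1 = "nth_of Z ` H0"
    have "finite ?H1" "n \<le> card ?H1" using H0' inj by (auto simp: card_image)
    from n[rule_format, OF this, of f] obtain H where H: "H \<subseteq> ?H1" "card H = K"
      "\<forall>j\<in>J. \<forall>S\<in>nsets H (k j). \<forall>S'\<in>nsets H (k j). f j S = f j S'" by blast
    have col: "f j S \<longleftrightarrow> i = 0" if S: "S \<in> nsets H (k j)" for S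
    proof -
      have "S \<subseteq> nth_of Z ` H0" using S H(1) by (auto simp: nsets_def)
      then obtain S0 where S0: "S0 \<subseteq> H0" "S = nth_of Z ` S0" by (rule subset_imageE)
      have "S0 \<in> nsets H0 (k j)"
        using S0 S inj H0'(2) card_image[OF inj_on_subset[OF inj S0(1)]] finite_subset[OF S0(1)]
        by (auto simp: nsets_def)
      then have "col S0 = i" using H0(2) by blast
      then show ?thesis unfolding S0(2) col_def by (auto split: if_splits)
    qed
    have "H \<subseteq> Z" using H(1) H0'(1) nth_of_in[OF Z(1)] by blast
    moreover have "f i S = f i S'" if "i \<in> insert j J" "S \<in> nsets H (k i)" "S' \<in> nsets H (k i)" for i S S'
      using that H(3) col[of S] col[of S'] by auto
    ultimately show "\<exists>H\<subseteq>Z. card H = K \<and>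
      (\<forall>j\<in>insert j J. \<forall>S\<in>nsets H (k j). \<forall>S'\<in>nsets H (k j). f j S = f j S')"
      using H(2) by (intro exI[of _ H] conjI ballI)
  qed
qed

text \<open>
  A family of tuples indexed by the \<open>m\<close>-subsets \<open>v\<close> of the natural numbers is a function
  on pairs \<open>(v, x)\<close>. Its restriction to the \<open>m\<close>-subsets of \<open>S\<close> becomes a family over
  \<open>{..<card S}\<close> along the increasing enumeration of \<open>S\<close>.
\<close>

definition resample :: "nat set \<Rightarrow> (nat set \<times> 'x \<Rightarrow> 'm) \<Rightarrow> nat set \<times> 'x \<Rightarrow> 'm" where
  "resample S a = (\<lambda>(v, x). a (nth_of S ` v, x))"

lemma nth_of_image_nsets:
  assumes "S \<in> nsets U k" "v \<in> nsets {..<k} m"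
  shows "nth_of S ` v \<in> nsets S m"
proof -
  have "inj_on (nth_of S) v"
    by (rule inj_on_subset[OF nth_of_inj]) (use assms in \<open>auto simp: nsets_def\<close>)
  then show ?thesis using assms nth_of_in[of S] by (auto simp: nsets_def card_image)
qed

lemma resample_resample:
  assumes "S \<in> nsets {..<card H} k" "v \<in> nsets {..<k} m" "finite H"
  shows "resample S (resample H a) (v, x) = resample (nth_of H ` S) a (v, x)"
proof -
  have "nth_of (nth_of H ` S) ` v = (\<lambda>i. nth_of H (nth_of S i)) ` v"
    by (rule image_cong[OF refl]) (use assms in \<open>auto simp: nsets_def intro!: nth_of_comp\<close>)
  then show ?thesis by (simp add: resample_def image_image)
qed

context monster
begin

lemma definable_resample:
  fixes P :: "(nat set \<times> 'x \<Rightarrow> 'm) \<Rightarrow> bool"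
  assumes "definable L M A (nsets {..<k} m \<times> X) P" "S \<in> nsets UNIV k"
  shows "definable L M A (nsets S m \<times> X) (\<lambda>a. P (resample S a))"
proof -
  have inf: "infinite (UNIV :: (nat set \<times> 'x) set)" by (simp add: finite_prod Finite_Set.finite_set)
  have eq: "resample S = (\<lambda>a :: nat set \<times> 'x \<Rightarrow> 'm. \<lambda>z. a ((\<lambda>(v, x). (nth_of S ` v, x)) z))"
    by (auto simp: resample_def fun_eq_iff)
  show ?thesis unfolding eq
    by (rule definable_reindex[OF assms(1) inf]) (use nth_of_image_nsets[OF assms(2)] in auto)
qed

text \<open>
  The generalized Ehrenfeucht-Mostowski construction: \<open>E\<close> collects properties that
  arbitrarily long families have on all their subfamilies of a given length. Some infinite
  family has all of them, and the type over \<open>A\<close> of a subfamily indexed by the subsets of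
  \<open>S\<close> depends only on the size of \<open>S\<close>. By compactness this is Ramsey's theorem for
  finitely many predicates.
\<close>

lemma extraction:
  fixes E :: "(nat \<times> ((nat set \<times> 'x \<Rightarrow> 'm) \<Rightarrow> bool)) set"
  assumes A: "small \<kappa> A" and X: "small \<kappa> X"
    and E: "\<And>k P. (k, P) \<in> E \<Longrightarrow> definable L M A (nsets {..<k} m \<times> X) P"
    and fam: "\<And>n. \<exists>a. \<forall>(k, P)\<in>E. \<forall>S\<in>nsets {..<n} k. P (resample S a)"
  obtains a where "\<And>k P S. (k, P) \<in> E \<Longrightarrow> S \<in> nsets UNIV k \<Longrightarrow> P (resample S a)"
    and "\<And>k P S S'. definable L M A (nsets {..<k} m \<times> X) P \<Longrightarrow> S \<in> nsets UNIV k \<Longrightarrow>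
      S' \<in> nsets UNIV k \<Longrightarrow> P (resample S a) = P (resample S' a)"
proof -
  define J1 where "J1 = {(k, P, S). (k, P) \<in> E \<and> S \<in> nsets (UNIV :: nat set) k}"
  define J2 where "J2 = {(k, P, S, S'). definable L M A (nsets {..<k} m \<times> X) P \<and>
      S \<in> nsets (UNIV :: nat set) k \<and> S' \<in> nsets (UNIV :: nat set) k}"
  define Q :: "_ \<Rightarrow> (nat set \<times> 'x \<Rightarrow> 'm) \<Rightarrow> bool" where
    "Q = case_sum (\<lambda>(k :: nat, P, S) a. P (resample S a))
      (\<lambda>(k :: nat, P :: (nat set \<times> 'x \<Rightarrow> 'm) \<Rightarrow> bool, S, S') a. P (resample S a) = P (resample S' a))"
  have "\<exists>a. \<forall>j\<in>J1 <+> J2. Q j a"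
  proof (rule realize[OF A])
    have "countable (nsets (UNIV :: nat set) m)"
      by (rule countable_subset[OF _ countable_Collect_finite]) (auto simp: nsets_def)
    then show "small \<kappa> (nsets (UNIV :: nat set) m \<times> X)"
      by (intro small_Times small_countable X)
  next
    fix j assume j: "j \<in> J1 <+> J2"
    have d: "definable L M A (nsets UNIV m \<times> X) (\<lambda>a. P (resample S a))"
      if "definable L M A (nsets {..<k} m \<times> X) P" "S \<in> nsets UNIV k" for k P S
      by (rule definable_mono[OF definable_resample[OF that]]) (auto simp: nsets_def)
    show "definable L M A (nsets UNIV m \<times> X) (Q j)"
    proof (cases j)
      case (Inl t)
      obtain k P S where t: "t = (k, P, S)" by (cases t)
      have "(k, P) \<in> E" "S \<in> nsets UNIV k" using j by (auto simp: Inl t J1_def)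
      then show ?thesis using d[OF E] by (simp add: Inl t Q_def)
    next
      case (Inr t)
      obtain k P S S' where t: "t = (k, P, S, S')" by (cases t)
      have "definable L M A (nsets {..<k} m \<times> X) P" "S \<in> nsets UNIV k" "S' \<in> nsets UNIV k"
        using j by (auto simp: Inr t J2_def)
      then show ?thesis using definable_eq[OF d d] by (simp add: Inr t Q_def)
    qed
  next
    fix J0 assume J0: "J0 \<subseteq> J1 <+> J2" "finite J0"
    define sets where "sets = case_sum (\<lambda>(k :: nat, P :: (nat set \<times> 'x \<Rightarrow> 'm) \<Rightarrow> bool, S :: nat set). S)
      (\<lambda>(k :: nat, P :: (nat set \<times> 'x \<Rightarrow> 'm) \<Rightarrow> bool, S, S'). S \<union> S')"
    have "finite (\<Union>j\<in>J0. sets j)"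
    proof (rule finite_UN_I[OF J0(2)])
      fix j assume "j \<in> J0"
      then have "j \<in> J1 <+> J2" using J0(1) by blast
      then show "finite (sets j)" by (auto simp: J1_def J2_def sets_def nsets_def)
    qed
    then obtain R where "(\<Union>j\<in>J0. sets j) \<subseteq> {..<R}"
      unfolding finite_nat_iff_bounded ..
    then have R: "sets j \<subseteq> {..<R}" if "j \<in> J0" for j using that by blast
    have J0': "j \<in> J1 <+> J2" if "j \<in> J0" for j using that J0(1) by blast
    define K where "K = case_sum (\<lambda>(k, P, S). (k, P)) (\<lambda>(k, P, S, S'). (k, P)) ` J0"
    have K: "finite K" using J0(2) by (simp add: K_def)
    from ramsey_finitely_many[OF K, where K = R and k = fst]
    obtain n where n: "\<forall>Z :: nat set. finite Z \<longrightarrow> n \<le> card Z \<longrightarrow>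
      (\<forall>f :: _ \<Rightarrow> nat set \<Rightarrow> bool. \<exists>H\<subseteq>Z. card H = R \<and> (\<forall>j\<in>K. \<forall>S\<in>nsets H (fst j). \<forall>S'\<in>nsets H (fst j). f j S = f j S'))"
      by (rule exE)
    from fam[of n] obtain a where a0: "\<forall>(k, P)\<in>E. \<forall>S\<in>nsets {..<n} k. P (resample S a)"
      by (rule exE)
    have a: "P (resample S a)" if "(k, P) \<in> E" "S \<in> nsets {..<n} k" for k P S
      using bspec[OF a0 that(1)] that(2) by simp
    have "\<exists>H\<subseteq>{..<n}. card H = R \<and> (\<forall>j\<in>K. \<forall>S\<in>nsets H (fst j). \<forall>S'\<in>nsets H (fst j).
      snd j (resample S a) = snd j (resample S' a))"
      by (rule n[rule_format, where f = "\<lambda>j S. snd j (resample S a)"]) auto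
    then obtain H where H: "H \<subseteq> {..<n}" "card H = R"
      and H0: "\<forall>j\<in>K. \<forall>S\<in>nsets H (fst j). \<forall>S'\<in>nsets H (fst j).
        snd j (resample S a) = snd j (resample S' a)"
      by (elim exE conjE)
    have H3: "P (resample S a) = P (resample S' a)"
      if "(k, P) \<in> K" "S \<in> nsets H k" "S' \<in> nsets H k" for k P S S'
      by (rule bspec[OF bspec[OF bspec[OF H0 that(1), unfolded fst_conv snd_conv] that(2)] that(3)])
    have finH: "finite H" using H(1) finite_subset by blast
    have rr: "P (resample S (resample H a)) = P (resample (nth_of H ` S) a)"
      if "definable L M A (nsets {..<k} m \<times> X) P" "S \<in> nsets {..<R} k" for k P S
      by (rule definable_cong[OF that(1)]) (use that(2) H(2) finH resample_resample in auto)
    have HS: "nth_of H ` S \<in> nsets H k" if "S \<in> nsets {..<R} k" for S k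
      by (rule nth_of_image_nsets[OF _ that, of _ UNIV]) (use finH H(2) in \<open>auto simp: nsets_def\<close>)
    have "Q j (resample H a)" if j: "j \<in> J0" for j
    proof (cases j)
      case (Inl t)
      obtain k P S where t: "t = (k, P, S)" by (cases t)
      have 1: "(k, P) \<in> E" "S \<in> nsets {..<R} k"
        using J0'[OF j] R[OF j] by (auto simp: Inl t J1_def sets_def nsets_def)
      have "nth_of H ` S \<in> nsets {..<n} k" using HS[OF 1(2)] H(1) by (auto simp: nsets_def)
      then show ?thesis using a[OF 1(1)] rr[OF E[OF 1(1)] 1(2)] by (simp add: Inl t Q_def)
    next
      case (Inr t)
      obtain k P S S' where t: "t = (k, P, S, S')" by (cases t)
      have 1: "definable L M A (nsets {..<k} m \<times> X) P" "S \<in> nsets {..<R} k" "S' \<in> nsets {..<R} k"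
        using J0'[OF j] R[OF j] by (auto simp: Inr t J2_def sets_def nsets_def)
      have "(k, P) \<in> K" unfolding K_def by (rule image_eqI[OF _ j]) (simp add: Inr t)
      then show ?thesis
        using H3[OF _ HS[OF 1(2)] HS[OF 1(3)]] rr[OF 1(1,2)] rr[OF 1(1,3)] by (simp add: Inr t Q_def)
    qed
    then show "\<exists>a. \<forall>j\<in>J0. Q j a" by blast
  qed
  then obtain a where a: "\<And>j. j \<in> J1 <+> J2 \<Longrightarrow> Q j a" by blast
  show ?thesis
  proof (rule that[of a])
    show "P (resample S a)" if "(k, P) \<in> E" "S \<in> nsets UNIV k" for k P S
      using a[of "Inl (k, P, S)"] that by (auto simp: J1_def Q_def)
    show "P (resample S a) = P (resample S' a)"
      if "definable L M A (nsets {..<k} m \<times> X) P" "S \<in> nsets UNIV k" "S' \<in> nsets UNIV k" for k P S S'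
      using a[of "Inr (k, P, S, S')"] InrI[of "(k, P, S, S')" J2 J1] that by (simp add: J2_def Q_def)
  qed
qed

end

section \<open>Dividing and forking\<close>

lemma realizes_tp_iff:
  "realizes M y (tp L M Y e C) \<longleftrightarrow> tp L M Y y C = tp L M Y e C"
proof
  assume r: "realizes M y (tp L M Y e C)"
  have "sat (named M) y \<phi> \<longleftrightarrow> sat (named M) e \<phi>" if \<phi>: "\<phi> \<in> forms (lang_over L C) Y" for \<phi>
  proof (cases "sat (named M) e \<phi>")
    case True
    then have "\<phi> \<in> tp L M Y e C" using \<phi> by (simp add: tp_def)
    then have "sat (named M) y \<phi>" using r unfolding realizes_def by (rule bspec[rotated])
    then show ?thesis using True by simp
  next
    case False
    then have "Neg \<phi> \<in> tp L M Y e C" using \<phi> by (simp add: tp_def forms_def)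
    then have "sat (named M) y (Neg \<phi>)" using r unfolding realizes_def by (rule bspec[rotated])
    then show ?thesis using False by simp
  qed
  then show "tp L M Y y C = tp L M Y e C" unfolding tp_def by blast
next
  assume "tp L M Y y C = tp L M Y e C"
  then have "realizes M y (tp L M Y e C) \<longleftrightarrow> realizes M y (tp L M Y y C)" by simp
  moreover have "realizes M y (tp L M Y y C)" unfolding realizes_def tp_def by blast
  ultimately show "realizes M y (tp L M Y e C)" by blast
qed

lemma tp_mono:
  assumes "tp L M Z y C = tp L M Z y' C" "C' \<subseteq> C"
  shows "tp L M Z y C' = tp L M Z y' C'"
  unfolding tp_eq_iff
proof (intro allI impI)
  fix P assume "definable L M C' Z P"
  then have "definable L M C Z P" using assms(2) by (rule definable_mono) simp
  then show "P y = P y'" using assms(1) unfolding tp_eq_iff by blast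
qed

text \<open>
  The definition of dividing demands a formula without parameters and a tuple indexed by
  natural numbers. The finitely many parameters from \<open>A\<close> in \<open>P\<close> join the finitely many
  variables from \<open>Z\<close> in one such tuple.
\<close>

lemma dividing_formula:
  fixes L :: "('f, 'r) lang" and M :: "('f, 'r, 'm) struc"
    and P :: "('y + 'z \<Rightarrow> 'm) \<Rightarrow> bool" and c :: "nat \<Rightarrow> 'z \<Rightarrow> 'm"
  assumes P: "definable L M A (Y <+> Z) P" and inf: "infinite (UNIV :: 'z set)"
    and same: "\<And>i. tp L M Z (c i) A = tp L M Z d A"
    and inc: "\<And>S. finite S \<Longrightarrow> card S = k \<Longrightarrow> \<not> (\<exists>y. \<forall>i\<in>S. P (case_sum y (c i)))"
  shows "\<exists>\<phi> b. \<phi> \<in> forms L (Y <+> UNIV) \<and> divides L M \<phi> b A \<and>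
    (\<forall>y. sat M (case_sum y b) \<phi> \<longleftrightarrow> P (case_sum y d))"
proof -
  obtain \<psi> where \<psi>: "\<psi> \<in> forms L ((Y <+> Z) <+> A)" "\<And>s. P s \<longleftrightarrow> sat M (case_sum s id) \<psi>"
    using definable_unname[OF P] by blast
  define param :: "('y + 'z) + 'm \<Rightarrow> ('z + 'm)" where
    "param = case_sum (case_sum undefined Inl) Inr"
  define U where "U = param ` (fv \<psi> - range (Inl \<circ> Inl))"
  have U: "U \<subseteq> Z <+> A"
    using \<psi>(1) by (auto simp: U_def param_def forms_def split: sum.splits)
  have "finite U" by (simp add: U_def finite_fv)
  from finite_imp_inj_to_nat_seg[OF this]
  obtain \<theta> :: "'z + 'm \<Rightarrow> nat" where \<theta>: "inj_on \<theta> U" by (elim exE conjE)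
  define g :: "('y + 'z) + 'm \<Rightarrow> ('f, 'y + nat) trm" where
    "g x = (case x of Inl (Inl v) \<Rightarrow> Var (Inl v) | _ \<Rightarrow> Var (Inr (\<theta> (param x))))" for x
  have inf': "infinite (UNIV :: ('y + nat) set)" by simp
  have "\<exists>\<phi>. wf_fml L \<phi> \<and> fv \<phi> \<subseteq> (\<Union>x\<in>fv \<psi>. tvars (g x)) \<and>
        (\<forall>s. sat M s \<phi> \<longleftrightarrow> sat M (\<lambda>x. trm_val M s (g x)) \<psi>)"
  proof (rule substitution[OF inf', of M id M L L \<psi> g])
    show "wf_fml L \<psi>" using \<psi>(1) by (simp add: forms_def)
    show "wf_trm L (g x)" for x by (simp add: g_def split: sum.splits)
  qed auto
  then obtain \<phi> where \<phi>: "wf_fml L \<phi>" "fv \<phi> \<subseteq> (\<Union>x\<in>fv \<psi>. tvars (g x))"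
      and "\<forall>s. sat M s \<phi> \<longleftrightarrow> sat M (\<lambda>x. trm_val M s (g x)) \<psi>" by (elim exE conjE)
  note \<phi>3 = this(3)[rule_format]
  have fvy: "v \<in> Y" if "Inl v \<in> fv \<phi>" for v
  proof -
    from that \<phi>(2) obtain x where x: "x \<in> fv \<psi>" "Inl v \<in> tvars (g x)" by blast
    then have "x = Inl (Inl v)" by (auto simp: g_def split: sum.splits)
    then show ?thesis using x(1) \<psi>(1) by (auto simp: forms_def)
  qed
  have fvn: "n \<in> \<theta> ` U" if "Inr n \<in> fv \<phi>" for n
  proof -
    from that \<phi>(2) obtain x where x: "x \<in> fv \<psi>" "Inr n \<in> tvars (g x)" by blast
    then have "x \<notin> range (Inl \<circ> Inl)" "n = \<theta> (param x)" by (auto simp: g_def split: sum.splits)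
    then show ?thesis using x(1) unfolding U_def by blast
  qed
  define \<beta> where "\<beta> e = place (inv_into U \<theta>) e" for e :: "'z \<Rightarrow> 'm"
  have sat\<beta>: "sat M (case_sum y (\<beta> e)) \<phi> \<longleftrightarrow> P (case_sum y e)" for y e
    unfolding \<phi>3 \<psi>(2)
  proof (rule sat_cong)
    fix x assume x: "x \<in> fv \<psi>"
    show "trm_val M (case_sum y (\<beta> e)) (g x) = case_sum (case_sum y e) id x"
    proof (cases "x \<in> range (Inl \<circ> Inl)")
      case True
      then show ?thesis by (auto simp: g_def)
    next
      case False
      then have "param x \<in> U" using x by (auto simp: U_def)
      then have "inv_into U \<theta> (\<theta> (param x)) = param x" by (rule inv_into_f_f[OF \<theta>])
      then show ?thesis using False
        by (auto simp: g_def \<beta>_def place_def param_def split: sum.splits)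
    qed
  qed
  have "tp L M {n. Inr n \<in> fv \<phi>} (\<beta> (c i)) A = tp L M {n. Inr n \<in> fv \<phi>} (\<beta> d) A" for i
    unfolding tp_eq_iff
  proof (intro allI impI)
    fix Q assume Q: "definable L M A {n. Inr n \<in> fv \<phi>} Q"
    have "definable L M A Z (\<lambda>e. Q (place (inv_into U \<theta>) e))"
      by (rule definable_place[OF Q inf]) (use U fvn inv_into_into[of _ \<theta> U] in auto)
    then show "Q (\<beta> (c i)) = Q (\<beta> d)"
      using same[of i] unfolding tp_eq_iff \<beta>_def by blast
  qed
  then have "divides L M \<phi> (\<beta> d) A"
    unfolding divides_def
    by (intro exI[of _ k] exI[of _ "\<lambda>i. \<beta> (c i)"]) (use inc sat\<beta> in auto)
  moreover have "\<phi> \<in> forms L (Y <+> UNIV)"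
  proof -
    have "x \<in> Y <+> UNIV" if "x \<in> fv \<phi>" for x using that fvy by (cases x) auto
    then show ?thesis using \<phi>(1) by (auto simp: forms_def)
  qed
  ultimately show ?thesis using sat\<beta> by (intro exI[of _ \<phi>] exI[of _ "\<beta> d"]) simp
qed

context monster
begin

text \<open>
  Dividing over \<open>A\<close> for a definable predicate \<open>P(y, d)\<close> that may have parameters in \<open>A\<close>,
  with \<open>d\<close> a tuple of any length.
\<close>

definition divides_pred ::
  "'m set \<Rightarrow> 'y set \<Rightarrow> 'z set \<Rightarrow> (('y + 'z \<Rightarrow> 'm) \<Rightarrow> bool) \<Rightarrow> ('z \<Rightarrow> 'm) \<Rightarrow> bool" where
  "divides_pred A Y Z P d \<longleftrightarrow> definable L M A (Y <+> Z) P \<and>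
     (\<exists>k (c :: nat \<Rightarrow> 'z \<Rightarrow> 'm). (\<forall>i. tp L M Z (c i) A = tp L M Z d A) \<and>
       (\<forall>S. finite S \<longrightarrow> card S = k \<longrightarrow> \<not> (\<exists>y. \<forall>i\<in>S. P (case_sum y (c i)))))"

text \<open>
  A disjunction of finitely many dividing formulas cannot be implied. Avoiding several of
  them at once is what non-forking gives beyond non-dividing.
\<close>

lemma nonforking_avoids:
  fixes P :: "'i \<Rightarrow> ('v + 'z \<Rightarrow> 'm) \<Rightarrow> bool"
  assumes nf: "\<not> forks L M Y \<Sigma> A" and I: "finite I" and inf: "infinite (UNIV :: 'z set)"
    and div: "\<And>i. i \<in> I \<Longrightarrow> divides_pred A Y Z (P i) (d i)"
  obtains y where "realizes M y \<Sigma>" "\<And>i. i \<in> I \<Longrightarrow> \<not> P i (case_sum y (d i))"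
proof -
  have "\<forall>i\<in>I. \<exists>\<phi>b. fst \<phi>b \<in> forms L (Y <+> UNIV) \<and> divides L M (fst \<phi>b) (snd \<phi>b) A \<and>
      (\<forall>y. sat M (case_sum y (snd \<phi>b)) (fst \<phi>b) \<longleftrightarrow> P i (case_sum y (d i)))"
  proof
    fix i assume "i \<in> I"
    from div[OF this] obtain k c where "definable L M A (Y <+> Z) (P i)"
      "\<And>j. tp L M Z (c j) A = tp L M Z (d i) A"
      and *: "\<And>S :: nat set. finite S \<Longrightarrow> card S = k \<Longrightarrow> \<not> (\<exists>y. \<forall>j\<in>S. P i (case_sum y (c j)))"
      unfolding divides_pred_def by blast
    have "\<exists>\<phi> b. \<phi> \<in> forms L (Y <+> UNIV) \<and> divides L M \<phi> b A \<and>
        (\<forall>y. sat M (case_sum y b) \<phi> \<longleftrightarrow> P i (case_sum y (d i)))"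
      by (rule dividing_formula[OF \<open>definable L M A (Y <+> Z) (P i)\<close> inf
        \<open>\<And>j. tp L M Z (c j) A = tp L M Z (d i) A\<close> *])
    then obtain \<phi> b where "\<phi> \<in> forms L (Y <+> UNIV) \<and> divides L M \<phi> b A \<and>
        (\<forall>y. sat M (case_sum y b) \<phi> \<longleftrightarrow> P i (case_sum y (d i)))" by (elim exE)
    then show "\<exists>\<phi>b. fst \<phi>b \<in> forms L (Y <+> UNIV) \<and> divides L M (fst \<phi>b) (snd \<phi>b) A \<and>
      (\<forall>y. sat M (case_sum y (snd \<phi>b)) (fst \<phi>b) \<longleftrightarrow> P i (case_sum y (d i)))"
      by (intro exI[of _ "(\<phi>, b)"]) simp
  qed
  from bchoice[OF this] obtain F where F: "\<And>i. i \<in> I \<Longrightarrow> fst (F i) \<in> forms L (Y <+> UNIV)"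
     "\<And>i. i \<in> I \<Longrightarrow> divides L M (fst (F i)) (snd (F i)) A"
     "\<And>i y. i \<in> I \<Longrightarrow> sat M (case_sum y (snd (F i))) (fst (F i)) \<longleftrightarrow> P i (case_sum y (d i))"
    by blast
  have "\<not> (\<forall>a. realizes M a \<Sigma> \<longrightarrow> (\<exists>(\<phi>, b)\<in>F ` I. sat M (case_sum a b) \<phi>))"
  proof
    assume cov: "\<forall>a. realizes M a \<Sigma> \<longrightarrow> (\<exists>(\<phi>, b)\<in>F ` I. sat M (case_sum a b) \<phi>)"
    have "forks L M Y \<Sigma> A"
      unfolding forks_def
      by (intro exI[of _ "F ` I"] conjI cov finite_imageI I) (use F in \<open>auto simp: case_prod_beta\<close>)
    with nf show False by simp
  qed
  then obtain y where "realizes M y \<Sigma>" "\<And>i. i \<in> I \<Longrightarrow> \<not> sat M (case_sum y (snd (F i))) (fst (F i))"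
    by (auto simp: case_prod_beta)
  then show ?thesis using that F(3) by blast
qed

end

section \<open>Enlarging the base of a type\<close>

lemma indiscernibleI:
  assumes "\<And>n s t P. increasing I n s \<Longrightarrow> increasing I n t \<Longrightarrow>
    definable L M A ({..<n} \<times> coords I) P \<Longrightarrow>
    P (\<lambda>(k, y). trm_at I (s k) y) = P (\<lambda>(k, y). trm_at I (t k) y)"
  shows "indiscernible L M I A"
  unfolding indiscernible_def tp_eq_iff using assms by blast

lemma indiscernibleD:
  assumes "indiscernible L M I A" "increasing I n s" "increasing I n t"
    "definable L M A ({..<n} \<times> coords I) P"
  shows "P (\<lambda>(k, y). trm_at I (s k) y) = P (\<lambda>(k, y). trm_at I (t k) y)"
  using assms unfolding indiscernible_def tp_eq_iff by blast

lemma infinite_nat_vars: "infinite (UNIV :: (nat \<times> 'x) set)"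
  by (simp add: finite_prod)

context monster
begin

text \<open>
  The set \<open>B\<close> is appended to each term of the given sequences. A sequence with terms that
  contain \<open>B\<close> and that is indiscernible over \<open>bA\<close> is indiscernible over \<open>bB\<close>, as
  parameters from \<open>B\<close> can be read off from the first of the terms involved.
\<close>

lemma dpr_less_base:
  assumes less: "dpr_less \<kappa> L M X A q \<mu>" and B: "small \<kappa> B" "A \<subseteq> B"
    and pq: "q \<subseteq> p"
  shows "dpr_less \<kappa> L M X B p \<mu>"
  unfolding dpr_less_def
proof (intro allI impI, elim conjE)
  fix I :: "'v \<Rightarrow> ('v, 'm) seq" and b
  assume inf: "\<forall>\<alpha>\<in>Field \<mu>. infinite_seq \<kappa> (I \<alpha>)"
    and mut: "mutually_indiscernible L M (Field \<mu>) I B" and b: "realizes M b p"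
  have "\<exists>j :: 'v + 'm \<Rightarrow> 'v. inj_on j (coords (I \<alpha>) <+> B)" if "\<alpha> \<in> Field \<mu>" for \<alpha>
  proof -
    have "small \<kappa> (coords (I \<alpha>) <+> B)"
      using inf that B(1) by (auto simp: infinite_seq_def intro: small_Plus)
    then show ?thesis by (rule small_embeds) blast
  qed
  then obtain j :: "'v \<Rightarrow> 'v + 'm \<Rightarrow> 'v" where j: "\<And>\<alpha>. \<alpha> \<in> Field \<mu> \<Longrightarrow> inj_on (j \<alpha>) (coords (I \<alpha>) <+> B)"
    by metis
  define J where "J \<alpha> = \<lparr>idx = idx (I \<alpha>), ord = ord (I \<alpha>), coords = j \<alpha> ` (coords (I \<alpha>) <+> B),
     trm_at = \<lambda>i y. case inv_into (coords (I \<alpha>) <+> B) (j \<alpha>) y of Inl k \<Rightarrow> trm_at (I \<alpha>) i k | Inr c \<Rightarrow> c\<rparr>" for \<alpha>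
  have inv: "k \<in> coords (I \<alpha>) \<Longrightarrow> inv_into (coords (I \<alpha>) <+> B) (j \<alpha>) (j \<alpha> (Inl k)) = Inl k"
    "c \<in> B \<Longrightarrow> inv_into (coords (I \<alpha>) <+> B) (j \<alpha>) (j \<alpha> (Inr c)) = Inr c"
    if "\<alpha> \<in> Field \<mu>" for \<alpha> k c
    by (rule inv_into_f_f[OF j[OF that]], blast)+
  have incr: "increasing (J \<alpha>) n s \<longleftrightarrow> increasing (I \<alpha>) n s" for \<alpha> n s
    by (simp add: increasing_def J_def)
  have elems: "seq_elems (J \<alpha>) \<subseteq> seq_elems (I \<alpha>) \<union> B" if "\<alpha> \<in> Field \<mu>" for \<alpha>
    using inv[OF that] by (auto simp: seq_elems_def J_def)
  have "infinite_seq \<kappa> (J \<alpha>)" if "\<alpha> \<in> Field \<mu>" for \<alpha>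
    using inf that B(1) by (auto simp: infinite_seq_def J_def intro!: small_image small_Plus)
  moreover have "mutually_indiscernible L M (Field \<mu>) J A"
    unfolding mutually_indiscernible_def
  proof
    fix \<alpha> assume \<alpha>: "\<alpha> \<in> Field \<mu>"
    let ?C = "A \<union> (\<Union>\<beta>\<in>Field \<mu> - {\<alpha>}. seq_elems (J \<beta>))"
    let ?C' = "B \<union> (\<Union>\<beta>\<in>Field \<mu> - {\<alpha>}. seq_elems (I \<beta>))"
    have CC: "?C \<subseteq> ?C'" using elems B(2) by blast
    have ind: "indiscernible L M (I \<alpha>) ?C'" using mut \<alpha> by (simp add: mutually_indiscernible_def)
    show "indiscernible L M (J \<alpha>) ?C"
    proof (rule indiscernibleI)
      fix n s t P
      assume st: "increasing (J \<alpha>) n s" "increasing (J \<alpha>) n t"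
        and P: "definable L M ?C ({..<n} \<times> coords (J \<alpha>)) P"
      define g :: "nat \<times> 'v \<Rightarrow> (nat \<times> 'v) + 'm" where
        "g = (\<lambda>(l, y). case inv_into (coords (I \<alpha>) <+> B) (j \<alpha>) y of Inl k \<Rightarrow> Inl (l, k) | Inr c \<Rightarrow> Inr c)"
      have "definable L M ?C' ({..<n} \<times> coords (I \<alpha>)) (\<lambda>z. P (place g z))"
        by (rule definable_place[OF P infinite_nat_vars _ CC])
          (use inv[OF \<alpha>] in \<open>auto simp: J_def g_def\<close>)
      from indiscernibleD[OF ind st[unfolded incr] this]
      show "P (\<lambda>(k, y). trm_at (J \<alpha>) (s k) y) = P (\<lambda>(k, y). trm_at (J \<alpha>) (t k) y)"
        by (rule back_subst[of "\<lambda>x. x"], intro arg_cong2[of _ _ _ _ "(=)"] arg_cong[of _ _ P])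
          (auto simp: fun_eq_iff place_def g_def J_def split: sum.splits)
    qed
  qed
  moreover have "realizes M b q" using b pq by (auto simp: realizes_def)
  ultimately obtain \<beta> where \<beta>: "\<beta> \<in> Field \<mu>" "indiscernible L M (J \<beta>) (b ` X \<union> A)"
    using less unfolding dpr_less_def by blast
  have "indiscernible L M (I \<beta>) (b ` X \<union> B)"
  proof (rule indiscernibleI)
    fix n s t P
    assume st: "increasing (I \<beta>) n s" "increasing (I \<beta>) n t"
      and P: "definable L M (b ` X \<union> B) ({..<n} \<times> coords (I \<beta>)) P"
    show "P (\<lambda>(k, y). trm_at (I \<beta>) (s k) y) = P (\<lambda>(k, y). trm_at (I \<beta>) (t k) y)"
    \<comment> \<open>the elements of \<open>B\<close> are read off from the term at \<open>s 0\<close>, so the empty tuple is treated separately\<close>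
    proof (cases "n = 0")
      case True
      show ?thesis by (rule definable_cong[OF P]) (simp add: True)
    next
      case False
      have "definable L M (id ` B \<union> (b ` X \<union> A)) ({..<n} \<times> coords (I \<beta>)) P"
        by (rule definable_mono[OF P]) auto
      then obtain Q where Q: "definable L M (b ` X \<union> A) (B <+> ({..<n} \<times> coords (I \<beta>))) Q"
        "\<And>z. P z \<longleftrightarrow> Q (case_sum id z)"
        using definable_absorb[OF _ infinite_nat_vars] by blast
      define g where "g = case_sum (\<lambda>c. (0, j \<beta> (Inr c))) (\<lambda>(l, k). (l :: nat, j \<beta> (Inl k)))"
      have "definable L M (b ` X \<union> A) ({..<n} \<times> coords (J \<beta>)) (\<lambda>z. Q (\<lambda>x. z (g x)))"
        by (rule definable_reindex[OF Q(1) infinite_nat_vars])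
          (use False in \<open>auto simp: g_def J_def\<close>)
      from indiscernibleD[OF \<beta>(2) st[folded incr] this]
      have "Q (\<lambda>x. (\<lambda>(k, y). trm_at (J \<beta>) (s k) y) (g x)) = Q (\<lambda>x. (\<lambda>(k, y). trm_at (J \<beta>) (t k) y) (g x))" .
      moreover have "Q (\<lambda>x. (\<lambda>(k, y). trm_at (J \<beta>) (s k) y) (g x)) = P (\<lambda>(k, y). trm_at (I \<beta>) (s k) y)" for s
        unfolding Q(2)
        by (rule definable_cong[OF Q(1)]) (use inv[OF \<beta>(1)] in \<open>auto simp: g_def J_def\<close>)
      ultimately show ?thesis by simp
    qed
  qed
  with \<beta>(1) show "\<exists>\<beta>\<in>Field \<mu>. indiscernible L M (I \<beta>) (b ` X \<union> B)" by blast
qed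

end

section \<open>Points of a family of sequences\<close>

text \<open>
  A point \<open>(\<alpha>, i)\<close> is the position \<open>i\<close> of the sequence \<open>I \<alpha>\<close>. The points are ordered
  lexicographically, so the positions of each \<open>I \<alpha>\<close> form a convex segment.
\<close>

definition pt_less :: "'v rel \<Rightarrow> ('v \<Rightarrow> ('v, 'm) seq) \<Rightarrow> 'v \<times> 'v \<Rightarrow> 'v \<times> 'v \<Rightarrow> bool" where
  "pt_less \<mu> I = (\<lambda>(\<alpha>, i) (\<beta>, j). \<alpha> \<noteq> \<beta> \<and> (\<alpha>, \<beta>) \<in> \<mu> \<or> \<alpha> = \<beta> \<and> i \<noteq> j \<and> (i, j) \<in> ord (I \<alpha>))"

definition points :: "'v rel \<Rightarrow> ('v \<Rightarrow> ('v, 'm) seq) \<Rightarrow> ('v \<times> 'v) set" where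
  "points \<mu> I = Sigma (Field \<mu>) (\<lambda>\<alpha>. idx (I \<alpha>))"

definition rank :: "'v rel \<Rightarrow> ('v \<Rightarrow> ('v, 'm) seq) \<Rightarrow> ('v \<times> 'v) set \<Rightarrow> 'v \<times> 'v \<Rightarrow> nat" where
  "rank \<mu> I P q = card {q'\<in>P. pt_less \<mu> I q' q}"

lemma increasing_inj: "increasing I n s \<Longrightarrow> inj_on s {..<n}"
  by (rule linorder_inj_onI) (auto simp: increasing_def)

locale skeleton =
  fixes \<mu> :: "'v rel" and I :: "'v \<Rightarrow> ('v, 'm) seq"
  assumes lin_\<mu>: "linear_order_on (Field \<mu>) \<mu>"
    and lin: "\<And>\<alpha>. \<alpha> \<in> Field \<mu> \<Longrightarrow> linear_order_on (idx (I \<alpha>)) (ord (I \<alpha>))"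
begin

lemma pt_less_irrefl: "\<not> pt_less \<mu> I q q"
  by (auto simp: pt_less_def)

lemma pt_less_trans:
  assumes "q1 \<in> points \<mu> I" "q2 \<in> points \<mu> I" "q3 \<in> points \<mu> I" "pt_less \<mu> I q1 q2" "pt_less \<mu> I q2 q3"
  shows "pt_less \<mu> I q1 q3"
proof -
  obtain a1 i1 a2 i2 a3 i3 where q: "q1 = (a1, i1)" "q2 = (a2, i2)" "q3 = (a3, i3)"
    by (metis surj_pair)
  have t: "trans \<mu>" "antisym \<mu>"
    using lin_\<mu> by (auto simp: linear_order_on_def partial_order_on_def preorder_on_def)
  have t1: "trans (ord (I a1))" "antisym (ord (I a1))"
    using lin[of a1] assms(1) q by (auto simp: points_def linear_order_on_def partial_order_on_def preorder_on_def)
  consider "a1 \<noteq> a2" "a2 \<noteq> a3" | "a1 = a2" "a2 \<noteq> a3" | "a1 \<noteq> a2" "a2 = a3" | "a1 = a2" "a2 = a3"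
    by blast
  then show ?thesis
  proof cases
    case 1
    then have "(a1, a2) \<in> \<mu>" "(a2, a3) \<in> \<mu>" using assms(4,5) by (auto simp: q pt_less_def)
    then have "(a1, a3) \<in> \<mu>" "a1 \<noteq> a3" using t 1 by (meson transD, metis antisymD)
    then show ?thesis by (simp add: q pt_less_def)
  next
    case 4
    then have "(i1, i2) \<in> ord (I a1)" "(i2, i3) \<in> ord (I a1)" "i1 \<noteq> i2" using assms(4,5) by (auto simp: q pt_less_def)
    then have "(i1, i3) \<in> ord (I a1)" "i1 \<noteq> i3" using t1 by (meson transD, metis antisymD)
    then show ?thesis using 4 by (simp add: q pt_less_def)
  qed (use assms(4,5) in \<open>auto simp: q pt_less_def\<close>)
qed

lemma pt_less_total:
  assumes "q1 \<in> points \<mu> I" "q2 \<in> points \<mu> I" "q1 \<noteq> q2"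
  shows "pt_less \<mu> I q1 q2 \<or> pt_less \<mu> I q2 q1"
proof -
  obtain a1 i1 a2 i2 where q: "q1 = (a1, i1)" "q2 = (a2, i2)" by (metis surj_pair)
  have m: "a1 \<in> Field \<mu>" "a2 \<in> Field \<mu>" "i1 \<in> idx (I a1)" "i2 \<in> idx (I a2)"
    using assms by (auto simp: points_def q)
  show ?thesis
  proof (cases "a1 = a2")
    case True
    have "total_on (idx (I a1)) (ord (I a1))" using lin[OF m(1)] by (simp add: linear_order_on_def)
    then show ?thesis using True m assms(3) unfolding total_on_def q pt_less_def by auto
  next
    case False
    have "total_on (Field \<mu>) \<mu>" using lin_\<mu> by (simp add: linear_order_on_def)
    then show ?thesis using False m unfolding total_on_def q pt_less_def by auto
  qed
qed

lemma pt_less_asym: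
  assumes "q1 \<in> points \<mu> I" "q2 \<in> points \<mu> I" "pt_less \<mu> I q1 q2"
  shows "\<not> pt_less \<mu> I q2 q1"
  using pt_less_trans[of q1 q2 q1] pt_less_irrefl[of q1] assms by blast

lemma rank_mono:
  assumes "finite P" "P \<subseteq> points \<mu> I" "q \<in> P" "q' \<in> P" "pt_less \<mu> I q q'"
  shows "rank \<mu> I P q < rank \<mu> I P q'"
  unfolding rank_def
proof (rule psubset_card_mono)
  show "finite {r\<in>P. pt_less \<mu> I r q'}" using assms(1) by simp
  have "q \<in> {r\<in>P. pt_less \<mu> I r q'} - {r\<in>P. pt_less \<mu> I r q}"
    using assms pt_less_irrefl by simp
  moreover have "{r\<in>P. pt_less \<mu> I r q} \<subseteq> {r\<in>P. pt_less \<mu> I r q'}"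
  proof
    fix r assume r: "r \<in> {r\<in>P. pt_less \<mu> I r q}"
    then have "pt_less \<mu> I r q'"
      using assms by (intro pt_less_trans[of r q q']) auto
    then show "r \<in> {r\<in>P. pt_less \<mu> I r q'}" using r by simp
  qed
  ultimately show "{r\<in>P. pt_less \<mu> I r q} \<subset> {r\<in>P. pt_less \<mu> I r q'}" by blast
qed

lemma rank_less:
  assumes "finite P" "q \<in> P"
  shows "rank \<mu> I P q < card P"
  unfolding rank_def
  by (rule psubset_card_mono[OF assms(1)]) (use assms(2) pt_less_irrefl in blast)

text \<open>
  The value of an increasing position map at \<open>q\<close> can be recovered from its image and the
  rank of \<open>q\<close>. This lets colourings of sets of positions see which position belongs to
  which point.
\<close>

lemma nth_of_rank_image:
  assumes P: "finite P" "P \<subseteq> points \<mu> I"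
    and g: "\<And>q q'. q \<in> P \<Longrightarrow> q' \<in> P \<Longrightarrow> pt_less \<mu> I q q' \<Longrightarrow> g q < (g q' :: nat)"
    and q: "q \<in> P"
  shows "nth_of (g ` P) (rank \<mu> I P q) = g q"
proof -
  have iff: "pt_less \<mu> I r q \<longleftrightarrow> g r < g q" if "r \<in> P" for r
    using g[OF that q] g[OF q that] pt_less_total[of r q] that q P(2) by (metis less_asym less_irrefl subsetD)
  have inj: "inj_on g P"
    using g pt_less_total P(2) unfolding inj_on_def by (metis less_irrefl subsetD)
  have "{t\<in>g ` P. t < g q} = g ` {r\<in>P. pt_less \<mu> I r q}" using iff by auto
  then have "card {t\<in>g ` P. t < g q} = rank \<mu> I P q"
    unfolding rank_def by (simp add: card_image inj_on_subset[OF inj])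
  then show ?thesis using nth_of_rank[of "g ` P" "g q"] P(1) q by simp
qed

lemma inj_on_increasing:
  assumes P: "P \<subseteq> points \<mu> I"
    and g: "\<And>q q'. q \<in> P \<Longrightarrow> q' \<in> P \<Longrightarrow> pt_less \<mu> I q q' \<Longrightarrow> g q < (g q' :: nat)"
  shows "inj_on g P"
  using g pt_less_total P unfolding inj_on_def by (metis less_irrefl subsetD)

end

text \<open>
  Maps on a set of points that replace positions of each sequence by other positions of
  the same sequence in the same order. They may move positions of several sequences at
  once.
\<close>

definition order_embedding ::
  "'v rel \<Rightarrow> ('v \<Rightarrow> ('v, 'm) seq) \<Rightarrow> ('v \<times> 'v) set \<Rightarrow> ('v \<times> 'v \<Rightarrow> 'v \<times> 'v) \<Rightarrow> bool" where
  "order_embedding \<mu> I P f \<longleftrightarrow> (\<forall>q\<in>P. f q \<in> points \<mu> I \<and> fst (f q) = fst q) \<and>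
     (\<forall>q\<in>P. \<forall>q'\<in>P. pt_less \<mu> I q q' \<longrightarrow> pt_less \<mu> I (f q) (f q'))"

text \<open>
  A cell \<open>((\<alpha>, i), k)\<close> stands for the \<open>k\<close>-th coordinate of the \<open>i\<close>-th term of \<open>I \<alpha>\<close>.
\<close>

definition cells :: "('v \<Rightarrow> ('v, 'm) seq) \<Rightarrow> ('v \<times> 'v) set \<Rightarrow> (('v \<times> 'v) \<times> 'v) set" where
  "cells I P = Sigma P (\<lambda>q. coords (I (fst q)))"

definition seq_of_cells :: "('v \<Rightarrow> ('v, 'm) seq) \<Rightarrow> (('v \<times> 'v) \<times> 'v \<Rightarrow> 'm) \<Rightarrow> 'v \<Rightarrow> ('v, 'm) seq" where
  "seq_of_cells I y \<alpha> = (I \<alpha>)\<lparr>trm_at := \<lambda>i k. y ((\<alpha>, i), k)\<rparr>"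

lemma seq_of_cells_simps [simp]:
  "idx (seq_of_cells I y \<alpha>) = idx (I \<alpha>)" "ord (seq_of_cells I y \<alpha>) = ord (I \<alpha>)"
  "coords (seq_of_cells I y \<alpha>) = coords (I \<alpha>)" "trm_at (seq_of_cells I y \<alpha>) i k = y ((\<alpha>, i), k)"
  by (simp_all add: seq_of_cells_def)

lemma increasing_seq_of_cells [simp]: "increasing (seq_of_cells I y \<alpha>) n s = increasing (I \<alpha>) n s"
  by (simp add: increasing_def)

lemma increasing_in: "increasing I n s \<Longrightarrow> l < n \<Longrightarrow> s l \<in> idx I"
  by (auto simp: increasing_def)

context monster
begin

lemma infinite_cells: "infinite (UNIV :: (('v \<times> 'v) \<times> 'v) set)"
  by (simp add: finite_prod infinite_vars)

text \<open>
  Invariance under order embeddings of finite sets of points implies mutual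
  indiscernibility: take the embedding that replaces \<open>s l\<close> by \<open>t l\<close> in \<open>I \<alpha>\<close> and fixes the
  points of the other sequences that occur as parameters.
\<close>

lemma mutually_indiscernible_seq_of_cells:
  fixes y :: "('v \<times> 'v) \<times> 'v \<Rightarrow> 'm"
  assumes sk: "skeleton \<mu> I"
    and inv: "\<And>\<chi> P f. finite P \<Longrightarrow> P \<subseteq> points \<mu> I \<Longrightarrow> order_embedding \<mu> I P f \<Longrightarrow>
      definable L M B (cells I P) \<chi> \<Longrightarrow> \<chi> y = \<chi> (\<lambda>(q, k). y (f q, k))"
  shows "mutually_indiscernible L M (Field \<mu>) (seq_of_cells I y) B"
  unfolding mutually_indiscernible_def
proof
  interpret skeleton \<mu> I by (rule sk)
  fix \<alpha> assume \<alpha>: "\<alpha> \<in> Field \<mu>"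
  let ?C = "B \<union> (\<Union>\<beta>\<in>Field \<mu> - {\<alpha>}. seq_elems (seq_of_cells I y \<beta>))"
  define W where "W = cells I (points \<mu> I - {\<alpha>} \<times> UNIV)"
  have C: "?C = y ` W \<union> B"
    by (fastforce simp: seq_elems_def W_def cells_def points_def)
  show "indiscernible L M (seq_of_cells I y \<alpha>) ?C"
  proof (rule indiscernibleI, unfold increasing_seq_of_cells seq_of_cells_simps)
    fix n s t P
    assume s: "increasing (I \<alpha>) n s" and t: "increasing (I \<alpha>) n t"
      and P: "definable L M ?C ({..<n} \<times> coords (I \<alpha>)) P"
    obtain Q where Q: "definable L M B (W <+> ({..<n} \<times> coords (I \<alpha>))) Q"
      "\<And>z. P z \<longleftrightarrow> Q (case_sum y z)"
      using definable_absorb[OF P[unfolded C] infinite_nat_vars] by blast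
    obtain V where V: "finite V" "V \<subseteq> W <+> ({..<n} \<times> coords (I \<alpha>))" "definable L M B V Q"
      using definable_finite_support[OF Q(1)] by blast
    define g :: "(('v \<times> 'v) \<times> 'v) + (nat \<times> 'v) \<Rightarrow> ('v \<times> 'v) \<times> 'v" where
      "g = case_sum id (\<lambda>(l, k). ((\<alpha>, s l), k))"
    define \<chi> where "\<chi> z = Q (\<lambda>x. z (g x))" for z
    define R where "R = fst ` g ` V"
    define f where "f = (\<lambda>(\<beta>, i). if \<beta> = \<alpha> then (\<alpha>, t (inv_into {..<n} s i)) else (\<beta>, i))"
    have fs: "f (\<alpha>, s l) = (\<alpha>, t l)" if "l < n" for l
      using inv_into_f_f[OF increasing_inj[OF s], of l] that by (simp add: f_def)
    have fo: "f (\<beta>, i) = (\<beta>, i)" if "\<beta> \<noteq> \<alpha>" for \<beta> i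
      using that by (simp add: f_def)
    have gV: "g x \<in> cells I (points \<mu> I)" if "x \<in> V" for x
      using that V(2) \<alpha> increasing_in[OF s]
      by (force simp: g_def W_def cells_def points_def)
    have R: "finite R" "R \<subseteq> points \<mu> I"
    proof -
      show "finite R" using V(1) by (simp add: R_def)
      have "fst (g x) \<in> points \<mu> I" if "x \<in> V" for x
        using gV[OF that] by (cases "g x") (auto simp: cells_def)
      then show "R \<subseteq> points \<mu> I" by (auto simp: R_def simp del: fst_conv)
    qed
    have Rcases: "(\<exists>l<n. q = (\<alpha>, s l)) \<or> fst q \<noteq> \<alpha>" if "q \<in> R" for q
    proof -
      from that V(2) obtain x where x: "x \<in> W <+> ({..<n} \<times> coords (I \<alpha>))" "q = fst (g x)"
        unfolding R_def by blast
      then show ?thesis by (cases x) (auto simp: g_def W_def cells_def)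
    qed
    have emb: "order_embedding \<mu> I R f"
      unfolding order_embedding_def
    proof (intro conjI ballI impI)
      fix q assume q: "q \<in> R"
      consider l where "l < n" "q = (\<alpha>, s l)" | "fst q \<noteq> \<alpha>" using Rcases[OF q] by blast
      then show "f q \<in> points \<mu> I" "fst (f q) = fst q"
        using fs fo[of "fst q" "snd q"] R(2) q \<alpha> increasing_in[OF t]
        by (cases; force simp: points_def)+
    next
      fix q q' assume q: "q \<in> R" and q': "q' \<in> R" and lt: "pt_less \<mu> I q q'"
      show "pt_less \<mu> I (f q) (f q')"
      proof (cases "fst q = \<alpha> \<and> fst q' = \<alpha>")
        case True
        then obtain l l' where l: "l < n" "q = (\<alpha>, s l)" "l' < n" "q' = (\<alpha>, s l')"
          using Rcases q q' by blast
        have "l < l'"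
        proof (rule ccontr)
          assume "\<not> l < l'"
          then consider "l = l'" | "l' < l" by linarith
          then show False
          proof cases
            case 1
            then show False using lt l pt_less_irrefl by simp
          next
            case 2
            then have "pt_less \<mu> I q' q" using s l by (simp add: increasing_def pt_less_def)
            moreover have "q \<in> points \<mu> I" "q' \<in> points \<mu> I" using R q q' by auto
            ultimately show False using pt_less_asym lt by blast
          qed
        qed
        then show ?thesis using t l fs by (simp add: increasing_def pt_less_def)
      next
        case False
        then consider "fst q \<noteq> fst q'" | "fst q \<noteq> \<alpha>" "fst q' = fst q" by metis
        then show ?thesis
        proof cases
          case 1
          then show ?thesis using lt by (auto simp: f_def pt_less_def split: prod.splits)
        next
          case 2
          then show ?thesis using lt fo by (metis prod.collapse)
        qed
      qed
    qed
    have "definable L M B (cells I R) \<chi>"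
      unfolding \<chi>_def
    proof (rule definable_reindex[OF V(3) infinite_cells], clarify)
      fix q k x assume "(q, k) = g x" "x \<in> V"
      then show "(q, k) \<in> cells I R"
        using gV[of x] by (force simp: R_def cells_def)
    qed
    from inv[OF R emb this] have "\<chi> y = \<chi> (\<lambda>(q, k). y (f q, k))" .
    moreover have "\<chi> y = P (\<lambda>(l, k). y ((\<alpha>, s l), k))"
      unfolding \<chi>_def Q(2)
      by (rule definable_cong[OF V(3)]) (auto simp: g_def split: sum.splits)
    moreover have "\<chi> (\<lambda>(q, k). y (f q, k)) = P (\<lambda>(l, k). y ((\<alpha>, t l), k))"
      unfolding \<chi>_def Q(2)
    proof (rule definable_cong[OF V(3)])
      fix x assume x: "x \<in> V"
      show "(\<lambda>(q, k). y (f q, k)) (g x) = case_sum y (\<lambda>(l, k). y ((\<alpha>, t l), k)) x"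
      proof (cases x)
        case (Inl w)
        then have "fst (fst w) \<noteq> \<alpha>" using x V(2) by (auto simp: W_def cells_def)
        then have "f (fst w) = fst w" using fo by (metis prod.collapse)
        then show ?thesis by (simp add: Inl g_def case_prod_beta)
      next
        case (Inr u)
        then have "fst u < n" using x V(2) by auto
        then show ?thesis using fs by (simp add: Inr g_def case_prod_beta)
      qed
    qed
    ultimately show "P (\<lambda>(l, k). y ((\<alpha>, s l), k)) = P (\<lambda>(l, k). y ((\<alpha>, t l), k))" by simp
  qed
qed

end

section \<open>Mutually indiscernible sequences from patterns\<close>

text \<open>
  \<open>C j \<alpha> k\<close> is the \<open>k\<close>-th coordinate of the \<open>\<alpha>\<close>-th part of the column at position \<open>j\<close>, and
  \<open>pos\<close> puts points at positions. The tuple \<open>a\<close> distinguishes the places of \<open>s \<alpha>\<close> from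
  those of \<open>t \<alpha>\<close>.
\<close>

definition separates :: "('v \<Rightarrow> ('v + nat \<times> 'v \<Rightarrow> 'm) \<Rightarrow> bool) \<Rightarrow> ('v \<Rightarrow> nat \<Rightarrow> 'v) \<Rightarrow> ('v \<Rightarrow> nat \<Rightarrow> 'v) \<Rightarrow>
    (nat \<Rightarrow> 'v \<Rightarrow> 'v \<Rightarrow> 'm) \<Rightarrow> ('v \<times> 'v \<Rightarrow> nat) \<Rightarrow> ('v \<Rightarrow> 'm) \<Rightarrow> 'v \<Rightarrow> bool" where
  "separates \<Phi> s t C pos a \<alpha> \<longleftrightarrow>
     \<Phi> \<alpha> (case_sum a (\<lambda>(l, k). C (pos (\<alpha>, s \<alpha> l)) \<alpha> k)) \<noteq>
     \<Phi> \<alpha> (case_sum a (\<lambda>(l, k). C (pos (\<alpha>, t \<alpha> l)) \<alpha> k))"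

context monster
begin

text \<open>
  By compactness it is enough to find, for finitely many points \<open>P\<close>, values of the cells
  over \<open>P\<close> that are invariant under finitely many embeddings and predicates, together with
  a tuple that satisfies finitely many formulas of \<open>p\<close> and is separated. Ramsey's theorem
  gives a set \<open>H\<close> of \<open>card P\<close> positions on which the columns are homogeneous. The points
  of \<open>P\<close> are put on \<open>H\<close> in lexicographic order; an embedding that moves points within
  their segments respects this order, so homogeneity along the single sequence of columns
  yields mutual invariance.
\<close>

lemma pattern_imp_not_dpr_less:
  fixes \<mu> :: "'v rel" and I :: "'v \<Rightarrow> ('v, 'm) seq" and \<Phi> :: "'v \<Rightarrow> ('v + nat \<times> 'v \<Rightarrow> 'm) \<Rightarrow> bool"
  assumes sk: "skeleton \<mu> I"
    and \<mu>: "small \<kappa> (Field \<mu>)" and X: "small \<kappa> X" and B: "small \<kappa> B"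
    and idx: "\<And>\<alpha>. \<alpha> \<in> Field \<mu> \<Longrightarrow> countable (idx (I \<alpha>)) \<and> infinite (idx (I \<alpha>))"
    and coords: "\<And>\<alpha>. \<alpha> \<in> Field \<mu> \<Longrightarrow> finite (coords (I \<alpha>))"
    and s: "\<And>\<alpha>. \<alpha> \<in> Field \<mu> \<Longrightarrow> increasing (I \<alpha>) (n \<alpha>) (s \<alpha>)"
    and t: "\<And>\<alpha>. \<alpha> \<in> Field \<mu> \<Longrightarrow> increasing (I \<alpha>) (n \<alpha>) (t \<alpha>)"
    and \<Phi>: "\<And>\<alpha>. \<alpha> \<in> Field \<mu> \<Longrightarrow> definable L M B (X <+> ({..<n \<alpha>} \<times> coords (I \<alpha>))) (\<Phi> \<alpha>)"
    and p: "p \<subseteq> forms (lang_over L B) X"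
    and pattern: "\<And>F P \<Delta> N. finite F \<Longrightarrow> F \<subseteq> Field \<mu> \<Longrightarrow> finite P \<Longrightarrow> P \<subseteq> points \<mu> I \<Longrightarrow>
      (\<And>\<alpha> l. \<alpha> \<in> F \<Longrightarrow> l < n \<alpha> \<Longrightarrow> (\<alpha>, s \<alpha> l) \<in> P \<and> (\<alpha>, t \<alpha> l) \<in> P) \<Longrightarrow>
      finite \<Delta> \<Longrightarrow> \<Delta> \<subseteq> p \<Longrightarrow>
      \<exists>C. \<forall>v\<in>nsets {..<N} (card P). \<exists>a. realizes M a \<Delta> \<and>
        (\<forall>\<alpha>\<in>F. separates \<Phi> s t C (\<lambda>q. nth_of v (rank \<mu> I P q)) a \<alpha>)"
  shows "\<not> dpr_less \<kappa> L M X B p \<mu>"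
proof -
  interpret skeleton \<mu> I by (rule sk)
  let ?U = "X <+> cells I (points \<mu> I)"
  define T where "T = {(\<chi> :: (('v \<times> 'v) \<times> 'v \<Rightarrow> 'm) \<Rightarrow> bool, P, f). finite P \<and> P \<subseteq> points \<mu> I \<and> order_embedding \<mu> I P f \<and>
    definable L M B (cells I P) \<chi>}"
  define Q1 where "Q1 \<phi> \<sigma> = sat (named M) (\<lambda>x. \<sigma> (Inl x)) \<phi>"
    for \<phi> :: "('f + 'm, 'r, 'v) fml" and \<sigma> :: "'v + ('v \<times> 'v) \<times> 'v \<Rightarrow> 'm"
  define Q2 where "Q2 = (\<lambda>(\<chi> :: (('v \<times> 'v) \<times> 'v \<Rightarrow> 'm) \<Rightarrow> bool, P :: ('v \<times> 'v) set, f :: 'v \<times> 'v \<Rightarrow> 'v \<times> 'v)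
    (\<sigma> :: 'v + ('v \<times> 'v) \<times> 'v \<Rightarrow> 'm). \<chi> (\<lambda>z. \<sigma> (Inr z)) = \<chi> (\<lambda>(q, k). \<sigma> (Inr (f q, k))))"
  define Q3 where "Q3 \<alpha> \<sigma> \<longleftrightarrow>
      \<Phi> \<alpha> (case_sum (\<lambda>x. \<sigma> (Inl x)) (\<lambda>(l, k). \<sigma> (Inr ((\<alpha>, s \<alpha> l), k)))) \<noteq>
      \<Phi> \<alpha> (case_sum (\<lambda>x. \<sigma> (Inl x)) (\<lambda>(l, k). \<sigma> (Inr ((\<alpha>, t \<alpha> l), k))))"
    for \<alpha> and \<sigma> :: "'v + ('v \<times> 'v) \<times> 'v \<Rightarrow> 'm"
  define Q where "Q = case_sum Q1 (case_sum Q2 Q3)"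
  have inf: "infinite (UNIV :: ('v + ('v \<times> 'v) \<times> 'v) set)" by (simp add: infinite_vars)
  have "\<exists>\<sigma>. \<forall>j\<in>p <+> (T <+> Field \<mu>). Q j \<sigma>"
  proof (rule realize[OF B])
    have "small \<kappa> (cells I (points \<mu> I))"
      unfolding cells_def
    proof (rule small_Sigma)
      show "small \<kappa> (points \<mu> I)"
        unfolding points_def by (rule small_Sigma[OF \<mu>]) (use idx in blast)
      show "countable (coords (I (fst q)))" if "q \<in> points \<mu> I" for q
        using coords that by (auto simp: points_def intro: countable_finite)
    qed
    then show "small \<kappa> ?U" by (rule small_Plus[OF X])
  next
    fix j assume j: "j \<in> p <+> (T <+> Field \<mu>)"
    then consider \<phi> where "j = Inl \<phi>" "\<phi> \<in> p" | \<chi> P f where "j = Inr (Inl (\<chi>, P, f))" "(\<chi>, P, f) \<in> T"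
      | \<alpha> where "j = Inr (Inr \<alpha>)" "\<alpha> \<in> Field \<mu>" by auto
    then show "definable L M B ?U (Q j)"
    proof cases
      case 1
      have "definable L M B X (\<lambda>s. sat (named M) s \<phi>)" using 1 p by (intro definable_form) blast
      then have "definable L M B ?U (\<lambda>\<sigma>. sat (named M) (\<lambda>x. \<sigma> (Inl x)) \<phi>)"
        by (rule definable_reindex[OF _ inf]) auto
      then show ?thesis by (simp add: 1 Q_def Q1_def[abs_def])
    next
      case 2
      then have P: "P \<subseteq> points \<mu> I" and f: "order_embedding \<mu> I P f" and \<chi>: "definable L M B (cells I P) \<chi>"
        by (auto simp: T_def)
      have 3: "definable L M B ?U (\<lambda>\<sigma>. \<chi> (\<lambda>z. \<sigma> (Inr z)))"
        by (rule definable_reindex[OF \<chi> inf]) (use P in \<open>auto simp: cells_def\<close>)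
      have "definable L M B ?U (\<lambda>\<sigma>. \<chi> (\<lambda>z. \<sigma> ((\<lambda>(q, k). Inr (f q, k)) z)))"
      proof (rule definable_reindex[OF \<chi> inf], rule image_subsetI)
        fix z assume "z \<in> cells I P"
        then show "(\<lambda>(q, k). Inr (f q, k)) z \<in> ?U"
          using f by (cases z) (auto simp: cells_def order_embedding_def)
      qed
      then have 4: "definable L M B ?U (\<lambda>\<sigma>. \<chi> (\<lambda>(q, k). \<sigma> (Inr (f q, k))))"
        by (simp add: split_def)
      show ?thesis using definable_eq[OF 3 4] by (simp add: 2 Q_def Q2_def)
    next
      case 3
      have d: "definable L M B ?U (\<lambda>\<sigma>. \<Phi> \<alpha> (case_sum (\<lambda>x. \<sigma> (Inl x)) (\<lambda>(l, k). \<sigma> (Inr ((\<alpha>, s l), k)))))"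
        if s: "increasing (I \<alpha>) (n \<alpha>) s" for s
      proof -
        let ?g = "case_sum Inl (\<lambda>(l, k). Inr ((\<alpha>, s l), k))"
        have "definable L M B ?U (\<lambda>\<sigma>. \<Phi> \<alpha> (\<lambda>x. \<sigma> (?g x)))"
        proof (rule definable_reindex[OF \<Phi>[OF 3(2)] inf], rule image_subsetI)
          fix x assume "x \<in> X <+> ({..<n \<alpha>} \<times> coords (I \<alpha>))"
          then show "?g x \<in> ?U"
            using 3(2) increasing_in[OF s] by (cases x) (auto simp: cells_def points_def)
        qed
        moreover have "(\<lambda>x. \<sigma> (?g x)) = case_sum (\<lambda>x. \<sigma> (Inl x)) (\<lambda>(l, k). \<sigma> (Inr ((\<alpha>, s l), k)))"
          for \<sigma> :: "'v + ('v \<times> 'v) \<times> 'v \<Rightarrow> 'm"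
          by (auto simp: fun_eq_iff split: sum.splits)
        ultimately show ?thesis by simp
      qed
      show ?thesis
        using definable_Not[OF definable_eq[OF d[OF s[OF 3(2)]] d[OF t[OF 3(2)]]]] 
        by (simp add: 3 Q_def Q3_def[abs_def])
    qed
  next
    fix J0 assume J0: "J0 \<subseteq> p <+> (T <+> Field \<mu>)" "finite J0"
    define \<Delta> where "\<Delta> = Inl -` J0"
    define T0 where "T0 = (\<lambda>x. Inr (Inl x)) -` J0"
    define F where "F = (\<lambda>x. Inr (Inr x)) -` J0"
    have fin: "finite \<Delta>" "finite T0" "finite F"
      unfolding \<Delta>_def T0_def F_def by (intro finite_vimageI J0(2) injI; simp)+
    have sub: "\<Delta> \<subseteq> p" "T0 \<subseteq> T" "F \<subseteq> Field \<mu>"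
      using J0(1) by (auto simp: \<Delta>_def T0_def F_def)
    define P where "P = (\<Union>(\<chi>, P, f)\<in>T0. P \<union> f ` P) \<union>
      (\<Union>\<alpha>\<in>F. (\<lambda>l. (\<alpha>, s \<alpha> l)) ` {..<n \<alpha>} \<union> (\<lambda>l. (\<alpha>, t \<alpha> l)) ` {..<n \<alpha>})"
    have T0: "finite P0 \<and> P0 \<subseteq> points \<mu> I \<and> order_embedding \<mu> I P0 f \<and> definable L M B (cells I P0) \<chi>"
      if "(\<chi>, P0, f) \<in> T0" for \<chi> P0 f
      using that sub(2) by (auto simp: T_def)
    have T0P: "P0 \<subseteq> P" "f ` P0 \<subseteq> P" if "(\<chi>, P0, f) \<in> T0" for \<chi> P0 f
      using that unfolding P_def by blast+
    have "finite P" unfolding P_def using fin T0 by auto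
    have Psub: "P \<subseteq> points \<mu> I"
    proof -
      have "f ` P0 \<subseteq> points \<mu> I" if "(\<chi>, P0, f) \<in> T0" for \<chi> P0 f
        using T0[OF that] by (auto simp: order_embedding_def)
      moreover have "(\<alpha>, s \<alpha> l) \<in> points \<mu> I" "(\<alpha>, t \<alpha> l) \<in> points \<mu> I" if "\<alpha> \<in> F" "l < n \<alpha>" for \<alpha> l
        using that sub(3) increasing_in[OF s] increasing_in[OF t] by (auto simp: points_def)
      ultimately show ?thesis unfolding P_def using T0 by fast
    qed
    from ramsey_finitely_many[OF fin(2), where K = "card P" and k = "\<lambda>(\<chi>, P, f). card P"]
    obtain N where N: "\<forall>Z :: nat set. finite Z \<longrightarrow> N \<le> card Z \<longrightarrow> (\<forall>c :: _ \<Rightarrow> nat set \<Rightarrow> bool.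
      \<exists>H\<subseteq>Z. card H = card P \<and> (\<forall>j\<in>T0. \<forall>S\<in>nsets H (case j of (\<chi>, P, f) \<Rightarrow> card P).
        \<forall>S'\<in>nsets H (case j of (\<chi>, P, f) \<Rightarrow> card P). c j S = c j S'))"
      by (rule exE)
    have "\<exists>C. \<forall>v\<in>nsets {..<N} (card P). \<exists>a. realizes M a \<Delta> \<and>
        (\<forall>\<alpha>\<in>F. separates \<Phi> s t C (\<lambda>q. nth_of v (rank \<mu> I P q)) a \<alpha>)"
      by (rule pattern[OF fin(3) sub(3) \<open>finite P\<close> Psub _ fin(1) sub(1)]) (auto simp: P_def)
    then obtain C where C: "\<forall>v\<in>nsets {..<N} (card P). \<exists>a. realizes M a \<Delta> \<and>
        (\<forall>\<alpha>\<in>F. separates \<Phi> s t C (\<lambda>q. nth_of v (rank \<mu> I P q)) a \<alpha>)"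
      by (rule exE)
    \<comment> \<open>the colour of \<open>S\<close> is the truth value of \<open>\<chi>\<close> when the points of its domain \<open>P0\<close> are put on \<open>S\<close>\<close>
    define c where "c = (\<lambda>(\<chi> :: (('v \<times> 'v) \<times> 'v \<Rightarrow> 'm) \<Rightarrow> bool, P0, f :: 'v \<times> 'v \<Rightarrow> 'v \<times> 'v) S.
      \<chi> (\<lambda>(q, k). C (nth_of S (rank \<mu> I P0 q)) (fst q) k))"
    have "\<exists>H\<subseteq>{..<N}. card H = card P \<and> (\<forall>j\<in>T0. \<forall>S\<in>nsets H (case j of (\<chi>, P, f) \<Rightarrow> card P).
        \<forall>S'\<in>nsets H (case j of (\<chi>, P, f) \<Rightarrow> card P). c j S = c j S')"
      by (rule N[rule_format]) auto
    then obtain H where H: "H \<subseteq> {..<N}" "card H = card P"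
      and H0: "\<forall>j\<in>T0. \<forall>S\<in>nsets H (case j of (\<chi>, P, f) \<Rightarrow> card P).
        \<forall>S'\<in>nsets H (case j of (\<chi>, P, f) \<Rightarrow> card P). c j S = c j S'"
      by (elim exE conjE)
    have finH: "finite H" using H(1) by (rule finite_subset) simp
    then have "H \<in> nsets {..<N} (card P)" using H by (simp add: nsets_def)
    from bspec[OF C this] obtain a where a: "realizes M a \<Delta>"
      and sep: "\<forall>\<alpha>\<in>F. separates \<Phi> s t C (\<lambda>q. nth_of H (rank \<mu> I P q)) a \<alpha>"
      by (elim exE conjE)
    define pos where "pos q = nth_of H (rank \<mu> I P q)" for q
    have pos_less: "pos q < pos q'" if "q \<in> P" "q' \<in> P" "pt_less \<mu> I q q'" for q q'
      unfolding pos_def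
      by (rule nth_of_less[OF finH rank_mono[OF \<open>finite P\<close> Psub that]])
        (simp add: H(2) rank_less[OF \<open>finite P\<close> that(2)])
    have posH: "pos q \<in> H" if "q \<in> P" for q
      unfolding pos_def by (rule nth_of_in[OF finH]) (simp add: H(2) rank_less[OF \<open>finite P\<close> that])
    define \<sigma> where "\<sigma> = case_sum a (\<lambda>(q, k). C (pos q) (fst q) k)"
    have "Q j \<sigma>" if j: "j \<in> J0" for j
    proof -
      have "j \<in> p <+> (T <+> Field \<mu>)" using j J0(1) by blast
      then consider \<phi> where "j = Inl \<phi>" | \<chi> P f where "j = Inr (Inl (\<chi>, P, f))" | \<alpha> where "j = Inr (Inr \<alpha>)"
        by auto
      then show ?thesis
      proof cases
        case 1
        then have "\<phi> \<in> \<Delta>" using j by (simp add: \<Delta>_def)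
        then show ?thesis using a by (simp add: 1 Q_def Q1_def \<sigma>_def realizes_def)
      next
        case (2 \<chi> P0 f)
        then have j0: "(\<chi>, P0, f) \<in> T0" using j by (simp add: T0_def)
        note P0 = T0[OF j0] and sub0 = T0P[OF j0]
        have finP0: "finite P0" and P0p: "P0 \<subseteq> points \<mu> I" and \<chi>: "definable L M B (cells I P0) \<chi>"
          using P0 by auto
        have f: "f q \<in> P" "fst (f q) = fst q" if "q \<in> P0" for q
          using that P0 sub0(2) by (auto simp: order_embedding_def)
        have mono1: "pos q < pos q'" if "q \<in> P0" "q' \<in> P0" "pt_less \<mu> I q q'" for q q'
          using pos_less that sub0(1) by blast
        have mono2: "pos (f q) < pos (f q')" if "q \<in> P0" "q' \<in> P0" "pt_less \<mu> I q q'" for q q'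
          using pos_less f that P0 by (auto simp: order_embedding_def)
        have ns: "g ` P0 \<in> nsets H (card P0)"
          if "\<And>q. q \<in> P0 \<Longrightarrow> g q \<in> H" "\<And>q q'. q \<in> P0 \<Longrightarrow> q' \<in> P0 \<Longrightarrow> pt_less \<mu> I q q' \<Longrightarrow> g q < g q'"
          for g :: "'v \<times> 'v \<Rightarrow> nat"
          using that(1) finP0 card_image[OF inj_on_increasing[OF P0p that(2)]] by (auto simp: nsets_def)
        have S1: "pos ` P0 \<in> nsets H (card P0)"
          by (rule ns[OF _ mono1]) (use posH sub0(1) in auto)
        have S2: "(\<lambda>q. pos (f q)) ` P0 \<in> nsets H (card P0)"
          by (rule ns[OF _ mono2]) (use posH f in auto)
        have "c (\<chi>, P0, f) (pos ` P0) = c (\<chi>, P0, f) ((\<lambda>q. pos (f q)) ` P0)"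
          by (rule bspec[OF bspec[OF bspec[OF H0 j0, unfolded prod.case] S1] S2])
        moreover have "c (\<chi>, P0, f) (g ` P0) = \<chi> (\<lambda>(q, k). C (g q) (fst q) k)"
          if "\<And>q q'. q \<in> P0 \<Longrightarrow> q' \<in> P0 \<Longrightarrow> pt_less \<mu> I q q' \<Longrightarrow> g q < g q'" for g
          unfolding c_def prod.case
          by (rule definable_cong[OF \<chi>])
            (use nth_of_rank_image[OF finP0 P0p that] in \<open>auto simp: cells_def\<close>)
        ultimately have "\<chi> (\<lambda>(q, k). C (pos q) (fst q) k) = \<chi> (\<lambda>(q, k). C (pos (f q)) (fst q) k)"
          using mono1 mono2 by simp
        moreover have "\<chi> (\<lambda>(q, k). C (pos (f q)) (fst q) k) = \<chi> (\<lambda>(q, k). \<sigma> (Inr (f q, k)))"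
          by (rule definable_cong[OF \<chi>]) (use f(2) in \<open>auto simp: cells_def \<sigma>_def\<close>)
        moreover have "(\<lambda>z. \<sigma> (Inr z)) = (\<lambda>(q, k). C (pos q) (fst q) k)"
          by (simp add: \<sigma>_def)
        ultimately show ?thesis by (simp add: 2 Q_def Q2_def)
      next
        case 3
        then have "\<alpha> \<in> F" using j by (simp add: F_def)
        from bspec[OF sep this] show ?thesis
          by (simp add: 3 Q_def Q3_def \<sigma>_def pos_def separates_def)
      qed
    qed
    then show "\<exists>\<sigma>. \<forall>j\<in>J0. Q j \<sigma>" by blast
  qed
  then obtain \<sigma> where \<sigma>: "\<forall>j\<in>p <+> (T <+> Field \<mu>). Q j \<sigma>" by (rule exE)
  define a where "a x = \<sigma> (Inl x)" for x
  define y where "y z = \<sigma> (Inr z)" for z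
  have real: "realizes M a p"
    unfolding realizes_def
  proof
    fix \<phi> assume "\<phi> \<in> p"
    then have "Q (Inl \<phi>) \<sigma>" using \<sigma> by blast
    then show "sat (named M) a \<phi>" by (simp add: Q_def Q1_def a_def[abs_def])
  qed
  have mut: "mutually_indiscernible L M (Field \<mu>) (seq_of_cells I y) B"
  proof (rule mutually_indiscernible_seq_of_cells[OF sk])
    fix \<chi> P f assume "finite P" "P \<subseteq> points \<mu> I" "order_embedding \<mu> I P f" "definable L M B (cells I P) \<chi>"
    then have "(\<chi>, P, f) \<in> T" by (simp add: T_def)
    then have "Q (Inr (Inl (\<chi>, P, f))) \<sigma>" using \<sigma> by blast
    then show "\<chi> y = \<chi> (\<lambda>(q, k). y (f q, k))" by (simp add: Q_def Q2_def y_def[abs_def])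
  qed
  have infs: "infinite_seq \<kappa> (seq_of_cells I y \<alpha>)" if "\<alpha> \<in> Field \<mu>" for \<alpha>
    using idx[OF that] coords[OF that] lin[OF that]
    by (simp add: infinite_seq_def small_countable small_finite)
  have "\<not> indiscernible L M (seq_of_cells I y \<alpha>) (a ` X \<union> B)" if \<alpha>: "\<alpha> \<in> Field \<mu>" for \<alpha>
  proof
    assume ind: "indiscernible L M (seq_of_cells I y \<alpha>) (a ` X \<union> B)"
    have "definable L M (a ` X \<union> B) ({..<n \<alpha>} \<times> coords (seq_of_cells I y \<alpha>)) (\<lambda>z. \<Phi> \<alpha> (case_sum a z))"
      using definable_instantiate[OF \<Phi>[OF \<alpha>] infinite_nat_vars] by simp
    from indiscernibleD[OF ind _ _ this, of "s \<alpha>" "t \<alpha>"]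
    have "\<Phi> \<alpha> (case_sum a (\<lambda>(l, k). y ((\<alpha>, s \<alpha> l), k))) = \<Phi> \<alpha> (case_sum a (\<lambda>(l, k). y ((\<alpha>, t \<alpha> l), k)))"
      using s[OF \<alpha>] t[OF \<alpha>] by simp
    moreover have "Q (Inr (Inr \<alpha>)) \<sigma>" using \<sigma> \<alpha> by blast
    ultimately show False by (simp add: Q_def Q3_def a_def[abs_def] y_def)
  qed
  then show ?thesis
    using real mut infs unfolding dpr_less_def by blast
qed

end

section \<open>Block-indiscernible families\<close>

text \<open>
  Consecutive index sets, each to the left of the next. The sequences of tuples \<open>a_v\<close> on
  which types are compared below are indexed by such sets.
\<close>

definition block_seq :: "nat \<Rightarrow> nat \<Rightarrow> (nat \<Rightarrow> nat set) \<Rightarrow> bool" where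
  "block_seq k m w \<longleftrightarrow> (\<forall>i<k. w i \<in> nsets UNIV m) \<and>
     (\<forall>i j. i < j \<longrightarrow> j < k \<longrightarrow> (\<forall>x\<in>w i. \<forall>y\<in>w j. x < y))"

lemma block_seq_nsets:
  assumes "block_seq k m w" "i < k"
  shows "w i \<in> nsets UNIV m"
  using conjunct1[OF assms(1)[unfolded block_seq_def], rule_format, OF assms(2)] .

lemma block_seq_less:
  assumes "block_seq k m w" "i < j" "j < k" "x \<in> w i" "y \<in> w j"
  shows "x < y"
  using conjunct2[OF assms(1)[unfolded block_seq_def], rule_format, OF assms(2-5)] .

definition block :: "nat \<Rightarrow> nat \<Rightarrow> nat set" where
  "block m i = {i * m..<i * m + m}"

lemma block_less:
  assumes "i < j" "x \<in> block m i" "y \<in> block m j"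
  shows "x < y"
proof -
  have "Suc i * m \<le> j * m" using assms(1) by (intro mult_le_mono1) simp
  then show ?thesis using assms(2,3) by (auto simp: block_def)
qed

lemma block_seq_block:
  assumes "\<And>i j. i < j \<Longrightarrow> j < k \<Longrightarrow> f i < f j"
  shows "block_seq k m (\<lambda>i. block m (f i))"
  unfolding block_seq_def
proof (intro conjI allI impI ballI)
  show "block m (f i) \<in> nsets UNIV m" for i by (simp add: block_def nsets_def)
  show "x < y" if "i < j" "j < k" "x \<in> block m (f i)" "y \<in> block m (f j)" for i j x y
    by (rule block_less[OF assms[OF that(1,2)] that(3,4)])
qed

text \<open>
  The union of a block sequence is enumerated block by block, so in terms of places the
  blocks do not depend on the sequence.
\<close>

lemma nth_of_blocks:
  assumes w: "block_seq k m w"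
  shows "(\<Union>i<k. w i) \<in> nsets UNIV (k * m)"
    and "i < k \<Longrightarrow> nth_of (\<Union>i<k. w i) ` block m i = w i"
proof -
  have fin: "finite (w i)" and card: "card (w i) = m" if "i < k" for i
    using block_seq_nsets[OF w that] by (simp_all add: nsets_def)
  have wD: "x < y" if "i < j" "j < k" "x \<in> w i" "y \<in> w j" for i j x y
    by (rule block_seq_less[OF w that])
  define f where "f p = nth_of (w (p div m)) (p mod m)" for p
  have dk: "p div m < k" if "p < k * m" for p
    using that by (simp add: less_mult_imp_div_less)
  have fw: "f p \<in> w (p div m)" if "p < k * m" for p
  proof -
    have "m > 0" using that by (cases m) auto
    then show ?thesis unfolding f_def
      by (intro nth_of_in fin dk[OF that]) (simp add: card[OF dk[OF that]])
  qed
  have mono: "f p < f q" if "p < q" "q < k * m" for p q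
  proof (cases "p div m = q div m")
    case True
    have "m > 0" using that by (cases m) auto
    have "p mod m < q mod m"
      using that(1) div_mult_mod_eq[of p m] div_mult_mod_eq[of q m] unfolding True by linarith
    then show ?thesis unfolding f_def True
      using \<open>m > 0\<close> by (intro nth_of_less fin dk[OF that(2)]) (simp_all add: card[OF dk[OF that(2)]])
  next
    case False
    then have "p div m < q div m" using that(1) by (simp add: div_le_mono le_neq_implies_less)
    moreover have "f p \<in> w (p div m)" "f q \<in> w (q div m)" using fw that by simp_all
    ultimately show ?thesis by (rule wD[OF _ dk[OF that(2)]])
  qed
  have fblock: "f ` block m i = w i" if "i < k" for i
  proof -
    have "block m i = (\<lambda>j. i * m + j) ` {..<m}"
      by (simp add: block_def lessThan_atLeast0 image_add_atLeastLessThan add.commute)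
    then have "f ` block m i = (\<lambda>j. f (i * m + j)) ` {..<m}" by (simp add: image_image)
    also have "\<dots> = nth_of (w i) ` {..<m}"
      by (rule image_cong[OF refl]) (auto simp: f_def)
    also have "\<dots> = w i" using nth_of_image[OF fin[OF that]] card[OF that] by simp
    finally show ?thesis .
  qed
  have blocks: "{..<k * m} = (\<Union>i<k. block m i)"
  proof (intro set_eqI iffI)
    fix p assume "p \<in> {..<k * m}"
    then have "p < k * m" by simp
    moreover from this have "m > 0" by (cases m) auto
    ultimately have "p div m < k" "p \<in> block m (p div m)"
      using dk dividend_less_div_times[of m p]
      by (auto simp: block_def add.commute)
    then show "p \<in> (\<Union>i<k. block m i)" by blast
  next
    fix p assume "p \<in> (\<Union>i<k. block m i)"
    then obtain i where i: "i < k" "p < i * m + m" by (auto simp: block_def)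
    have "Suc i * m \<le> k * m" using i(1) by (intro mult_le_mono1) simp
    then show "p \<in> {..<k * m}" using i(2) by simp
  qed
  have img: "f ` {..<k * m} = (\<Union>i<k. w i)"
    unfolding blocks image_UN using fblock by simp
  have inj: "inj_on f {..<k * m}"
    by (rule inj_onI, rule ccontr) (metis mono lessThan_iff nat_neq_iff)
  have "card (\<Union>i<k. w i) = k * m"
    unfolding img[symmetric] by (simp add: card_image[OF inj])
  then show "(\<Union>i<k. w i) \<in> nsets UNIV (k * m)" using fin by (simp add: nsets_def)
  show "nth_of (\<Union>i<k. w i) ` block m i = w i" if "i < k"
  proof -
    have "nth_of (\<Union>i<k. w i) ` block m i = f ` block m i"
    proof (rule image_cong[OF refl])
      fix p assume "p \<in> block m i"
      then have "p \<in> {..<k * m}" unfolding blocks using that by blast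
      then show "nth_of (\<Union>i<k. w i) p = f p"
        by (intro nth_of_unique[OF mono img]) auto
    qed
    then show ?thesis using fblock[OF that] by simp
  qed
qed

context monster
begin

text \<open>
  The consequence of \<open>extraction\<close> that is needed: along index sets \<open>w 0 < \<dots> < w (k - 1)\<close>
  the type over \<open>A\<close> of the tuples does not depend on the choice of the sets.
\<close>

definition indiscernible_family ::
  "'m set \<Rightarrow> 'x set \<Rightarrow> nat \<Rightarrow> (nat set \<times> 'x \<Rightarrow> 'm) \<Rightarrow> bool" where
  "indiscernible_family A X m a \<longleftrightarrow>
     (\<forall>k w w' P. block_seq k m w \<longrightarrow> block_seq k m w' \<longrightarrow> definable L M A ({..<k} \<times> X) P \<longrightarrow>
        P (\<lambda>(i, x). a (w i, x)) = P (\<lambda>(i, x). a (w' i, x)))"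

lemma indiscernible_familyD:
  assumes "indiscernible_family A X m a" "block_seq k m w" "block_seq k m w'"
    "definable L M A ({..<k} \<times> X) P"
  shows "P (\<lambda>(i, x). a (w i, x)) = P (\<lambda>(i, x). a (w' i, x))"
  using assms unfolding indiscernible_family_def by blast

lemma indiscernible_familyI:
  fixes a :: "nat set \<times> 'x \<Rightarrow> 'm"
  assumes "\<And>k P S S'. definable L M A (nsets {..<k} m \<times> X) P \<Longrightarrow> S \<in> nsets UNIV k \<Longrightarrow>
      S' \<in> nsets UNIV k \<Longrightarrow> P (resample S a) = P (resample S' a)"
  shows "indiscernible_family A X m a"
  unfolding indiscernible_family_def
proof (intro allI impI)
  fix k w w' P
  assume w: "block_seq k m w" and w': "block_seq k m w'" and P: "definable L M A ({..<k} \<times> X) P"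
  have inf: "infinite (UNIV :: (nat set \<times> 'x) set)" by (simp add: finite_prod Finite_Set.finite_set)
  define P' where "P' z = P (\<lambda>x. z ((\<lambda>(i, x). (block m i, x)) x))" for z
  have P': "definable L M A (nsets {..<k * m} m \<times> X) P'"
    unfolding P'_def
  proof (rule definable_reindex[OF P inf], rule image_subsetI)
    fix z assume z: "z \<in> {..<k} \<times> X"
    then have "Suc (fst z) * m \<le> k * m" by (intro mult_le_mono1) auto
    then have "block m (fst z) \<subseteq> {..<k * m}" by (auto simp: block_def)
    then show "(\<lambda>(i, x). (block m i, x)) z \<in> nsets {..<k * m} m \<times> X"
      using z by (auto simp: nsets_def block_def split: prod.splits)
  qed
  have "P' (resample (\<Union>i<k. w i) a) = P (\<lambda>(i, x). a (w i, x))" if "block_seq k m w" for w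
    unfolding P'_def
    by (rule definable_cong[OF P]) (auto simp: resample_def nth_of_blocks(2)[OF that])
  then show "P (\<lambda>(i, x). a (w i, x)) = P (\<lambda>(i, x). a (w' i, x))"
    using assms[OF P' nth_of_blocks(1)[OF w] nth_of_blocks(1)[OF w']] w w' by simp
qed

lemma indiscernible_family_Aut:
  assumes "indiscernible_family A X m a" "g \<in> Aut A"
  shows "indiscernible_family A X m (\<lambda>z. g (a z))"
  unfolding indiscernible_family_def
proof (intro allI impI)
  fix k w w' P
  assume w: "block_seq k m w" and w': "block_seq k m w'" and P: "definable L M A ({..<k} \<times> X) P"
  have "P (\<lambda>(i, x). g (a (w i, x))) = P (\<lambda>(i, x). a (w i, x))" for w
    using definable_Aut[OF P assms(2), of "\<lambda>(i, x). a (w i, x)"] by (simp add: split_def)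
  then show "P (\<lambda>(i, x). g (a (w i, x))) = P (\<lambda>(i, x). g (a (w' i, x)))"
    using indiscernible_familyD[OF assms(1) w w' P] by simp
qed

end

section \<open>Consequences of non-forking\<close>

text \<open>
  The type in question is that of the tuple \<open>a0\<close>, indexed by \<open>X\<close>, over the set that \<open>e\<close>
  enumerates by the index set \<open>Y\<close>.
\<close>

locale nonforking = monster \<kappa> L M
  for \<kappa> :: "'v rel" and L :: "('f, 'r) lang" and M :: "('f, 'r, 'm) struc" +
  fixes X Y :: "'v set" and A :: "'m set" and a0 e :: "'v \<Rightarrow> 'm"
  assumes X: "small \<kappa> X" and Y: "small \<kappa> Y" and A: "small \<kappa> A"
    and nonforking: "\<not> forks L M Y (tp L M Y e (a0 ` X \<union> A)) A"
begin

lemma same_over_a0: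
  assumes R: "definable L M A (Y <+> X) R" and y: "tp L M Y y (a0 ` X \<union> A) = tp L M Y e (a0 ` X \<union> A)"
  shows "R (case_sum y a0) = R (case_sum e a0)"
proof -
  let ?g = "case_sum Inl (\<lambda>x. Inr (a0 x))"
  have "definable L M (a0 ` X \<union> A) Y (\<lambda>y. R (place ?g y))"
    by (rule definable_place[OF R infinite_vars]) auto
  moreover have "place ?g y = case_sum y a0" for y :: "'v \<Rightarrow> 'm"
    by (auto simp: fun_eq_iff place_def split: sum.splits)
  ultimately have "definable L M (a0 ` X \<union> A) Y (\<lambda>y. R (case_sum y a0))" by simp
  then show ?thesis using y unfolding tp_eq_iff by blast
qed

lemma avoid_dividing:
  fixes P :: "'i \<Rightarrow> ('v + 'z \<Rightarrow> 'm) \<Rightarrow> bool"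
  assumes "finite I" "infinite (UNIV :: 'z set)" "\<And>i. i \<in> I \<Longrightarrow> divides_pred A Y Z (P i) (d i)"
  shows "\<exists>y. tp L M Y y (a0 ` X \<union> A) = tp L M Y e (a0 ` X \<union> A) \<and> (\<forall>i\<in>I. \<not> P i (case_sum y (d i)))"
  by (rule nonforking_avoids[OF nonforking assms(1,2), of Z P d])
    (use assms(3) in \<open>auto simp: realizes_tp_iff\<close>)

text \<open>
  The formula \<open>Q(y, x)\<close> has the independence property as a formula in \<open>x\<close> on realizations
  of \<open>tp(a0/A)\<close>, with \<open>y\<close> cutting out the subsets.
\<close>

definition shattering :: "(('v + 'v \<Rightarrow> 'm) \<Rightarrow> bool) \<Rightarrow> bool" where
  "shattering Q \<longleftrightarrow> (\<forall>k. \<exists>a :: nat \<Rightarrow> 'v \<Rightarrow> 'm. (\<forall>i<k. tp L M X (a i) A = tp L M X a0 A) \<and>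
     (\<forall>\<eta>. \<exists>y. \<forall>i<k. Q (case_sum y (a i)) \<longleftrightarrow> i \<in> \<eta>))"

lemma definable_exists_pattern:
  fixes k :: nat
  assumes Q: "definable L M A (Y <+> X) Q"
  shows "definable L M A ({..<k} \<times> X) (\<lambda>z. \<exists>y. \<forall>i<k. Q (case_sum y (\<lambda>x. z (i, x))) \<longleftrightarrow> i \<in> \<eta>)"
proof -
  obtain V where V: "finite V" "V \<subseteq> Y <+> X" "definable L M A V Q"
    using definable_finite_support[OF Q] by blast
  define Y0 where "Y0 = Inl -` V"
  have Y0: "finite Y0" unfolding Y0_def by (rule finite_vimageI[OF V(1)]) simp
  have inf: "infinite (UNIV :: (nat \<times> 'v + 'v) set)" by (simp add: infinite_vars)
  have "definable L M A (({..<k} \<times> X) <+> Y0) (\<lambda>s. \<forall>i\<in>{..<k}. Q ((\<lambda>u. s (case_sum Inr (\<lambda>x. Inl (i, x)) u))) \<longleftrightarrow> i \<in> \<eta>)"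
  proof (rule definable_Ball)
    fix i assume i: "i \<in> {..<k}"
    have "definable L M A (({..<k} \<times> X) <+> Y0) (\<lambda>s. Q ((\<lambda>u. s (case_sum Inr (\<lambda>x. Inl (i, x)) u))))"
    proof (rule definable_reindex[OF V(3) inf], rule image_subsetI)
      fix u assume "u \<in> V"
      then show "case_sum Inr (\<lambda>x. Inl (i, x)) u \<in> ({..<k} \<times> X) <+> Y0"
        using V(2) i by (cases u) (auto simp: Y0_def)
    qed
    then show "definable L M A (({..<k} \<times> X) <+> Y0) (\<lambda>s. (Q ((\<lambda>u. s (case_sum Inr (\<lambda>x. Inl (i, x)) u)))) \<longleftrightarrow> (i \<in> \<eta>))"
      by (intro definable_eq definable_const)
  qed simp
  from definable_Ex_finite[OF this Y0 infinite_nat_vars]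
  have "definable L M A ({..<k} \<times> X) (\<lambda>z. \<exists>y. \<forall>i\<in>{..<k}.
      Q (\<lambda>u. case_sum z y (case_sum Inr (\<lambda>x. Inl (i, x)) u)) \<longleftrightarrow> i \<in> \<eta>)" .
  note D = this
  have eq: "(\<lambda>u. case_sum z y (case_sum Inr (\<lambda>x. Inl (i, x)) u)) = case_sum y (\<lambda>x. z (i, x))"
    for z :: "nat \<times> 'v \<Rightarrow> 'm" and y i
    by (auto simp: fun_eq_iff split: sum.splits)
  show ?thesis using D unfolding eq Ball_def lessThan_iff .
qed

lemma move_to_realization:
  assumes tp: "tp L M X a A = tp L M X a0 A"
  obtains g where "g \<in> Aut A" "\<And>x. x \<in> X \<Longrightarrow> g (a x) = a0 x"
  using tp_eq_imp_Aut[OF tp X A infinite_vars] by blast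

text \<open>
  Take the realization \<open>a_w\<close> for \<open>a0\<close>, where \<open>w\<close> lies to the right of \<open>{..<n}\<close>. For each
  \<open>v\<close> below \<open>n\<close> the formula \<open>Q(y, a_w) \<and> \<not> Q(y, a_v)\<close> divides over \<open>A\<close>: if \<open>k\<close> members of
  the sequence given by consecutive pairs of blocks had a common solution, then choosing
  one block of each pair at will would show that the tuples at \<open>k\<close> blocks are shattered.
  Non-forking gives a conjugate of \<open>e\<close> over \<open>a0 A\<close> that avoids the finitely many formulas.
\<close>

lemma not_shattering_consistent:
  assumes Q: "definable L M A (Y <+> X) Q" and e: "Q (case_sum e a0)"
    and nip: "\<not> shattering Q"
    and ind: "indiscernible_family A X m a"
    and tp: "\<And>v. v \<in> nsets UNIV m \<Longrightarrow> tp L M X (\<lambda>x. a (v, x)) A = tp L M X a0 A"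
  shows "\<exists>g\<in>Aut A. \<forall>v\<in>nsets {..<n} m. Q (case_sum e (\<lambda>x. g (a (v, x))))"
proof -
  \<comment> \<open>the index set to the right of all those in question; the tuple there is moved to \<open>a0\<close>\<close>
  define v1 where "v1 = {n..<n + m}"
  have v1: "v1 \<in> nsets UNIV m" by (simp add: v1_def nsets_def)
  obtain g where g: "g \<in> Aut A" "\<And>x. x \<in> X \<Longrightarrow> g (a (v1, x)) = a0 x"
    using move_to_realization[OF tp[OF v1]] by blast
  define b where "b z = g (a z)" for z
  have indb: "indiscernible_family A X m b"
    unfolding b_def using indiscernible_family_Aut[OF ind g(1)] .
  have tpb: "tp L M X (\<lambda>x. b (v, x)) A = tp L M X a0 A" if "v \<in> nsets UNIV m" for v
    unfolding b_def using tp_Aut[OF g(1), of X "\<lambda>x. a (v, x)"] tp[OF that] by simp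
  have Qb1: "Q (case_sum y (\<lambda>x. b (v1, x))) \<longleftrightarrow> Q (case_sum y a0)" for y
    by (rule definable_cong[OF Q]) (auto simp: b_def g(2))
  define R where "R s \<longleftrightarrow> Q (\<lambda>u. s (case_sum Inl (\<lambda>x. Inr (1, x)) u)) \<and>
      \<not> Q (\<lambda>u. s (case_sum Inl (\<lambda>x. Inr (0, x)) u))" for s :: "'v + nat \<times> 'v \<Rightarrow> 'm"
  have R_iff: "R (case_sum y d) \<longleftrightarrow> Q (case_sum y (\<lambda>x. d (1, x))) \<and> \<not> Q (case_sum y (\<lambda>x. d (0, x)))" for y d
  proof -
    have "(\<lambda>u. case_sum y d (case_sum Inl (\<lambda>x. Inr (j, x)) u)) = case_sum y (\<lambda>x. d (j, x))" for j
      by (auto simp: fun_eq_iff split: sum.splits)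
    then show ?thesis unfolding R_def by simp
  qed
  have R: "definable L M A (Y <+> ({..<2} \<times> X)) R"
  proof -
    have inf: "infinite (UNIV :: ('v + nat \<times> 'v) set)" by (simp add: infinite_vars)
    have "definable L M A (Y <+> ({..<2} \<times> X)) (\<lambda>s. Q ((\<lambda>u. s (case_sum Inl (\<lambda>x. Inr (j, x)) u))))"
      if "j < 2" for j :: nat
      by (rule definable_reindex[OF Q inf]) (use that in auto)
    then show ?thesis unfolding R_def by (intro definable_conj definable_Not) auto
  qed
  define d where "d v = (\<lambda>(j :: nat, x). b (if j = 0 then v else v1, x))" for v
  have div: "divides_pred A Y ({..<2} \<times> X) R (d v)" if v: "v \<in> nsets {..<n} m" for v
  proof -
    have "\<exists>k. \<not> (\<exists>a :: nat \<Rightarrow> 'v \<Rightarrow> 'm. (\<forall>i<k. tp L M X (a i) A = tp L M X a0 A) \<and>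
        (\<forall>\<eta>. \<exists>y. \<forall>i<k. Q (case_sum y (a i)) \<longleftrightarrow> i \<in> \<eta>))"
      using nip unfolding shattering_def by (simp only: not_all)
    then obtain k where nk: "\<not> (\<exists>a :: nat \<Rightarrow> 'v \<Rightarrow> 'm. (\<forall>i<k. tp L M X (a i) A = tp L M X a0 A) \<and>
        (\<forall>\<eta>. \<exists>y. \<forall>i<k. Q (case_sum y (a i)) \<longleftrightarrow> i \<in> \<eta>))"
      by (rule exE)
    have k: "\<exists>\<eta>. \<not> (\<exists>y. \<forall>i<k. Q (case_sum y (a i)) \<longleftrightarrow> i \<in> \<eta>)"
      if "\<forall>i<k. tp L M X (a i) A = tp L M X a0 A" for a :: "nat \<Rightarrow> 'v \<Rightarrow> 'm"
    proof (rule ccontr)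
      assume "\<not> (\<exists>\<eta>. \<not> (\<exists>y. \<forall>i<k. Q (case_sum y (a i)) \<longleftrightarrow> i \<in> \<eta>))"
      then have "\<forall>\<eta>. \<exists>y. \<forall>i<k. Q (case_sum y (a i)) \<longleftrightarrow> i \<in> \<eta>" by (simp only: not_ex not_all not_not simp_thms)
      with that have "\<exists>a :: nat \<Rightarrow> 'v \<Rightarrow> 'm. (\<forall>i<k. tp L M X (a i) A = tp L M X a0 A) \<and>
        (\<forall>\<eta>. \<exists>y. \<forall>i<k. Q (case_sum y (a i)) \<longleftrightarrow> i \<in> \<eta>)" by (intro exI[of _ a] conjI)
      with nk show False by (rule notE)
    qed
    define c where "c i = (\<lambda>(j :: nat, x). b (block m (2 * i + j), x))" for i
    have bv: "block_seq 2 m (\<lambda>j. if j = 0 then v else v1)"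
      using v v1 by (auto simp: block_seq_def v1_def nsets_def)
    have "tp L M ({..<2} \<times> X) (c i) A = tp L M ({..<2} \<times> X) (d v) A" for i
      unfolding tp_eq_iff
    proof (intro allI impI)
      fix P assume "definable L M A ({..<2 :: nat} \<times> X) P"
      then show "P (c i) = P (d v)"
        unfolding c_def d_def
        by (intro indiscernible_familyD[OF indb _ bv] block_seq_block) auto
    qed
    moreover have "\<not> (\<exists>y. \<forall>i\<in>S. R (case_sum y (c i)))" if S: "finite S" "card S = k" for S
    proof
      assume "\<exists>y. \<forall>i\<in>S. R (case_sum y (c i))"
      then obtain y where y: "\<And>i. i \<in> S \<Longrightarrow> R (case_sum y (c i))" by blast
      have y1: "Q (case_sum y (\<lambda>x. b (block m (Suc (2 * i)), x)))"
          "\<not> Q (case_sum y (\<lambda>x. b (block m (2 * i), x)))" if "i \<in> S" for i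
        using y[OF that] unfolding R_iff by (simp_all add: c_def)
      \<comment> \<open>the sequence of dividing instances uses the blocks \<open>2 i\<close> and \<open>2 i + 1\<close>; the odd ones are claimed to be shattered\<close>
      define w where "w i = Suc (2 * nth_of S i)" for i
      have "\<forall>i<k. tp L M X (\<lambda>x. b (block m (w i), x)) A = tp L M X a0 A"
        by (intro allI impI tpb) (simp add: block_def nsets_def)
      from k[OF this]
      obtain \<eta> where \<eta>: "\<not> (\<exists>y. \<forall>i<k. Q (case_sum y (\<lambda>x. b (block m (w i), x))) \<longleftrightarrow> i \<in> \<eta>)"
        by (rule exE)
      define w' where "w' i = (if i \<in> \<eta> then Suc (2 * nth_of S i) else 2 * nth_of S i)" for i
      have lt: "nth_of S i < nth_of S j" if "i < j" "j < k" for i j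
        using nth_of_less[OF S(1)] that S(2) by simp
      have bw: "block_seq k m (\<lambda>i. block m (w i))"
        by (rule block_seq_block) (use lt in \<open>auto simp: w_def\<close>)
      have bw': "block_seq k m (\<lambda>i. block m (w' i))"
      proof (rule block_seq_block)
        fix i j assume "i < j" "j < k"
        from lt[OF this] show "w' i < w' j" by (simp add: w'_def)
      qed
      have "\<forall>i<k. Q (case_sum y (\<lambda>x. b (block m (w' i), x))) \<longleftrightarrow> i \<in> \<eta>"
        using y1 nth_of_in[OF S(1)] S(2) by (simp add: w'_def)
      then have "\<exists>y. \<forall>i<k. Q (case_sum y (\<lambda>x. (\<lambda>(i, x). b (block m (w' i), x)) (i, x))) \<longleftrightarrow> i \<in> \<eta>"
        by auto
      then have "\<exists>y. \<forall>i<k. Q (case_sum y (\<lambda>x. (\<lambda>(i, x). b (block m (w i), x)) (i, x))) \<longleftrightarrow> i \<in> \<eta>"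
        using indiscernible_familyD[OF indb bw bw' definable_exists_pattern[OF Q]] by blast
      then show False using \<eta> by simp
    qed
    ultimately show ?thesis unfolding divides_pred_def using R by blast
  qed
  have "finite (nsets {..<n} m)" by (simp add: finite_imp_finite_nsets)
  from avoid_dividing[OF this infinite_nat_vars, of "{..<2} \<times> X" "\<lambda>_. R" d, OF div]
  obtain y where y: "tp L M Y y (a0 ` X \<union> A) = tp L M Y e (a0 ` X \<union> A)"
    and ny: "\<And>v. v \<in> nsets {..<n} m \<Longrightarrow> \<not> R (case_sum y (d v))" by blast
  have "Q (case_sum y a0)" using same_over_a0[OF Q y] e by simp
  then have Qy: "Q (case_sum y (\<lambda>x. b (v, x)))" if "v \<in> nsets {..<n} m" for v
    using ny[OF that] unfolding R_iff by (simp add: d_def Qb1)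
  have "tp L M Y y A = tp L M Y e A" using y by (rule tp_mono) simp
  from tp_eq_imp_Aut[OF this Y A infinite_vars]
  obtain h where h: "h \<in> Aut A" "\<And>z. z \<in> Y \<Longrightarrow> h (y z) = e z" by blast
  have "Q (case_sum e (\<lambda>x. (h \<circ> g) (a (v, x))))" if "v \<in> nsets {..<n} m" for v
  proof -
    have "Q ((\<lambda>u. h (case_sum y (\<lambda>x. b (v, x)) u))) \<longleftrightarrow> Q (case_sum y (\<lambda>x. b (v, x)))"
      by (rule definable_Aut[OF Q h(1)])
    moreover have "Q ((\<lambda>u. h (case_sum y (\<lambda>x. b (v, x)) u))) \<longleftrightarrow> Q (case_sum e (\<lambda>x. (h \<circ> g) (a (v, x))))"
      by (rule definable_cong[OF Q]) (auto simp: b_def h(2))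
    ultimately show ?thesis using Qy[OF that] by simp
  qed
  then show ?thesis using Aut_comp[OF h(1) g(1)] by blast
qed

end

lemma nsets_one_iff: "v \<in> nsets U 1 \<longleftrightarrow> (\<exists>i\<in>U. v = {i})"
  by (auto simp: nsets_one)

lemma nth_of_singleton: "nth_of {i} 0 = i"
  by (simp add: nth_of_def)

context nonforking
begin

text \<open>
  The shattered finite sets of all sizes extract to an infinite sequence, the case of
  index sets with one element.
\<close>

lemma shattering_family:
  assumes Q: "definable L M A (Y <+> X) Q" and sh: "shattering Q"
  obtains a where "indiscernible_family A X 1 a"
    "\<And>i. tp L M X (\<lambda>x. a ({i}, x)) A = tp L M X a0 A"
    "\<And>k \<eta>. \<exists>y. \<forall>i<k. Q (case_sum y (\<lambda>x. a ({i}, x))) \<longleftrightarrow> i \<in> \<eta>"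
proof -
  have inf: "infinite (UNIV :: (nat set \<times> 'v) set)" by (simp add: finite_prod Finite_Set.finite_set)
  define Sh where "Sh k \<eta> a \<longleftrightarrow> (\<exists>y. \<forall>i<k. Q (case_sum y (\<lambda>x. a ({i}, x))) \<longleftrightarrow> i \<in> \<eta>)"
    for k :: nat and \<eta> and a :: "nat set \<times> 'v \<Rightarrow> 'm"
  define E1 where "E1 = {(k, Sh k \<eta>) |k \<eta>. True}"
  define E2 where "E2 = {(1 :: nat, \<lambda>a :: nat set \<times> 'v \<Rightarrow> 'm. P (\<lambda>x. a ({0}, x))) |P. definable L M A X P \<and> P a0}"
  have dSh: "definable L M A (nsets {..<k} 1 \<times> X) (Sh k \<eta>)" for k \<eta>
  proof -
    have "definable L M A (nsets {..<k} 1 \<times> X)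
        (\<lambda>a. \<exists>y. \<forall>i<k. Q (case_sum y (\<lambda>x. a ((\<lambda>(i, x). ({i}, x)) (i, x)))) \<longleftrightarrow> i \<in> \<eta>)"
      by (rule definable_reindex[OF definable_exists_pattern[OF Q] inf])
        (auto simp: nsets_one_iff simp del: One_nat_def)
    then show ?thesis by (simp add: Sh_def[abs_def])
  qed
  have dE2: "definable L M A (nsets {..<1} 1 \<times> X) (\<lambda>a :: nat set \<times> 'v \<Rightarrow> 'm. P (\<lambda>x. a ({0}, x)))" if "definable L M A X P" for P
    by (rule definable_reindex[OF that inf]) (auto simp: nsets_one_iff simp del: One_nat_def)
  have fam: "\<exists>a. \<forall>(k, P)\<in>E1 \<union> E2. \<forall>S\<in>nsets {..<n} k. P (resample S a)" for n
  proof -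
    from sh[unfolded shattering_def, rule_format, of n] obtain a' :: "nat \<Rightarrow> 'v \<Rightarrow> 'm" where
      a': "\<forall>i<n. tp L M X (a' i) A = tp L M X a0 A"
      and sha: "\<forall>\<eta>. \<exists>y. \<forall>i<n. Q (case_sum y (a' i)) \<longleftrightarrow> i \<in> \<eta>" by (elim exE conjE)
    define a where "a = (\<lambda>(v, x). a' (the_elem v) x)"
    have res: "resample S a ({i}, x) = a' (nth_of S i) x" for S i x
      by (simp add: resample_def a_def)
    have "P (resample S a)" if kP: "(k, P) \<in> E1 \<union> E2" and S: "S \<in> nsets {..<n} k" for k P S
    proof (cases "(k, P) \<in> E1")
      case True
      then obtain \<eta> where P: "P = Sh k \<eta>" by (auto simp: E1_def)
      \<comment> \<open>a pattern on the subsequence at \<open>S\<close> is induced by one on the whole sequence\<close>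
      from sha[rule_format, of "nth_of S ` (\<eta> \<inter> {..<k})"] obtain y where
        y: "\<forall>i<n. Q (case_sum y (a' i)) \<longleftrightarrow> i \<in> nth_of S ` (\<eta> \<inter> {..<k})" by (rule exE)
      have S': "finite S" "card S = k" "S \<subseteq> {..<n}" using S by (auto simp: nsets_def)
      have "Q (case_sum y (a' (nth_of S i))) \<longleftrightarrow> i \<in> \<eta>" if "i < k" for i
      proof -
        have "nth_of S i < n" using nth_of_in[OF S'(1), of i] S' that by auto
        moreover have "nth_of S i \<in> nth_of S ` (\<eta> \<inter> {..<k}) \<longleftrightarrow> i \<in> \<eta>"
          using inj_on_image_mem_iff[OF nth_of_inj[OF S'(1)], of i "\<eta> \<inter> {..<k}"] that S'(2) by auto
        ultimately show ?thesis using y by simp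
      qed
      then show ?thesis unfolding P Sh_def res by blast
    next
      case False
      then obtain P' where P': "k = 1" "P = (\<lambda>a. P' (\<lambda>x. a ({0}, x)))" "definable L M A X P'" "P' a0"
        using kP by (auto simp: E2_def)
      have "nth_of S 0 < n" using nth_of_in[of S 0] S P'(1) by (auto simp: nsets_def)
      then have "tp L M X (a' (nth_of S 0)) A = tp L M X a0 A" using a' by blast
      then have "P' (a' (nth_of S 0))" using P'(3,4) unfolding tp_eq_iff by blast
      then show ?thesis unfolding P'(2) res .
    qed
    then show ?thesis by (intro exI[of _ a]) auto
  qed
  have dE: "definable L M A (nsets {..<k} 1 \<times> X) P" if "(k, P) \<in> E1 \<union> E2" for k P
    using that dSh dE2 unfolding E1_def E2_def by blast
  show ?thesis
  proof (rule extraction[OF A X dE fam])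
    fix a :: "nat set \<times> 'v \<Rightarrow> 'm"
    assume a1: "\<And>k P S. (k, P) \<in> E1 \<union> E2 \<Longrightarrow> S \<in> nsets UNIV k \<Longrightarrow> P (resample S a)"
      and a2: "\<And>k P S S'. definable L M A (nsets {..<k} 1 \<times> X) P \<Longrightarrow> S \<in> nsets UNIV k \<Longrightarrow>
        S' \<in> nsets UNIV k \<Longrightarrow> P (resample S a) = P (resample S' a)"
    show thesis
    proof (rule that[of a])
      show "indiscernible_family A X 1 a" by (rule indiscernible_familyI[OF a2])
      show "tp L M X (\<lambda>x. a ({i}, x)) A = tp L M X a0 A" for i
      proof -
        have pos: "P (\<lambda>x. a ({i}, x))" if "definable L M A X P" "P a0" for P
        proof -
          have "(1, \<lambda>a :: nat set \<times> 'v \<Rightarrow> 'm. P (\<lambda>x. a ({0}, x))) \<in> E1 \<union> E2" using that unfolding E2_def by blast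
          from a1[OF this, of "{i}"] show ?thesis
            by (simp add: nsets_def resample_def nth_of_singleton)
        qed
        show ?thesis unfolding tp_eq_iff using pos definable_Not pos by blast
      qed
      show "\<exists>y. \<forall>i<k. Q (case_sum y (\<lambda>x. a ({i}, x))) \<longleftrightarrow> i \<in> \<eta>" for k \<eta>
      proof -
        have "(k, Sh k \<eta>) \<in> E1 \<union> E2" unfolding E1_def by blast
        from a1[OF this, of "{..<k}"] have "Sh k \<eta> (resample {..<k} a)" by (simp add: nsets_def)
        moreover have "resample {..<k} a ({i}, x) = a ({i}, x)" if "i < k" for i x
          using nth_of_unique[of k id "{..<k}" i] that by (simp add: resample_def)
        ultimately show ?thesis unfolding Sh_def by simp
      qed
    qed
  qed
qed

text \<open>
  Let \<open>a_0\<close> be \<open>a0\<close>. If \<open>Q'(y, a_0), \<dots>, Q'(y, a_{n-1})\<close> were inconsistent with the type of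
  \<open>e\<close> over \<open>A\<close>, then by compactness and indiscernibility some formula of \<open>tp(e/a0 A)\<close>
  would be \<open>n\<close>-inconsistent along the sequence and so divide over \<open>A\<close>. A common solution
  that has the type of \<open>e\<close> is moved to \<open>e\<close>.
\<close>

lemma shattering_consistent:
  assumes Q: "definable L M A (Y <+> X) Q" and sh: "shattering Q"
    and Q': "definable L M A (Y <+> X) Q'" and e: "Q' (case_sum e a0)"
  shows "\<exists>a :: nat \<Rightarrow> 'v \<Rightarrow> 'm. (\<forall>i<n. Q' (case_sum e (a i))) \<and>
    (\<forall>\<eta>. \<exists>y. \<forall>i<n. Q (case_sum y (a i)) \<longleftrightarrow> i \<in> \<eta>)"
proof -
  obtain a where ind: "indiscernible_family A X 1 a"
    and tp: "\<And>i. tp L M X (\<lambda>x. a ({i}, x)) A = tp L M X a0 A"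
    and sha: "\<And>k \<eta>. \<exists>y. \<forall>i<k. Q (case_sum y (\<lambda>x. a ({i}, x))) \<longleftrightarrow> i \<in> \<eta>"
    using shattering_family[OF Q sh] by blast
  obtain g where g: "g \<in> Aut A" "\<And>x. x \<in> X \<Longrightarrow> g (a ({0}, x)) = a0 x"
    using move_to_realization[OF tp[of 0]] by blast
  define b where "b z = g (a z)" for z
  have indb: "indiscernible_family A X 1 b"
    unfolding b_def using indiscernible_family_Aut[OF ind g(1)] .
  have tpb: "tp L M X (\<lambda>x. b ({i}, x)) A = tp L M X a0 A" for i
    unfolding b_def using tp_Aut[OF g(1), of X "\<lambda>x. a ({i}, x)"] tp[of i] by simp
  have fin: "\<exists>y. (\<forall>i<n. Q' (case_sum y (\<lambda>x. b ({i}, x)))) \<and> G y" if G: "definable L M A Y G" "G e" for G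
  proof (rule ccontr)
    assume none: "\<not> (\<exists>y. (\<forall>i<n. Q' (case_sum y (\<lambda>x. b ({i}, x)))) \<and> G y)"
    \<comment> \<open>the instances of \<open>R\<close> are inconsistent for the first \<open>n\<close> tuples, hence for any \<open>n\<close> tuples of the sequence\<close>
    define R where "R s \<longleftrightarrow> Q' s \<and> G (\<lambda>z. s (Inl z))" for s :: "'v + 'v \<Rightarrow> 'm"
    have R: "definable L M A (Y <+> X) R"
    proof -
      have inf: "infinite (UNIV :: ('v + 'v) set)" by (simp add: infinite_vars)
      have "definable L M A (Y <+> X) (\<lambda>s. G (\<lambda>z. s (Inl z)))"
        by (rule definable_reindex[OF G(1) inf]) auto
      then show ?thesis unfolding R_def by (rule definable_conj[OF Q'])
    qed
    have inc: "\<not> (\<exists>y. \<forall>i\<in>S. R (case_sum y (\<lambda>x. b ({i}, x))))" if S: "finite S" "card S = n" for S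
    proof
      assume "\<exists>y. \<forall>i\<in>S. R (case_sum y (\<lambda>x. b ({i}, x)))"
      then obtain y where y: "\<forall>i\<in>S. R (case_sum y (\<lambda>x. b ({i}, x)))" by (rule exE)
      have lt: "nth_of S i < nth_of S j" if "i < j" "j < n" for i j
        using nth_of_less[OF S(1)] that S(2) by simp
      have w: "block_seq n 1 (\<lambda>i. {nth_of S i})" "block_seq n 1 (\<lambda>i. {i})"
        using lt by (auto simp: block_seq_def nsets_def)
      have "\<forall>i<n. R (case_sum y (\<lambda>x. b ({nth_of S i}, x)))"
        using y nth_of_in[OF S(1)] S(2) by simp
      then have "\<exists>y. \<forall>i<n. R (case_sum y (\<lambda>x. (\<lambda>(i, x). b ({nth_of S i}, x)) (i, x))) \<longleftrightarrow> i \<in> UNIV"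
        by auto
      then have "\<exists>y. \<forall>i<n. R (case_sum y (\<lambda>x. (\<lambda>(i, x). b ({i}, x)) (i, x))) \<longleftrightarrow> i \<in> UNIV"
        using indiscernible_familyD[OF indb w definable_exists_pattern[OF R, of n UNIV]] by blast
      then obtain y' where "\<forall>i<n. R (case_sum y' (\<lambda>x. b ({i}, x)))" by auto
      then have *: "\<forall>i<n. Q' (case_sum y' (\<lambda>x. b ({i}, x))) \<and> G y'" by (simp add: R_def)
      show False
      proof (cases "n = 0")
        case True
        then show False using none G(2) by auto
      next
        case False
        then show False using none * by blast
      qed
    qed
    have "divides_pred A Y X R a0"
      unfolding divides_pred_def
    proof (intro conjI R exI[of _ n] exI[of _ "\<lambda>i x. b ({i}, x)"] allI impI)
      show "tp L M X (\<lambda>x. b ({i}, x)) A = tp L M X a0 A" for i by (rule tpb)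
      show "\<not> (\<exists>y. \<forall>i\<in>S. R (case_sum y (\<lambda>x. b ({i}, x))))" if "finite S" "card S = n" for S
        by (rule inc[OF that])
    qed
    from avoid_dividing[of "{()}" X "\<lambda>_. R" "\<lambda>_. a0", OF _ infinite_vars] this
    obtain y where y: "tp L M Y y (a0 ` X \<union> A) = tp L M Y e (a0 ` X \<union> A)" "\<not> R (case_sum y a0)"
      by auto
    have "\<not> R (case_sum e a0)" using same_over_a0[OF R y(1)] y(2) by simp
    moreover have "R (case_sum e a0)" using e G(2) by (simp add: R_def)
    ultimately show False by simp
  qed
  define C where "C = (\<Union>i<n. (\<lambda>x. b ({i}, x)) ` X) \<union> A"
  define J where "J = {..<n} <+> {P. definable L M A Y P \<and> P e}"
  define H where "H = case_sum (\<lambda>i y. Q' (case_sum y (\<lambda>x. b ({i}, x)))) (\<lambda>P :: ('v \<Rightarrow> 'm) \<Rightarrow> bool. P)"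
  have "\<exists>y. \<forall>j\<in>J. H j y"
  proof (rule realize[of C Y])
    have "C = (\<lambda>(i, x). b ({i}, x)) ` ({..<n} \<times> X) \<union> A" by (auto simp: C_def)
    moreover have "small \<kappa> ({..<n} \<times> X)" by (intro small_Times small_finite X) simp
    ultimately show "small \<kappa> C" using A by (simp add: small_Un small_image)
    show "small \<kappa> Y" by (rule Y)
  next
    fix j assume j: "j \<in> J"
    show "definable L M C Y (H j)"
    proof (cases j)
      case (Inl i)
      then have i: "i < n" using j by (auto simp: J_def)
      let ?g = "case_sum Inl (\<lambda>x. Inr (b ({i}, x)))"
      have "definable L M C Y (\<lambda>y. Q' (place ?g y))"
      proof (rule definable_place[OF Q' infinite_vars])
        have "b ({i}, x) \<in> C" if "x \<in> X" for x using that i unfolding C_def by blast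
        then show "?g u \<in> Y <+> C" if "u \<in> Y <+> X" for u using that by (cases u) auto
      qed (simp add: C_def)
      moreover have "place ?g y = case_sum y (\<lambda>x. b ({i}, x))" for y :: "'v \<Rightarrow> 'm"
        by (auto simp: fun_eq_iff place_def split: sum.splits)
      ultimately show ?thesis by (simp add: Inl H_def)
    next
      case (Inr P)
      then have "definable L M A Y P" using j by (auto simp: J_def)
      then have "definable L M C Y P" by (rule definable_mono) (auto simp: C_def)
      then show ?thesis by (simp add: Inr H_def)
    qed
  next
    fix J0 assume J0: "J0 \<subseteq> J" "finite J0"
    define \<G> where "\<G> = Inr -` J0"
    have \<G>: "finite \<G>" "\<And>P. P \<in> \<G> \<Longrightarrow> definable L M A Y P \<and> P e"
      using finite_vimageI[OF J0(2), of Inr] J0(1) by (auto simp: \<G>_def J_def)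
    have "definable L M A Y (\<lambda>y. \<forall>P\<in>\<G>. P y)"
      by (rule definable_Ball[OF \<G>(1)]) (use \<G>(2) in blast)
    then obtain y where y: "\<forall>i<n. Q' (case_sum y (\<lambda>x. b ({i}, x)))" "\<forall>P\<in>\<G>. P y"
      using fin[of "\<lambda>y. \<forall>P\<in>\<G>. P y"] \<G>(2) by auto
    have "H j y" if j: "j \<in> J0" for j
    proof (cases j)
      case (Inl i)
      then have "i < n" using j J0(1) by (auto simp: J_def)
      then show ?thesis using y(1) by (simp add: Inl H_def)
    next
      case (Inr P)
      then have "P \<in> \<G>" using j by (simp add: \<G>_def)
      from bspec[OF y(2) this] show ?thesis by (simp add: Inr H_def)
    qed
    then show "\<exists>y. \<forall>j\<in>J0. H j y" by blast
  qed
  then obtain y where y: "\<forall>j\<in>J. H j y" by (rule exE)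
  have Q'y: "Q' (case_sum y (\<lambda>x. b ({i}, x)))" if "i < n" for i
    using bspec[OF y, of "Inl i"] that by (simp add: J_def H_def InlI)
  have Py: "P y" if "definable L M A Y P" "P e" for P
    using bspec[OF y, of "Inr P"] that by (simp add: J_def H_def InrI)
  have "tp L M Y y A = tp L M Y e A"
    unfolding tp_eq_iff using Py definable_Not by blast
  from tp_eq_imp_Aut[OF this Y A infinite_vars]
  obtain h where h: "h \<in> Aut A" "\<And>z. z \<in> Y \<Longrightarrow> h (y z) = e z" by blast
  have hg: "h \<circ> g \<in> Aut A" by (rule Aut_comp[OF h(1) g(1)])
  have "Q' (case_sum e (\<lambda>x. (h \<circ> g) (a ({i}, x))))" if "i < n" for i
  proof -
    have "Q' (\<lambda>u. h (case_sum y (\<lambda>x. b ({i}, x)) u)) \<longleftrightarrow> Q' (case_sum y (\<lambda>x. b ({i}, x)))"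
      by (rule definable_Aut[OF Q' h(1)])
    moreover have "Q' (\<lambda>u. h (case_sum y (\<lambda>x. b ({i}, x)) u)) \<longleftrightarrow> Q' (case_sum e (\<lambda>x. (h \<circ> g) (a ({i}, x))))"
      by (rule definable_cong[OF Q']) (auto simp: b_def h(2))
    ultimately show ?thesis using Q'y[OF that] by simp
  qed
  moreover have "\<exists>y. \<forall>i<n. Q (case_sum y (\<lambda>x. (h \<circ> g) (a ({i}, x)))) \<longleftrightarrow> i \<in> \<eta>" for \<eta>
  proof -
    obtain y where y: "\<forall>i<n. Q (case_sum y (\<lambda>x. a ({i}, x))) \<longleftrightarrow> i \<in> \<eta>" using sha by blast
    have "Q (case_sum (\<lambda>z. (h \<circ> g) (y z)) (\<lambda>x. (h \<circ> g) (a ({i}, x)))) \<longleftrightarrow> Q (case_sum y (\<lambda>x. a ({i}, x)))" for i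
    proof -
      have "case_sum (\<lambda>z. (h \<circ> g) (y z)) (\<lambda>x. (h \<circ> g) (a ({i}, x))) =
          (\<lambda>u. (h \<circ> g) (case_sum y (\<lambda>x. a ({i}, x)) u))"
        by (auto simp: fun_eq_iff split: sum.splits)
      then show ?thesis using definable_Aut[OF Q hg] by (simp only:)
    qed
    then show ?thesis using y by blast
  qed
  ultimately show ?thesis
    by (intro exI[of _ "\<lambda>i x. (h \<circ> g) (a ({i}, x))"]) blast
qed

end

section \<open>Moving the witnesses of a large dp-rank\<close>

context skeleton
begin

definition lex_enum :: "('v \<times> 'v) set \<Rightarrow> nat \<Rightarrow> 'v \<times> 'v" where
  "lex_enum P = inv_into P (rank \<mu> I P)"

lemma rank_bij:
  assumes P: "finite P" "P \<subseteq> points \<mu> I"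
  shows "bij_betw (rank \<mu> I P) P {..<card P}"
proof -
  have inj: "inj_on (rank \<mu> I P) P"
    by (rule inj_on_increasing[OF P(2)]) (rule rank_mono[OF P])
  have "rank \<mu> I P ` P \<subseteq> {..<card P}" using rank_less[OF P(1)] by auto
  then have "rank \<mu> I P ` P = {..<card P}"
    by (rule card_subset_eq[OF finite_lessThan]) (simp add: card_image[OF inj])
  then show ?thesis using inj by (simp add: bij_betw_def)
qed

lemma lex_enum_in:
  assumes "finite P" "P \<subseteq> points \<mu> I" "l < card P"
  shows "lex_enum P l \<in> P" "rank \<mu> I P (lex_enum P l) = l"
  using rank_bij[OF assms(1,2)] assms(3) unfolding lex_enum_def bij_betw_def
  by (auto intro: inv_into_into f_inv_into_f)

lemma lex_enum_less:
  assumes P: "finite P" "P \<subseteq> points \<mu> I" and l: "k < l" "l < card P"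
  shows "pt_less \<mu> I (lex_enum P k) (lex_enum P l)"
proof -
  have k: "k < card P" using l by simp
  note ek = lex_enum_in[OF P k] and el = lex_enum_in[OF P l(2)]
  have ne: "lex_enum P k \<noteq> lex_enum P l" using ek(2) el(2) l(1) by auto
  have "\<not> pt_less \<mu> I (lex_enum P l) (lex_enum P k)"
  proof
    assume "pt_less \<mu> I (lex_enum P l) (lex_enum P k)"
    from rank_mono[OF P el(1) ek(1) this] show False using ek(2) el(2) l(1) by simp
  qed
  moreover have "lex_enum P k \<in> points \<mu> I" "lex_enum P l \<in> points \<mu> I" using ek(1) el(1) P(2) by auto
  ultimately show ?thesis using pt_less_total ne by blast
qed

lemma lex_enum_surj:
  assumes P: "finite P" "P \<subseteq> points \<mu> I" and q: "q \<in> P"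
  obtains l where "l < card P" "q = lex_enum P l"
proof
  show "rank \<mu> I P q < card P" by (rule rank_less[OF P(1) q])
  show "q = lex_enum P (rank \<mu> I P q)"
    unfolding lex_enum_def using rank_bij[OF P] q by (simp add: bij_betw_def)
qed

lemma increasing_fiber:
  assumes "\<And>l. l < n \<Longrightarrow> g l \<in> points \<mu> I \<and> fst (g l) = \<alpha>"
    and "\<And>k l. k < l \<Longrightarrow> l < n \<Longrightarrow> pt_less \<mu> I (g k) (g l)"
  shows "increasing (I \<alpha>) n (\<lambda>l. snd (g l))"
  unfolding increasing_def
proof (intro conjI allI impI image_subsetI)
  fix l assume "l \<in> {..<n}"
  then show "snd (g l) \<in> idx (I \<alpha>)" using assms(1)[of l] by (auto simp: points_def)
next
  fix k l assume kl: "k < l \<and> l < n"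
  then have "pt_less \<mu> I (g k) (g l)" "fst (g k) = \<alpha>" "fst (g l) = \<alpha>"
    using assms by auto
  then show "(snd (g k), snd (g l)) \<in> ord (I \<alpha>)" "snd (g k) \<noteq> snd (g l)"
    by (auto simp: pt_less_def split: prod.splits)
qed

lemma increasing_exists:
  assumes "\<alpha> \<in> Field \<mu>" "infinite (idx (I \<alpha>))"
  obtains u where "increasing (I \<alpha>) n u"
proof -
  obtain R where R: "finite R" "card R = n" "R \<subseteq> idx (I \<alpha>)"
    using infinite_arbitrarily_large[OF assms(2)] by blast
  let ?P = "{\<alpha>} \<times> R"
  have P: "finite ?P" "?P \<subseteq> points \<mu> I" "card ?P = n"
    using R assms(1) by (auto simp: points_def card_cartesian_product)
  have "increasing (I \<alpha>) n (\<lambda>l. snd (lex_enum ?P l))"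
  proof (rule increasing_fiber)
    show "lex_enum ?P l \<in> points \<mu> I \<and> fst (lex_enum ?P l) = \<alpha>" if "l < n" for l
      using lex_enum_in(1)[OF P(1,2), of l] that P(2,3) by auto
    show "pt_less \<mu> I (lex_enum ?P k) (lex_enum ?P l)" if "k < l" "l < n" for k l
      using lex_enum_less[OF P(1,2)] that P(3) by simp
  qed
  then show ?thesis by (rule that)
qed

end

text \<open>
  A failure of indiscernibility involves only finitely many coordinates of the terms.
\<close>

lemma not_indiscernible_witness:
  assumes "\<not> indiscernible L M I (b ` X \<union> A)"
  obtains n s t K \<Phi> where "increasing I n s" "increasing I n t" "finite K" "K \<subseteq> coords I"
    "definable L M A (X <+> ({..<n} \<times> K)) \<Phi>"
    "\<Phi> (case_sum b (\<lambda>(l, k). trm_at I (s l) k)) \<noteq> \<Phi> (case_sum b (\<lambda>(l, k). trm_at I (t l) k))"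
proof -
  obtain n s t P where st: "increasing I n s" "increasing I n t"
    and P: "definable L M (b ` X \<union> A) ({..<n} \<times> coords I) P"
    and ne: "P (\<lambda>(k, y). trm_at I (s k) y) \<noteq> P (\<lambda>(k, y). trm_at I (t k) y)"
    using indiscernibleI[where I = I and A = "b ` X \<union> A"] assms by blast
  obtain \<Phi> where \<Phi>: "definable L M A (X <+> ({..<n} \<times> coords I)) \<Phi>" "\<And>z. P z \<longleftrightarrow> \<Phi> (case_sum b z)"
    using definable_absorb[OF P infinite_nat_vars] by blast
  obtain V where V: "finite V" "V \<subseteq> X <+> ({..<n} \<times> coords I)" "definable L M A V \<Phi>"
    using definable_finite_support[OF \<Phi>(1)] by blast
  define K where "K = snd ` (Inr -` V)"
  have "finite K" unfolding K_def by (intro finite_imageI finite_vimageI V(1)) simp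
  moreover have "K \<subseteq> coords I" using V(2) by (auto simp: K_def)
  moreover have "V \<subseteq> X <+> ({..<n} \<times> K)"
  proof
    fix u assume u: "u \<in> V"
    then show "u \<in> X <+> ({..<n} \<times> K)"
      using V(2) by (cases u) (force simp: K_def)+
  qed
  then have "definable L M A (X <+> ({..<n} \<times> K)) \<Phi>" by (rule definable_mono[OF V(3) subset_refl])
  ultimately show ?thesis using that[OF st] ne \<Phi>(2) by simp
qed

context monster
begin

lemma indiscernible_move:
  assumes ind: "indiscernible L M I C" and A: "small \<kappa> A" "A \<subseteq> C" and K: "finite K" "K \<subseteq> coords I"
    and st: "increasing I n s" "increasing I n t"
  obtains g where "g \<in> Aut A" "\<And>l k. l < n \<Longrightarrow> k \<in> K \<Longrightarrow> g (trm_at I (s l) k) = trm_at I (t l) k"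
proof -
  have "tp L M ({..<n} \<times> K) (\<lambda>(l, k). trm_at I (s l) k) A = tp L M ({..<n} \<times> K) (\<lambda>(l, k). trm_at I (t l) k) A"
    unfolding tp_eq_iff
  proof (intro allI impI)
    fix P assume "definable L M A ({..<n} \<times> K) P"
    then have "definable L M C ({..<n} \<times> coords I) P" by (rule definable_mono) (use A K in auto)
    then show "P (\<lambda>(l, k). trm_at I (s l) k) = P (\<lambda>(l, k). trm_at I (t l) k)"
      by (rule indiscernibleD[OF ind st])
  qed
  moreover have "small \<kappa> ({..<n} \<times> K)" by (rule small_finite) (simp add: K)
  ultimately obtain g where "g \<in> Aut A"
    "\<And>z. z \<in> {..<n} \<times> K \<Longrightarrow> g ((\<lambda>(l, k). trm_at I (s l) k) z) = (\<lambda>(l, k). trm_at I (t l) k) z"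
    using tp_eq_imp_Aut[OF _ _ A(1) infinite_nat_vars] by blast
  then show ?thesis using that[of g] by fastforce
qed

text \<open>
  The sequences are treated one after the other. Mutual indiscernibility moves the points
  of \<open>I \<alpha>\<close> by an automorphism that fixes the relevant terms of the other sequences, both
  at their old and at their new places. The family \<open>J\<close> is a thinning of \<open>I\<close>, so that
  finitely many elements are fixed at each step.
\<close>

lemma mutually_indiscernible_move:
  assumes sk: "skeleton \<mu> J" and mut: "mutually_indiscernible L M (Field \<mu>) I A"
    and A: "small \<kappa> A"
    and J: "\<And>\<alpha> n s. \<alpha> \<in> Field \<mu> \<Longrightarrow> increasing (J \<alpha>) n s \<Longrightarrow> increasing (I \<alpha>) n s"
    and K: "\<And>\<alpha>. \<alpha> \<in> Field \<mu> \<Longrightarrow> finite (coords (J \<alpha>)) \<and> coords (J \<alpha>) \<subseteq> coords (I \<alpha>)"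
    and idx: "\<And>\<alpha>. \<alpha> \<in> Field \<mu> \<Longrightarrow> idx (J \<alpha>) \<subseteq> idx (I \<alpha>)"
    and P: "finite P" "P \<subseteq> points \<mu> J" and f: "order_embedding \<mu> J P f"
  shows "\<exists>h\<in>Aut A. \<forall>q\<in>P. \<forall>k\<in>coords (J (fst q)).
    h (trm_at (I (fst q)) (snd q) k) = trm_at (I (fst q)) (snd (f q)) k"
proof -
  interpret skeleton \<mu> J by (rule sk)
  have Pm: "fst q \<in> Field \<mu>" "snd q \<in> idx (J (fst q))" if "q \<in> P" for q
    using that P(2) by (auto simp: points_def)
  have fm: "fst (f q) = fst q" "f q \<in> points \<mu> J" if "q \<in> P" for q
    using that f by (auto simp: order_embedding_def)
  have fi: "snd (f q) \<in> idx (J (fst q))" if "q \<in> P" for q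
    using fm[OF that] by (cases "f q") (auto simp: points_def)
  have "\<exists>h\<in>Aut A. \<forall>q\<in>P. \<forall>k\<in>coords (J (fst q)). h (trm_at (I (fst q)) (snd q) k) =
      trm_at (I (fst q)) (if fst q \<in> G then snd (f q) else snd q) k"
    if "finite G" for G
    using that
  proof (induct G rule: finite_induct)
    case empty
    show ?case by (rule bexI[OF _ Aut_id]) simp
  next
    case (insert \<alpha> G)
    then obtain h where h: "h \<in> Aut A" "\<forall>q\<in>P. \<forall>k\<in>coords (J (fst q)). h (trm_at (I (fst q)) (snd q) k) =
      trm_at (I (fst q)) (if fst q \<in> G then snd (f q) else snd q) k" by blast
    define R where "R = {q\<in>P. fst q = \<alpha>}"
    have R: "finite R" "R \<subseteq> points \<mu> J" "R \<subseteq> P" using P by (auto simp: R_def)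
    show ?case
    proof (cases "R = {}")
      case True
      then have "fst q \<noteq> \<alpha>" if "q \<in> P" for q using that unfolding R_def by blast
      then show ?thesis using h(2) by (intro bexI[OF _ h(1)]) simp
    next
      case False
      then have \<alpha>: "\<alpha> \<in> Field \<mu>" using Pm by (auto simp: R_def)
      define D where "D = (\<Union>q\<in>P - R. \<Union>k\<in>coords (J (fst q)).
        {trm_at (I (fst q)) (snd q) k, trm_at (I (fst q)) (snd (f q)) k})"
      have "finite D" unfolding D_def using P(1) K Pm by auto
      then have AD: "small \<kappa> (A \<union> D)" by (intro small_Un A small_finite)
      have "D \<subseteq> (\<Union>\<beta>\<in>Field \<mu> - {\<alpha>}. seq_elems (I \<beta>))"
      proof
        fix c assume "c \<in> D"
        then obtain q k where q: "q \<in> P" "fst q \<noteq> \<alpha>" "k \<in> coords (J (fst q))"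
          and c: "c = trm_at (I (fst q)) (snd q) k \<or> c = trm_at (I (fst q)) (snd (f q)) k"
          unfolding D_def R_def by blast
        have "k \<in> coords (I (fst q))" "snd q \<in> idx (I (fst q))" "snd (f q) \<in> idx (I (fst q))"
          using K[OF Pm(1)[OF q(1)]] idx[OF Pm(1)[OF q(1)]] Pm(2)[OF q(1)] fi[OF q(1)] q(3) by auto
        then have "c \<in> seq_elems (I (fst q))" using c unfolding seq_elems_def by blast
        then show "c \<in> (\<Union>\<beta>\<in>Field \<mu> - {\<alpha>}. seq_elems (I \<beta>))" using q Pm(1)[OF q(1)] by blast
      qed
      then have sub: "A \<union> D \<subseteq> A \<union> (\<Union>\<beta>\<in>Field \<mu> - {\<alpha>}. seq_elems (I \<beta>))" by blast
      have ind: "indiscernible L M (I \<alpha>) (A \<union> (\<Union>\<beta>\<in>Field \<mu> - {\<alpha>}. seq_elems (I \<beta>)))"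
        using mut \<alpha> unfolding mutually_indiscernible_def by blast
      have eR: "lex_enum R l \<in> P \<and> fst (lex_enum R l) = \<alpha>" if "l < card R" for l
        using lex_enum_in(1)[OF R(1,2) that] by (auto simp: R_def)
      have s: "increasing (I \<alpha>) (card R) (\<lambda>l. snd (lex_enum R l))"
        by (rule J[OF \<alpha> increasing_fiber]) (use eR P(2) lex_enum_less[OF R(1,2)] in auto)
      have t: "increasing (I \<alpha>) (card R) (\<lambda>l. snd (f (lex_enum R l)))"
      proof (rule J[OF \<alpha> increasing_fiber])
        show "f (lex_enum R l) \<in> points \<mu> J \<and> fst (f (lex_enum R l)) = \<alpha>" if "l < card R" for l
          using eR[OF that] fm by simp
        show "pt_less \<mu> J (f (lex_enum R k)) (f (lex_enum R l))" if "k < l" "l < card R" for k l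
          using lex_enum_less[OF R(1,2) that] eR that f unfolding order_embedding_def by simp
      qed
      obtain g where g: "g \<in> Aut (A \<union> D)" "\<And>l k. l < card R \<Longrightarrow> k \<in> coords (J \<alpha>) \<Longrightarrow>
          g (trm_at (I \<alpha>) (snd (lex_enum R l)) k) = trm_at (I \<alpha>) (snd (f (lex_enum R l))) k"
        using indiscernible_move[OF ind AD sub _ _ s t, of "coords (J \<alpha>)"] K[OF \<alpha>] by blast
      have "(g \<circ> h) (trm_at (I (fst q)) (snd q) k) =
          trm_at (I (fst q)) (if fst q \<in> insert \<alpha> G then snd (f q) else snd q) k"
        if q: "q \<in> P" and k: "k \<in> coords (J (fst q))" for q k
      proof (cases "q \<in> R")
        case True
        then obtain l where l: "l < card R" "q = lex_enum R l" by (rule lex_enum_surj[OF R(1,2)])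
        have "fst q = \<alpha>" using True by (simp add: R_def)
        then have "h (trm_at (I (fst q)) (snd q) k) = trm_at (I (fst q)) (snd q) k"
          using h(2) q k insert.hyps(2) by auto
        then show ?thesis using g(2)[OF l(1), of k] k \<open>fst q = \<alpha>\<close> l(2) by simp
      next
        case False
        then have ne: "fst q \<noteq> \<alpha>" using q by (simp add: R_def)
        have "trm_at (I (fst q)) (if fst q \<in> G then snd (f q) else snd q) k \<in> D"
          unfolding D_def using q False k by (cases "fst q \<in> G") auto
        then have "g (trm_at (I (fst q)) (if fst q \<in> G then snd (f q) else snd q) k) =
            trm_at (I (fst q)) (if fst q \<in> G then snd (f q) else snd q) k"
          using Aut_fixes[OF g(1)] by blast
        moreover have "h (trm_at (I (fst q)) (snd q) k) =
            trm_at (I (fst q)) (if fst q \<in> G then snd (f q) else snd q) k"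
          using h(2) q k by blast
        ultimately show ?thesis using ne by simp
      qed
      moreover have "g \<circ> h \<in> Aut A"
        using Aut_comp h(1) g(1) Aut_mono[of A "A \<union> D"] by blast
      ultimately show ?thesis by blast
    qed
  qed
  from this[of "fst ` P"] P(1) obtain h where "h \<in> Aut A"
    "\<forall>q\<in>P. \<forall>k\<in>coords (J (fst q)). h (trm_at (I (fst q)) (snd q) k) =
      trm_at (I (fst q)) (if fst q \<in> fst ` P then snd (f q) else snd q) k" by blast
  then show ?thesis by (intro bexI[of _ h]) auto
qed

end

section \<open>Patterns over the larger set\<close>

context nonforking
begin

lemma finite_type_formula:
  assumes "finite \<Delta>" "\<Delta> \<subseteq> forms (lang_over L (e ` Y)) X"
  obtains Q where "definable L M A (Y <+> X) Q" "\<And>x. realizes M x \<Delta> \<longleftrightarrow> Q (case_sum e x)"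
proof -
  have "definable L M (e ` Y \<union> {}) X (\<lambda>x. \<forall>\<phi>\<in>\<Delta>. sat (named M) x \<phi>)"
    by (rule definable_Ball[OF assms(1)], rule definable_form) (use assms(2) in auto)
  from definable_absorb[OF this infinite_vars] obtain Q where
    Q: "definable L M {} (Y <+> X) Q" "\<And>x. (\<forall>\<phi>\<in>\<Delta>. sat (named M) x \<phi>) \<longleftrightarrow> Q (case_sum e x)" by blast
  show ?thesis
    by (rule that[OF definable_mono[OF Q(1)]]) (simp_all add: realizes_def Q(2))
qed

text \<open>
  If \<open>2^N\<close> tuples satisfying a finite part of \<open>p\<close> are shattered by \<open>Q\<close>, index them by the
  subsets of \<open>{..<N}\<close>. For each \<open>l < N\<close> there is \<open>y l\<close> such that \<open>Q(y l, x)\<close> holds exactly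
  at the tuples \<open>x\<close> whose subset contains \<open>l\<close>. The columns \<open>y l\<close>, the same for all \<open>\<alpha>\<close>,
  form a pattern: given \<open>v\<close>, the tuple for the set of places of the points \<open>(\<alpha>, i \<alpha>)\<close>
  distinguishes these places from those of \<open>(\<alpha>, j \<alpha>)\<close>.
\<close>

lemma shattering_not_dpr_less:
  fixes \<mu> :: "'v rel" and J :: "'v \<Rightarrow> ('v, 'm) seq"
  assumes Q: "definable L M A (Y <+> X) Q" and sh: "shattering Q"
    and sk: "skeleton \<mu> J" and \<mu>: "small \<kappa> (Field \<mu>)"
    and idx: "\<And>\<alpha>. \<alpha> \<in> Field \<mu> \<Longrightarrow> countable (idx (J \<alpha>)) \<and> infinite (idx (J \<alpha>))"
    and p: "p \<subseteq> forms (lang_over L (e ` Y)) X" "realizes M a0 p" and AB: "A \<subseteq> e ` Y"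
  shows "\<not> dpr_less \<kappa> L M X (e ` Y) p \<mu>"
proof -
  interpret skeleton \<mu> J by (rule sk)
  obtain V where V: "finite V" "V \<subseteq> Y <+> X" "definable L M A V Q"
    using definable_finite_support[OF Q] by blast
  define Y0 where "Y0 = Inl -` V"
  have Y0: "finite Y0" unfolding Y0_def by (rule finite_vimageI[OF V(1)]) simp
  define I where "I \<alpha> = (J \<alpha>)\<lparr>coords := Y0\<rparr>" for \<alpha>
  have I_simps: "idx (I \<alpha>) = idx (J \<alpha>)" "ord (I \<alpha>) = ord (J \<alpha>)" "coords (I \<alpha>) = Y0" for \<alpha>
    by (simp_all add: I_def)
  have skI: "skeleton \<mu> I" using lin_\<mu> lin by (simp add: skeleton_def I_simps)
  interpret I: skeleton \<mu> I by (rule skI)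
  define \<Phi> where "\<Phi> s \<longleftrightarrow> Q (\<lambda>u. s (case_sum (\<lambda>z. Inr (0, z)) Inl u))" for s :: "'v + nat \<times> 'v \<Rightarrow> 'm"
  have \<Phi>: "definable L M (e ` Y) (X <+> ({..<1 :: nat} \<times> Y0)) \<Phi>"
  proof -
    have inf: "infinite (UNIV :: ('v + nat \<times> 'v) set)" by (simp add: infinite_vars)
    have "definable L M A (X <+> ({..<1 :: nat} \<times> Y0)) \<Phi>"
      unfolding \<Phi>_def
    proof (rule definable_reindex[OF V(3) inf], rule image_subsetI)
      fix u assume "u \<in> V"
      then show "case_sum (\<lambda>z. Inr (0, z)) Inl u \<in> X <+> ({..<1 :: nat} \<times> Y0)"
        using V(2) by (cases u) (auto simp: Y0_def)
    qed
    then show ?thesis by (rule definable_mono[OF _ AB]) simp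
  qed
  have \<Phi>_iff: "\<Phi> (case_sum x (\<lambda>(l, k). C l k)) \<longleftrightarrow> Q (case_sum (C 0) x)" for x C
  proof -
    have "(\<lambda>u. case_sum x (\<lambda>(l, k). C l k) (case_sum (\<lambda>z. Inr (0, z)) Inl u)) = case_sum (C 0) x"
      by (auto simp: fun_eq_iff split: sum.splits)
    then show ?thesis by (simp only: \<Phi>_def)
  qed
  have "\<exists>i j. i \<in> idx (I \<alpha>) \<and> j \<in> idx (I \<alpha>) \<and> i \<noteq> j" if "\<alpha> \<in> Field \<mu>" for \<alpha>
  proof -
    have inf: "infinite (idx (I \<alpha>))" using idx[OF that] by (simp add: I_simps)
    obtain i where i: "i \<in> idx (I \<alpha>)" using infinite_imp_nonempty[OF inf] by blast
    have "idx (I \<alpha>) - {i} \<noteq> {}" using inf by (metis finite.emptyI infinite_remove)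
    then show ?thesis using i by blast
  qed
  then obtain i j where ij: "\<And>\<alpha>. \<alpha> \<in> Field \<mu> \<Longrightarrow> i \<alpha> \<in> idx (I \<alpha>) \<and> j \<alpha> \<in> idx (I \<alpha>) \<and> i \<alpha> \<noteq> j \<alpha>"
    by metis
  show ?thesis
  proof (rule pattern_imp_not_dpr_less[OF skI \<mu> X small_image[OF Y],
      where n = "\<lambda>_. 1" and s = "\<lambda>\<alpha> _. i \<alpha>" and t = "\<lambda>\<alpha> _. j \<alpha>" and \<Phi> = "\<lambda>_. \<Phi>"])
    show "countable (idx (I \<alpha>)) \<and> infinite (idx (I \<alpha>))" if "\<alpha> \<in> Field \<mu>" for \<alpha>
      using idx[OF that] by (simp add: I_simps)
    show "finite (coords (I \<alpha>))" for \<alpha> using Y0 by (simp add: I_simps)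
    show "increasing (I \<alpha>) 1 (\<lambda>_. i \<alpha>)" "increasing (I \<alpha>) 1 (\<lambda>_. j \<alpha>)" if "\<alpha> \<in> Field \<mu>" for \<alpha>
      using ij[OF that] by (auto simp: increasing_def)
    show "definable L M (e ` Y) (X <+> ({..<1 :: nat} \<times> coords (I \<alpha>))) \<Phi>" for \<alpha>
      using \<Phi> by (simp add: I_simps)
    show "p \<subseteq> forms (lang_over L (e ` Y)) X" by (rule p(1))
  next
    fix F P \<Delta> and N :: nat
    assume F: "finite F" "F \<subseteq> Field \<mu>" and P: "finite P" "P \<subseteq> points \<mu> I"
      and FP: "\<And>\<alpha> l :: nat. \<alpha> \<in> F \<Longrightarrow> l < 1 \<Longrightarrow> (\<alpha>, i \<alpha>) \<in> P \<and> (\<alpha>, j \<alpha>) \<in> P"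
      and \<Delta>: "finite \<Delta>" "\<Delta> \<subseteq> p"
    have "\<Delta> \<subseteq> forms (lang_over L (e ` Y)) X" using \<Delta>(2) p(1) by blast
    from finite_type_formula[OF \<Delta>(1) this] obtain Q' where
      Q': "definable L M A (Y <+> X) Q'" "\<And>x. realizes M x \<Delta> \<longleftrightarrow> Q' (case_sum e x)" by blast
    have "realizes M a0 \<Delta>" using p(2) \<Delta>(2) unfolding realizes_def by blast
    then have e: "Q' (case_sum e a0)" using Q'(2) by simp
    \<comment> \<open>the tuple \<open>a i\<close> belongs to the subset \<open>E i\<close> of the positions\<close>
    define n where "n = card (Pow {..<N})"
    obtain E where E: "bij_betw E {..<n} (Pow {..<N})"
      using ex_bij_betw_nat_finite[of "Pow {..<N}"] by (auto simp: n_def lessThan_atLeast0)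
    from shattering_consistent[OF Q sh Q'(1) e, of n] obtain a where
      a: "\<forall>i<n. Q' (case_sum e (a i))" and sha: "\<forall>\<eta>. \<exists>y. \<forall>i<n. Q (case_sum y (a i)) \<longleftrightarrow> i \<in> \<eta>"
      by (elim exE conjE)
    have "\<forall>l. \<exists>y. \<forall>i<n. Q (case_sum y (a i)) \<longleftrightarrow> l \<in> E i"
    proof
      fix l
      from sha[rule_format, of "{i. l \<in> E i}"]
      show "\<exists>y. \<forall>i<n. Q (case_sum y (a i)) \<longleftrightarrow> l \<in> E i" by simp
    qed
    then obtain y where y: "\<forall>l. \<forall>i<n. Q (case_sum (y l) (a i)) \<longleftrightarrow> l \<in> E i" by metis
    show "\<exists>C. \<forall>v\<in>nsets {..<N} (card P). \<exists>a. realizes M a \<Delta> \<and>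
        (\<forall>\<alpha>\<in>F. separates (\<lambda>_. \<Phi>) (\<lambda>\<alpha> _. i \<alpha>) (\<lambda>\<alpha> _. j \<alpha>) C (\<lambda>q. nth_of v (rank \<mu> I P q)) a \<alpha>)"
    proof (unfold separates_def, rule exI[of _ "\<lambda>l \<alpha> k. y l k"], rule ballI)
      fix v assume v: "v \<in> nsets {..<N} (card P)"
      then have v': "finite v" "card v = card P" "v \<subseteq> {..<N}" by (auto simp: nsets_def)
      define pos where "pos q = nth_of v (rank \<mu> I P q)" for q
      have pos_in: "pos q \<in> {..<N}" if "q \<in> P" for q
        using nth_of_in[OF v'(1)] I.rank_less[OF P(1) that] v'(2,3) unfolding pos_def by auto
      have pos_inj: "inj_on pos P"
      proof (rule I.inj_on_increasing[OF P(2)])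
        show "pos q < pos q'" if "q \<in> P" "q' \<in> P" "pt_less \<mu> I q q'" for q q'
          unfolding pos_def
          by (rule nth_of_less[OF v'(1) I.rank_mono[OF P that]])
            (simp add: v'(2) I.rank_less[OF P(1) that(2)])
      qed
      define E0 where "E0 = (\<lambda>\<alpha>. pos (\<alpha>, i \<alpha>)) ` F"
      have "E0 \<in> Pow {..<N}" using pos_in FP unfolding E0_def by auto
      then obtain c where c: "c < n" "E c = E0"
        using E by (metis bij_betwE bij_betw_inv_into bij_betw_inv_into_right lessThan_iff)
      have ne: "pos (\<alpha>, j \<alpha>) \<notin> E0" if \<alpha>: "\<alpha> \<in> F" for \<alpha>
      proof
        assume "pos (\<alpha>, j \<alpha>) \<in> E0"
        then obtain \<beta> where \<beta>: "\<beta> \<in> F" "pos (\<alpha>, j \<alpha>) = pos (\<beta>, i \<beta>)" unfolding E0_def by blast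
        have "(\<alpha>, j \<alpha>) = (\<beta>, i \<beta>)"
          by (rule inj_onD[OF pos_inj \<beta>(2)]) (use FP \<alpha> \<beta>(1) in auto)
        moreover have "i \<alpha> \<noteq> j \<alpha>" using ij \<alpha> F(2) by blast
        ultimately show False by auto
      qed
      have "realizes M (a c) \<Delta>" using a c(1) Q'(2) by simp
      moreover have "\<Phi> (case_sum (a c) (\<lambda>(l, k). y (nth_of v (rank \<mu> I P (\<alpha>, i \<alpha>))) k)) \<noteq>
               \<Phi> (case_sum (a c) (\<lambda>(l, k). y (nth_of v (rank \<mu> I P (\<alpha>, j \<alpha>))) k))" if \<alpha>: "\<alpha> \<in> F" for \<alpha>
      proof -
        have "Q (case_sum (y (pos (\<alpha>, i \<alpha>))) (a c))" using y c \<alpha> by (simp add: E0_def)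
        moreover have "\<not> Q (case_sum (y (pos (\<alpha>, j \<alpha>))) (a c))" using y c ne[OF \<alpha>] by simp
        ultimately show ?thesis
          using \<Phi>_iff[of "a c" "\<lambda>_. y (pos (\<alpha>, i \<alpha>))"] \<Phi>_iff[of "a c" "\<lambda>_. y (pos (\<alpha>, j \<alpha>))"]
          by (simp add: pos_def)
      qed
      ultimately show "\<exists>a. realizes M a \<Delta> \<and>
        (\<forall>\<alpha>\<in>F. \<Phi> (case_sum a (\<lambda>(l, k). y (nth_of v (rank \<mu> I P (\<alpha>, i \<alpha>))) k)) \<noteq>
               \<Phi> (case_sum a (\<lambda>(l, k). y (nth_of v (rank \<mu> I P (\<alpha>, j \<alpha>))) k)))" by blast
    qed
  qed
qed

end

context nonforking
begin

text \<open>
  For each \<open>v\<close> an automorphism over \<open>A\<close> moves the points of \<open>P\<close> to terms of \<open>I\<close> at the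
  places in \<open>v\<close>; the tuple at \<open>v\<close> is the image of \<open>b\<close>. Being separated by some common
  sequence of columns is a definable property \<open>\<Theta>\<close> of the family of these tuples, so it
  survives the passage to an indiscernible family; there the columns are chosen anew. Then
  \<open>not_shattering_consistent\<close> moves the family into the finite part \<open>\<Delta>\<close> of the type.
\<close>

lemma not_shattering_pattern:
  fixes \<mu> :: "'v rel" and I J :: "'v \<Rightarrow> ('v, 'm) seq"
    and \<Phi> :: "'v \<Rightarrow> ('v + nat \<times> 'v \<Rightarrow> 'm) \<Rightarrow> bool" and n :: "'v \<Rightarrow> nat"
  assumes nip: "\<And>Q. definable L M A (Y <+> X) Q \<Longrightarrow> \<not> shattering Q"
    and b: "tp L M X b A = tp L M X a0 A"
    and mut: "mutually_indiscernible L M (Field \<mu>) I A"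
    and sk: "skeleton \<mu> J"
    and JI: "\<And>\<alpha> n s. \<alpha> \<in> Field \<mu> \<Longrightarrow> increasing (J \<alpha>) n s \<Longrightarrow> increasing (I \<alpha>) n s"
    and K: "\<And>\<alpha>. \<alpha> \<in> Field \<mu> \<Longrightarrow> finite (coords (J \<alpha>)) \<and> coords (J \<alpha>) \<subseteq> coords (I \<alpha>)"
    and idx: "\<And>\<alpha>. \<alpha> \<in> Field \<mu> \<Longrightarrow> infinite (idx (J \<alpha>)) \<and> idx (J \<alpha>) \<subseteq> idx (I \<alpha>)"
    and \<Phi>: "\<And>\<alpha>. \<alpha> \<in> Field \<mu> \<Longrightarrow> definable L M A (X <+> ({..<n \<alpha>} \<times> coords (J \<alpha>))) (\<Phi> \<alpha>)"
    and sep: "\<And>\<alpha>. \<alpha> \<in> Field \<mu> \<Longrightarrow> \<Phi> \<alpha> (case_sum b (\<lambda>(l, k). trm_at (I \<alpha>) (s \<alpha> l) k)) \<noteq>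
      \<Phi> \<alpha> (case_sum b (\<lambda>(l, k). trm_at (I \<alpha>) (t \<alpha> l) k))"
    and F: "finite F" "F \<subseteq> Field \<mu>" and P: "finite P" "P \<subseteq> points \<mu> J"
    and FP: "\<And>\<alpha> l. \<alpha> \<in> F \<Longrightarrow> l < n \<alpha> \<Longrightarrow> (\<alpha>, s \<alpha> l) \<in> P \<and> (\<alpha>, t \<alpha> l) \<in> P"
    and \<Delta>: "finite \<Delta>" "\<Delta> \<subseteq> forms (lang_over L (e ` Y)) X" "realizes M a0 \<Delta>"
  shows "\<exists>C. \<forall>v\<in>nsets {..<N} (card P). \<exists>a. realizes M a \<Delta> \<and>
        (\<forall>\<alpha>\<in>F. separates \<Phi> s t C (\<lambda>q. nth_of v (rank \<mu> J P q)) a \<alpha>)"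
proof -
  interpret skeleton \<mu> J by (rule sk)
  define m where "m = card P"
  define rs where "rs \<alpha> l = rank \<mu> J P (\<alpha>, s \<alpha> l)" for \<alpha> l
  define rt where "rt \<alpha> l = rank \<mu> J P (\<alpha>, t \<alpha> l)" for \<alpha> l
  have rm: "rs \<alpha> l < m" "rt \<alpha> l < m" if "\<alpha> \<in> F" "l < n \<alpha>" for \<alpha> l
    using FP[OF that] rank_less[OF P(1)] by (simp_all add: rs_def rt_def m_def)
  define config where "config C a v \<alpha> \<longleftrightarrow>
      \<Phi> \<alpha> (case_sum a (\<lambda>(l, k). C (nth_of v (rs \<alpha> l), \<alpha>, k))) \<noteq>
      \<Phi> \<alpha> (case_sum a (\<lambda>(l, k). C (nth_of v (rt \<alpha> l), \<alpha>, k)))"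
    for C :: "nat \<times> 'v \<times> 'v \<Rightarrow> 'm" and a :: "'v \<Rightarrow> 'm" and v \<alpha>
  have config_cong: "config C a v \<alpha> = config C' a' v' \<alpha>"
    if "\<alpha> \<in> F" "\<And>x. x \<in> X \<Longrightarrow> a x = a' x"
      "\<And>j k. j < m \<Longrightarrow> C (nth_of v j, \<alpha>, k) = C' (nth_of v' j, \<alpha>, k)" for C a v C' a' v' \<alpha>
  proof -
    have "\<Phi> \<alpha> (case_sum a (\<lambda>(l, k). C (nth_of v (r l), \<alpha>, k))) =
        \<Phi> \<alpha> (case_sum a' (\<lambda>(l, k). C' (nth_of v' (r l), \<alpha>, k)))" if "\<And>l. l < n \<alpha> \<Longrightarrow> r l < m" for r
      by (rule definable_cong[OF \<Phi>]) (use \<open>\<alpha> \<in> F\<close> F(2) that \<open>\<And>x. x \<in> X \<Longrightarrow> a x = a' x\<close>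
          \<open>\<And>j k. j < m \<Longrightarrow> C (nth_of v j, \<alpha>, k) = C' (nth_of v' j, \<alpha>, k)\<close> in auto)
    then show ?thesis using rm[OF that(1)] by (simp add: config_def)
  qed
  define \<Theta> where "\<Theta> k a \<longleftrightarrow> (\<exists>C. \<forall>v\<in>nsets {..<k} m. \<forall>\<alpha>\<in>F. config C (\<lambda>x. a (v, x)) v \<alpha>)"
    for k :: nat and a :: "nat set \<times> 'v \<Rightarrow> 'm"
  have inf: "infinite (UNIV :: (nat set \<times> 'v) set)" by (simp add: finite_prod Finite_Set.finite_set)
  have d\<Theta>: "definable L M A (nsets {..<k} m \<times> X) (\<Theta> k)" for k
  proof -
    let ?W = "{..<k} \<times> (SIGMA \<alpha>:F. coords (J \<alpha>))"
    have inf': "infinite (UNIV :: ((nat set \<times> 'v) + nat \<times> 'v \<times> 'v) set)" using inf by simp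
    have "definable L M A ((nsets {..<k} m \<times> X) <+> ?W)
        (\<lambda>\<sigma>. \<forall>v\<in>nsets {..<k} m. \<forall>\<alpha>\<in>F. config (\<lambda>u. \<sigma> (Inr u)) (\<lambda>x. \<sigma> (Inl (v, x))) v \<alpha>)"
    proof (intro definable_Ball F(1))
      show "finite (nsets {..<k} m)" by (simp add: finite_imp_finite_nsets)
      fix v \<alpha> assume v: "v \<in> nsets {..<k} m" and \<alpha>: "\<alpha> \<in> F"
      have d: "definable L M A ((nsets {..<k} m \<times> X) <+> ?W)
          (\<lambda>\<sigma>. \<Phi> \<alpha> (case_sum (\<lambda>x. \<sigma> (Inl (v, x))) (\<lambda>(l, y). \<sigma> (Inr (nth_of v (r l), \<alpha>, y)))))"
        if r: "\<And>l. l < n \<alpha> \<Longrightarrow> r l < m" for r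
      proof -
        let ?g = "case_sum (\<lambda>x. Inl (v, x)) (\<lambda>(l, y). Inr (nth_of v (r l), \<alpha>, y))"
        have "definable L M A ((nsets {..<k} m \<times> X) <+> ?W) (\<lambda>\<sigma>. \<Phi> \<alpha> (\<lambda>u. \<sigma> (?g u)))"
        proof (rule definable_reindex[OF \<Phi> inf'], use F(2) \<alpha> in blast, rule image_subsetI)
          fix u assume u: "u \<in> X <+> ({..<n \<alpha>} \<times> coords (J \<alpha>))"
          have "nth_of v (r l) < k" if "l < n \<alpha>" for l
            using nth_of_in[of v "r l"] r[OF that] v by (auto simp: nsets_def)
          then show "?g u \<in> (nsets {..<k} m \<times> X) <+> ?W"
            using u v \<alpha> by (cases u) auto
        qed
        moreover have "(\<lambda>u. \<sigma> (?g u)) = case_sum (\<lambda>x. \<sigma> (Inl (v, x))) (\<lambda>(l, y). \<sigma> (Inr (nth_of v (r l), \<alpha>, y)))"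
          for \<sigma> :: "(nat set \<times> 'v) + nat \<times> 'v \<times> 'v \<Rightarrow> 'm"
          by (auto simp: fun_eq_iff split: sum.splits)
        ultimately show ?thesis by simp
      qed
      show "definable L M A ((nsets {..<k} m \<times> X) <+> ?W)
          (\<lambda>\<sigma>. config (\<lambda>u. \<sigma> (Inr u)) (\<lambda>x. \<sigma> (Inl (v, x))) v \<alpha>)"
        unfolding config_def
        by (rule definable_Not[OF definable_eq[OF d d]]) (use rm[OF \<alpha>] in auto)
    qed
    moreover have "finite ?W" using F K by (intro finite_cartesian_product finite_SigmaI) auto
    ultimately have "definable L M A (nsets {..<k} m \<times> X) (\<lambda>a. \<exists>C. \<forall>v\<in>nsets {..<k} m. \<forall>\<alpha>\<in>F.
        config (\<lambda>u. case_sum a C (Inr u)) (\<lambda>x. case_sum a C (Inl (v, x))) v \<alpha>)"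
      by (rule definable_Ex_finite[OF _ _ inf])
    then show ?thesis by (simp add: \<Theta>_def[abs_def])
  qed
  define E1 where "E1 = {(k, \<Theta> k) |k. True}"
  define E2 where "E2 = {(m, \<lambda>a :: nat set \<times> 'v \<Rightarrow> 'm. R (\<lambda>x. a ({..<m}, x))) |R. definable L M A X R \<and> R b}"
  have dE2: "definable L M A (nsets {..<m} m \<times> X) (\<lambda>a :: nat set \<times> 'v \<Rightarrow> 'm. R (\<lambda>x. a ({..<m}, x)))"
    if "definable L M A X R" for R
    by (rule definable_reindex[OF that inf]) (auto simp: nsets_def)
  have dE: "definable L M A (nsets {..<k} m \<times> X) R" if "(k, R) \<in> E1 \<union> E2" for k R
    using that d\<Theta> dE2 unfolding E1_def E2_def by blast
  have fam: "\<exists>a. \<forall>(k, R)\<in>E1 \<union> E2. \<forall>S\<in>nsets {..<N} k. R (resample S a)" for N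
  proof -
    have "\<forall>\<alpha>\<in>Field \<mu>. \<exists>u. increasing (J \<alpha>) N u"
      using increasing_exists idx by blast
    from bchoice[OF this] obtain u where u: "\<forall>\<alpha>\<in>Field \<mu>. increasing (J \<alpha>) N (u \<alpha>)" by (rule exE)
    define f where "f v q = (fst q, u (fst q) (nth_of v (rank \<mu> J P q)))" for v q
    have emb: "order_embedding \<mu> J P (f v)" if v: "v \<in> nsets {..<N} m" for v
    proof -
      have v': "finite v" "card v = m" "v \<subseteq> {..<N}" using v by (auto simp: nsets_def)
      have lt: "nth_of v (rank \<mu> J P q) < N" if "q \<in> P" for q
        using nth_of_in[OF v'(1)] rank_less[OF P(1) that] v'(2,3) by (auto simp: m_def)
      have Fq: "fst q \<in> Field \<mu>" if "q \<in> P" for q using that P(2) by (auto simp: points_def)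
      show ?thesis
        unfolding order_embedding_def
      proof (intro conjI ballI impI)
        fix q assume q: "q \<in> P"
        show "fst (f v q) = fst q" by (simp add: f_def)
        show "f v q \<in> points \<mu> J"
          using increasing_in[OF bspec[OF u Fq[OF q]] lt[OF q]] Fq[OF q] by (simp add: f_def points_def)
      next
        fix q q' assume q: "q \<in> P" and q': "q' \<in> P" and less: "pt_less \<mu> J q q'"
        show "pt_less \<mu> J (f v q) (f v q')"
        proof (cases "fst q = fst q'")
          case True
          have "nth_of v (rank \<mu> J P q) < nth_of v (rank \<mu> J P q')"
            by (rule nth_of_less[OF v'(1) rank_mono[OF P q q' less]])
              (simp add: v'(2) rank_less[OF P(1) q'] m_def)
          then show ?thesis
            using bspec[OF u Fq[OF q]] lt[OF q'] True by (simp add: f_def pt_less_def increasing_def)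
        next
          case False
          then show ?thesis using less by (auto simp: f_def pt_less_def split: prod.splits)
        qed
      qed
    qed
    have "\<forall>v\<in>nsets {..<N} m. \<exists>h. h \<in> Aut A \<and> (\<forall>q\<in>P. \<forall>k\<in>coords (J (fst q)).
        h (trm_at (I (fst q)) (snd q) k) = trm_at (I (fst q)) (snd (f v q)) k)"
    proof
      fix v assume v: "v \<in> nsets {..<N} m"
      have "\<exists>h\<in>Aut A. \<forall>q\<in>P. \<forall>k\<in>coords (J (fst q)).
        h (trm_at (I (fst q)) (snd q) k) = trm_at (I (fst q)) (snd (f v q)) k"
        by (rule mutually_indiscernible_move[OF sk mut A JI K _ P emb[OF v]]) (use idx in auto)
      then show "\<exists>h. h \<in> Aut A \<and> (\<forall>q\<in>P. \<forall>k\<in>coords (J (fst q)).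
        h (trm_at (I (fst q)) (snd q) k) = trm_at (I (fst q)) (snd (f v q)) k)" by blast
    qed
    from bchoice[OF this] obtain h where h: "\<forall>v\<in>nsets {..<N} m. h v \<in> Aut A \<and>
        (\<forall>q\<in>P. \<forall>k\<in>coords (J (fst q)). h v (trm_at (I (fst q)) (snd q) k) = trm_at (I (fst q)) (snd (f v q)) k)"
      by (rule exE)
    define a where "a = (\<lambda>(v, x). h v (b x))"
    define C where "C = (\<lambda>(i, \<alpha>, k). trm_at (I \<alpha>) (u \<alpha> i) k)"
    have conf: "config C (\<lambda>x. a (v, x)) v \<alpha>" if v: "v \<in> nsets {..<N} m" and \<alpha>: "\<alpha> \<in> F" for v \<alpha>
    proof -
      have \<alpha>': "\<alpha> \<in> Field \<mu>" using \<alpha> F(2) by blast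
      note hv = bspec[OF h v]
      have "\<Phi> \<alpha> (case_sum (\<lambda>x. a (v, x)) (\<lambda>(l, k). C (nth_of v (rank \<mu> J P (\<alpha>, r l)), \<alpha>, k))) \<longleftrightarrow>
          \<Phi> \<alpha> (case_sum b (\<lambda>(l, k). trm_at (I \<alpha>) (r l) k))"
        if r: "\<And>l. l < n \<alpha> \<Longrightarrow> (\<alpha>, r l) \<in> P" for r
      proof -
        have "\<Phi> \<alpha> (case_sum (\<lambda>x. a (v, x)) (\<lambda>(l, k). C (nth_of v (rank \<mu> J P (\<alpha>, r l)), \<alpha>, k))) \<longleftrightarrow>
            \<Phi> \<alpha> (\<lambda>z. h v (case_sum b (\<lambda>(l, k). trm_at (I \<alpha>) (r l) k) z))"
        proof (rule definable_cong[OF \<Phi>[OF \<alpha>']])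
          fix z assume z: "z \<in> X <+> ({..<n \<alpha>} \<times> coords (J \<alpha>))"
          show "case_sum (\<lambda>x. a (v, x)) (\<lambda>(l, k). C (nth_of v (rank \<mu> J P (\<alpha>, r l)), \<alpha>, k)) z =
              h v (case_sum b (\<lambda>(l, k). trm_at (I \<alpha>) (r l) k) z)"
          proof (cases z)
            case (Inl x)
            then show ?thesis by (simp add: a_def)
          next
            case (Inr w)
            obtain l k where w: "w = (l, k)" by (cases w)
            have lk: "l < n \<alpha>" "k \<in> coords (J \<alpha>)" using z by (auto simp: Inr w)
            then have "h v (trm_at (I \<alpha>) (r l) k) = trm_at (I \<alpha>) (snd (f v (\<alpha>, r l))) k"
              using hv r[OF lk(1)] by force
            then show ?thesis by (simp add: Inr w C_def f_def)
          qed
        qed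
        also have "\<dots> \<longleftrightarrow> \<Phi> \<alpha> (case_sum b (\<lambda>(l, k). trm_at (I \<alpha>) (r l) k))"
          by (rule definable_Aut[OF \<Phi>[OF \<alpha>']]) (use hv in blast)
        finally show ?thesis .
      qed
      from this[of "s \<alpha>"] this[of "t \<alpha>"] show ?thesis
        using sep[OF \<alpha>'] FP[OF \<alpha>] by (simp add: config_def rs_def rt_def)
    qed
    have "R (resample S a)" if kR: "(k, R) \<in> E1 \<union> E2" and S: "S \<in> nsets {..<N} k" for k R S
    proof (cases "(k, R) \<in> E1")
      case True
      then have R: "R = \<Theta> k" by (auto simp: E1_def)
      have S': "finite S" "card S = k" "S \<subseteq> {..<N}" using S by (auto simp: nsets_def)
      have "config (\<lambda>(i, \<alpha>, k). C (nth_of S i, \<alpha>, k)) (\<lambda>x. resample S a (v, x)) v \<alpha>"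
        if v: "v \<in> nsets {..<k} m" and \<alpha>: "\<alpha> \<in> F" for v \<alpha>
      proof -
        have Sv: "nth_of S ` v \<in> nsets {..<N} m"
          using nth_of_image_nsets[OF S v] S'(3) by (auto simp: nsets_def)
        have v': "v \<subseteq> {..<card S}" "card v = m" using v S'(2) by (auto simp: nsets_def)
        have "config (\<lambda>(i, \<alpha>, k). C (nth_of S i, \<alpha>, k)) (\<lambda>x. resample S a (v, x)) v \<alpha> =
            config C (\<lambda>x. a (nth_of S ` v, x)) (nth_of S ` v) \<alpha>"
          by (rule config_cong[OF \<alpha>]) (auto simp: resample_def nth_of_comp[OF S'(1) v'(1)] v'(2))
        then show ?thesis using conf[OF Sv \<alpha>] by simp
      qed
      then show ?thesis unfolding R \<Theta>_def by blast
    next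
      case False
      then obtain R' where R': "k = m" "R = (\<lambda>a. R' (\<lambda>x. a ({..<m}, x)))" "definable L M A X R'" "R' b"
        using kR unfolding E2_def by blast
      have S': "S \<in> nsets {..<N} m" using S R'(1) by simp
      have "nth_of S ` {..<m} = S" using nth_of_image[of S] S' by (auto simp: nsets_def)
      then have "(\<lambda>x. resample S a ({..<m}, x)) = (\<lambda>x. h S (b x))" by (simp add: resample_def a_def)
      moreover have "R' (\<lambda>x. h S (b x)) = R' b"
        by (rule definable_Aut[OF R'(3)]) (use h S' in blast)
      ultimately show ?thesis using R'(4) unfolding R'(2) by simp
    qed
    then show ?thesis by (intro exI[of _ a]) auto
  qed
  show ?thesis
  proof (rule extraction[OF A X dE fam])
    fix a :: "nat set \<times> 'v \<Rightarrow> 'm"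
    assume a1: "\<And>k R S. (k, R) \<in> E1 \<union> E2 \<Longrightarrow> S \<in> nsets UNIV k \<Longrightarrow> R (resample S a)"
      and a2: "\<And>k R S S'. definable L M A (nsets {..<k} m \<times> X) R \<Longrightarrow> S \<in> nsets UNIV k \<Longrightarrow>
        S' \<in> nsets UNIV k \<Longrightarrow> R (resample S a) = R (resample S' a)"
    have ind: "indiscernible_family A X m a" by (rule indiscernible_familyI[OF a2])
    have tpa: "tp L M X (\<lambda>x. a (v, x)) A = tp L M X a0 A" if v: "v \<in> nsets UNIV m" for v
    proof -
      have "nth_of v ` {..<m} = v" using nth_of_image[of v] v by (auto simp: nsets_def)
      then have res: "(\<lambda>x. resample v a ({..<m}, x)) = (\<lambda>x. a (v, x))" by (simp add: resample_def)
      have pos: "R (\<lambda>x. a (v, x))" if "definable L M A X R" "R b" for R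
      proof -
        have "(m, \<lambda>a :: nat set \<times> 'v \<Rightarrow> 'm. R (\<lambda>x. a ({..<m}, x))) \<in> E1 \<union> E2"
          using that unfolding E2_def by blast
        from a1[OF this v] show ?thesis unfolding res .
      qed
      have "tp L M X (\<lambda>x. a (v, x)) A = tp L M X b A"
        unfolding tp_eq_iff using pos definable_Not pos by blast
      then show ?thesis using b by simp
    qed
    from finite_type_formula[OF \<Delta>(1,2)] obtain Q where
      Q: "definable L M A (Y <+> X) Q" "\<And>x. realizes M x \<Delta> \<longleftrightarrow> Q (case_sum e x)" by blast
    have "Q (case_sum e a0)" using \<Delta>(3) Q(2) by simp
    from not_shattering_consistent[OF Q(1) this nip[OF Q(1)] ind tpa, of N] obtain g where
      g: "g \<in> Aut A" "\<forall>v\<in>nsets {..<N} m. Q (case_sum e (\<lambda>x. g (a (v, x))))" by blast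
    have "(N, \<Theta> N) \<in> E1 \<union> E2" unfolding E1_def by blast
    from a1[OF this, of "{..<N}"] have "\<Theta> N (resample {..<N} a)" by (simp add: nsets_def)
    then obtain C where C: "\<forall>v\<in>nsets {..<N} m. \<forall>\<alpha>\<in>F. config C (\<lambda>x. resample {..<N} a (v, x)) v \<alpha>"
      unfolding \<Theta>_def by (rule exE)
    have conf: "config (\<lambda>z. g (C z)) (\<lambda>x. g (a (v, x))) v \<alpha>" if v: "v \<in> nsets {..<N} m" and \<alpha>: "\<alpha> \<in> F" for v \<alpha>
    proof -
      have "nth_of {..<N} ` v = (\<lambda>i. i) ` v"
      proof (rule image_cong[OF refl])
        fix i assume "i \<in> v"
        then have "i < N" using v by (auto simp: nsets_def)
        then show "nth_of {..<N} i = i" using nth_of_unique[of N id "{..<N}" i] by simp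
      qed
      then have res: "resample {..<N} a (v, x) = a (v, x)" for x by (simp add: resample_def)
      have c: "config C (\<lambda>x. a (v, x)) v \<alpha>" by (rule bspec[OF bspec[OF C v] \<alpha>, unfolded res])
      have "\<Phi> \<alpha> (case_sum (\<lambda>x. g (a (v, x))) (\<lambda>(l, k). g (D l k))) = \<Phi> \<alpha> (case_sum (\<lambda>x. a (v, x)) (\<lambda>(l, k). D l k))" for D
      proof -
        have "case_sum (\<lambda>x. g (a (v, x))) (\<lambda>(l, k). g (D l k)) = (\<lambda>z. g (case_sum (\<lambda>x. a (v, x)) (\<lambda>(l, k). D l k) z))"
          by (auto simp: fun_eq_iff split: sum.splits)
        then show ?thesis using definable_Aut[OF \<Phi> g(1)] \<alpha> F(2) by (simp only:) blast
      qed
      then show ?thesis using c by (simp add: config_def)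
    qed
    show ?thesis
    proof (unfold separates_def, rule exI[of _ "\<lambda>i \<alpha> k. g (C (i, \<alpha>, k))"], rule ballI)
      fix v assume "v \<in> nsets {..<N} (card P)"
      then have v: "v \<in> nsets {..<N} m" by (simp add: m_def)
      have "realizes M (\<lambda>x. g (a (v, x))) \<Delta>" using g(2) v Q(2) by blast
      then show "\<exists>a. realizes M a \<Delta> \<and>
        (\<forall>\<alpha>\<in>F. \<Phi> \<alpha> (case_sum a (\<lambda>(l, k). g (C (nth_of v (rank \<mu> J P (\<alpha>, s \<alpha> l)), \<alpha>, k)))) \<noteq>
               \<Phi> \<alpha> (case_sum a (\<lambda>(l, k). g (C (nth_of v (rank \<mu> J P (\<alpha>, t \<alpha> l)), \<alpha>, k)))))"
        using conf[OF v] unfolding config_def rs_def rt_def by blast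
    qed
  qed
qed

end

section \<open>Restriction without co-forking preserves the dp-rank\<close>

lemma linear_order_on_restrict:
  assumes "linear_order_on S r" "D \<subseteq> S"
  shows "linear_order_on D (r \<inter> D \<times> D)"
  using assms
  unfolding linear_order_on_def partial_order_on_def preorder_on_def refl_on_def trans_def antisym_def total_on_def
  by blast

context nonforking
begin

text \<open>
  A counterexample over \<open>A\<close> yields one over \<open>B = e ` Y\<close>. Its sequences are first thinned
  out to countably many positions and finitely many coordinates that still carry the
  witnesses, so that all of them together form a small set.
\<close>

lemma dpr_less_restrict:
  fixes \<mu> :: "'v rel"
  assumes AB: "A \<subseteq> e ` Y" and \<mu>: "Card_order \<mu>" "\<mu> <o \<kappa>"
    and less: "dpr_less \<kappa> L M X (e ` Y) (tp L M X a0 (e ` Y)) \<mu>"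
  shows "dpr_less \<kappa> L M X A (tp L M X a0 A) \<mu>"
  unfolding dpr_less_def
proof (intro allI impI, elim conjE, rule ccontr)
  fix I :: "'v \<Rightarrow> ('v, 'm) seq" and b
  assume infs: "\<forall>\<alpha>\<in>Field \<mu>. infinite_seq \<kappa> (I \<alpha>)"
    and mut: "mutually_indiscernible L M (Field \<mu>) I A"
    and b: "realizes M b (tp L M X a0 A)"
    and none: "\<not> (\<exists>\<beta>\<in>Field \<mu>. indiscernible L M (I \<beta>) (b ` X \<union> A))"
  have tpb: "tp L M X b A = tp L M X a0 A" using b unfolding realizes_tp_iff .
  have small\<mu>: "small \<kappa> (Field \<mu>)"
    unfolding small_def by (rule ordIso_ordLess_trans[OF card_of_Field_ordIso[OF \<mu>(1)] \<mu>(2)])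
  have lin\<mu>: "linear_order_on (Field \<mu>) \<mu>"
    using \<mu>(1) by (simp add: card_order_on_def well_order_on_def)
  define witness where "witness \<alpha> n s t K \<Phi> D \<longleftrightarrow> increasing (I \<alpha>) n s \<and> increasing (I \<alpha>) n t \<and>
      finite K \<and> K \<subseteq> coords (I \<alpha>) \<and> definable L M A (X <+> ({..<n} \<times> K)) \<Phi> \<and>
      \<Phi> (case_sum b (\<lambda>(l, k). trm_at (I \<alpha>) (s l) k)) \<noteq> \<Phi> (case_sum b (\<lambda>(l, k). trm_at (I \<alpha>) (t l) k)) \<and>
      countable D \<and> infinite D \<and> D \<subseteq> idx (I \<alpha>) \<and> s ` {..<n} \<subseteq> D \<and> t ` {..<n} \<subseteq> D"
    for \<alpha> n s t K \<Phi> D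
  have "\<forall>\<alpha>\<in>Field \<mu>. \<exists>n s t K \<Phi> D. witness \<alpha> n s t K \<Phi> D"
  proof
    fix \<alpha> assume \<alpha>: "\<alpha> \<in> Field \<mu>"
    have "\<not> indiscernible L M (I \<alpha>) (b ` X \<union> A)" using none \<alpha> by blast
    then obtain n s t K \<Phi> where st: "increasing (I \<alpha>) n s" "increasing (I \<alpha>) n t"
      and *: "finite K" "K \<subseteq> coords (I \<alpha>)" "definable L M A (X <+> ({..<n} \<times> K)) \<Phi>"
      "\<Phi> (case_sum b (\<lambda>(l, k). trm_at (I \<alpha>) (s l) k)) \<noteq> \<Phi> (case_sum b (\<lambda>(l, k). trm_at (I \<alpha>) (t l) k))"
      by (rule not_indiscernible_witness)
    have "infinite (idx (I \<alpha>))" using infs \<alpha> by (simp add: infinite_seq_def)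
    from infinite_countable_subset'[OF this] obtain D where
      D: "D \<subseteq> idx (I \<alpha>)" "countable D" "infinite D" by (elim exE conjE)
    define D' where "D' = D \<union> s ` {..<n} \<union> t ` {..<n}"
    have "countable D'" "infinite D'" using D by (auto simp: D'_def countable_finite)
    moreover have "D' \<subseteq> idx (I \<alpha>)" using D(1) st by (auto simp: D'_def increasing_def)
    moreover have "s ` {..<n} \<subseteq> D'" "t ` {..<n} \<subseteq> D'" by (auto simp: D'_def)
    ultimately have "witness \<alpha> n s t K \<Phi> D'" using st * unfolding witness_def by (intro conjI)
    then show "\<exists>n s t K \<Phi> D. witness \<alpha> n s t K \<Phi> D" by (intro exI)
  qed
  then obtain n s t K \<Phi> D where "\<forall>\<alpha>\<in>Field \<mu>. witness \<alpha> (n \<alpha>) (s \<alpha>) (t \<alpha>) (K \<alpha>) (\<Phi> \<alpha>) (D \<alpha>)"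
    unfolding bchoice_iff by (elim exE)
  note wit = bspec[OF this, unfolded witness_def]
  define J where "J \<alpha> = \<lparr>idx = D \<alpha>, ord = ord (I \<alpha>) \<inter> D \<alpha> \<times> D \<alpha>, coords = K \<alpha>, trm_at = trm_at (I \<alpha>)\<rparr>" for \<alpha>
  have J: "idx (J \<alpha>) = D \<alpha>" "ord (J \<alpha>) = ord (I \<alpha>) \<inter> D \<alpha> \<times> D \<alpha>" "coords (J \<alpha>) = K \<alpha>" for \<alpha>
    by (simp_all add: J_def)
  have sk: "skeleton \<mu> J"
  proof
    show "linear_order_on (Field \<mu>) \<mu>" by (rule lin\<mu>)
    show "linear_order_on (idx (J \<alpha>)) (ord (J \<alpha>))" if "\<alpha> \<in> Field \<mu>" for \<alpha>
      unfolding J by (rule linear_order_on_restrict) (use infs wit[OF that] that in \<open>auto simp: infinite_seq_def\<close>)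
  qed
  have JI: "increasing (I \<alpha>) k r" if "\<alpha> \<in> Field \<mu>" "increasing (J \<alpha>) k r" for \<alpha> k r
    using that wit[OF that(1)] by (auto simp: increasing_def J)
  have IJ: "increasing (J \<alpha>) k r" if "increasing (I \<alpha>) k r" "r ` {..<k} \<subseteq> D \<alpha>" for \<alpha> k r
    using that by (auto simp: increasing_def J image_subset_iff)
  have idxJ: "countable (idx (J \<alpha>)) \<and> infinite (idx (J \<alpha>))" if "\<alpha> \<in> Field \<mu>" for \<alpha>
    using wit[OF that] by (simp add: J)
  have p: "tp L M X a0 (e ` Y) \<subseteq> forms (lang_over L (e ` Y)) X" "realizes M a0 (tp L M X a0 (e ` Y))"
    by (auto simp: tp_def realizes_def)
  have "\<not> dpr_less \<kappa> L M X (e ` Y) (tp L M X a0 (e ` Y)) \<mu>"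
  proof (cases "\<exists>Q. definable L M A (Y <+> X) Q \<and> shattering Q")
    case True
    then obtain Q where "definable L M A (Y <+> X) Q" "shattering Q" by blast
    then show ?thesis by (rule shattering_not_dpr_less[OF _ _ sk small\<mu> idxJ p AB])
  next
    case False
    show ?thesis
    proof (rule pattern_imp_not_dpr_less[OF sk small\<mu> X small_image[OF Y] idxJ, where n = n and s = s and t = t and \<Phi> = \<Phi>])
      show "finite (coords (J \<alpha>))" if "\<alpha> \<in> Field \<mu>" for \<alpha> using wit[OF that] by (simp add: J)
      show "increasing (J \<alpha>) (n \<alpha>) (s \<alpha>)" "increasing (J \<alpha>) (n \<alpha>) (t \<alpha>)" if "\<alpha> \<in> Field \<mu>" for \<alpha>
        using wit[OF that] by (auto intro!: IJ)
      show "definable L M (e ` Y) (X <+> ({..<n \<alpha>} \<times> coords (J \<alpha>))) (\<Phi> \<alpha>)" if "\<alpha> \<in> Field \<mu>" for \<alpha>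
        unfolding J using wit[OF that] by (auto intro: definable_mono[OF _ AB])
      show "tp L M X a0 (e ` Y) \<subseteq> forms (lang_over L (e ` Y)) X" by (rule p(1))
    next
      fix F P \<Delta> and N :: nat
      assume F: "finite F" "F \<subseteq> Field \<mu>" and P: "finite P" "P \<subseteq> points \<mu> J"
        and FP: "\<And>\<alpha> l. \<alpha> \<in> F \<Longrightarrow> l < n \<alpha> \<Longrightarrow> (\<alpha>, s \<alpha> l) \<in> P \<and> (\<alpha>, t \<alpha> l) \<in> P"
        and \<Delta>: "finite \<Delta>" "\<Delta> \<subseteq> tp L M X a0 (e ` Y)"
      show "\<exists>C. \<forall>v\<in>nsets {..<N} (card P). \<exists>a. realizes M a \<Delta> \<and>
        (\<forall>\<alpha>\<in>F. separates \<Phi> s t C (\<lambda>q. nth_of v (rank \<mu> J P q)) a \<alpha>)"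
      proof (rule not_shattering_pattern[OF _ tpb mut sk JI _ _ _ _ F P FP \<Delta>(1)])
        show "\<not> shattering Q" if "definable L M A (Y <+> X) Q" for Q using False that by blast
        show "finite (coords (J \<alpha>)) \<and> coords (J \<alpha>) \<subseteq> coords (I \<alpha>)" if "\<alpha> \<in> Field \<mu>" for \<alpha>
          using wit[OF that] by (simp add: J)
        show "infinite (idx (J \<alpha>)) \<and> idx (J \<alpha>) \<subseteq> idx (I \<alpha>)" if "\<alpha> \<in> Field \<mu>" for \<alpha>
          using wit[OF that] by (simp add: J)
        show "definable L M A (X <+> ({..<n \<alpha>} \<times> coords (J \<alpha>))) (\<Phi> \<alpha>)" if "\<alpha> \<in> Field \<mu>" for \<alpha>
          using wit[OF that] by (simp add: J)
        show "\<Phi> \<alpha> (case_sum b (\<lambda>(l, k). trm_at (I \<alpha>) (s \<alpha> l) k)) \<noteq>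
            \<Phi> \<alpha> (case_sum b (\<lambda>(l, k). trm_at (I \<alpha>) (t \<alpha> l) k))" if "\<alpha> \<in> Field \<mu>" for \<alpha>
          using wit[OF that] by (elim conjE)
        show "\<Delta> \<subseteq> forms (lang_over L (e ` Y)) X" "realizes M a0 \<Delta>"
          using \<Delta>(2) p unfolding realizes_def by auto
      qed
    qed
  qed
  with less show False by simp
qed

end

theorem proposition3p4:
  fixes L :: "('f, 'r) lang" and T :: "('f, 'r, nat) fml set"
    and \<C> :: "('f, 'r, 'm) struc" and \<kappa> :: "'v rel"
    and X :: "'v set" and A B :: "'m set" and p :: "('f + 'm, 'r, 'v) fml set"
  assumes "complete_theory L T"
    and "monster_model \<kappa> L T \<C>"
    and "small \<kappa> X" and "small \<kappa> B"
    and "A \<subseteq> B"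
    and "p \<in> complete_types L \<C> X B"
    and "\<not> co_forks L \<C> X p B A"
  shows "dpr_eq \<kappa> L \<C> X B p A (restrict_type L p A)"
proof -
  interpret monster \<kappa> L \<C>
    using assms(2) unfolding monster_model_def by unfold_locales auto
  have p: "p \<subseteq> forms (lang_over L B) X" "fin_sat \<C> p"
    "\<And>\<phi>. \<phi> \<in> forms (lang_over L B) X \<Longrightarrow> \<phi> \<in> p \<or> Neg \<phi> \<in> p"
    using assms(6) unfolding complete_types_def by auto
  have "\<exists>a. \<forall>\<phi>\<in>p. sat (named \<C>) a \<phi>"
  proof (rule realize[OF assms(4,3)])
    show "definable L \<C> B X (\<lambda>a. sat (named \<C>) a \<phi>)" if "\<phi> \<in> p" for \<phi>
      using p(1) that by (intro definable_form) blast
    show "\<exists>a. \<forall>\<phi>\<in>\<Delta>. sat (named \<C>) a \<phi>" if "\<Delta> \<subseteq> p" "finite \<Delta>" for \<Delta>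
      using p(2) that unfolding fin_sat_def realizes_def by blast
  qed
  then obtain a where a: "\<forall>\<phi>\<in>p. sat (named \<C>) a \<phi>" by (rule exE)
  have p_tp: "p = tp L \<C> X a B"
  proof
    show "p \<subseteq> tp L \<C> X a B" using p(1) a unfolding tp_def by blast
    show "tp L \<C> X a B \<subseteq> p"
    proof
      fix \<phi> assume \<phi>: "\<phi> \<in> tp L \<C> X a B"
      then have "\<phi> \<in> p \<or> Neg \<phi> \<in> p" by (intro p(3)) (simp add: tp_def)
      moreover have "Neg \<phi> \<notin> p"
      proof
        assume "Neg \<phi> \<in> p"
        with a have "sat (named \<C>) a (Neg \<phi>)" by (rule bspec)
        then show False using \<phi> by (simp add: tp_def)
      qed
      ultimately show "\<phi> \<in> p" by simp
    qed
  qed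
  have restr: "restrict_type L p A = tp L \<C> X a A"
    unfolding restrict_type_def p_tp tp_def forms_def using wf_fml_mono[OF assms(5)] by blast
  obtain j :: "'m \<Rightarrow> 'v" where j: "inj_on j B" by (rule small_embeds[OF assms(4)])
  define Y where "Y = j ` B"
  define e where "e = inv_into B j"
  have bij: "bij_betw e Y B"
    unfolding e_def Y_def by (rule bij_betw_inv_into) (simp add: bij_betw_def j)
  then have eY: "e ` Y = B" by (simp add: bij_betw_def)
  have "realizes \<C> a p" using a by (simp add: realizes_def)
  then have "\<not> forks L \<C> Y (tp L \<C> Y e (a ` X \<union> A)) A"
    using assms(7) bij unfolding co_forks_def tp_co_forks_def by blast
  moreover have "small \<kappa> Y" unfolding Y_def by (rule small_image[OF assms(4)])
  moreover have "small \<kappa> A" by (rule small_subset[OF assms(5,4)])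
  ultimately interpret nonforking \<kappa> L \<C> X Y A a e
    using assms(3) by unfold_locales
  show ?thesis
    unfolding dpr_eq_def
  proof (intro allI impI, elim conjE)
    fix \<mu> :: "'v rel" assume \<mu>: "Card_order \<mu>" "\<mu> <o \<kappa>"
    show "dpr_less \<kappa> L \<C> X B p \<mu> \<longleftrightarrow> dpr_less \<kappa> L \<C> X A (restrict_type L p A) \<mu>"
    proof
      assume less: "dpr_less \<kappa> L \<C> X B p \<mu>"
      show "dpr_less \<kappa> L \<C> X A (restrict_type L p A) \<mu>"
        unfolding restr
        by (rule dpr_less_restrict[OF _ \<mu>, unfolded eY, OF assms(5) less[unfolded p_tp]])
    next
      assume "dpr_less \<kappa> L \<C> X A (restrict_type L p A) \<mu>"
      then show "dpr_less \<kappa> L \<C> X B p \<mu>"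
        by (rule dpr_less_base[OF _ assms(4,5)]) (auto simp: restrict_type_def)
    qed
  qed
qed

end
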